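(* Let $\Gamma$ be the simplicial graph with vertex set $\{v_1,v_2,v_3,v_4,w_1,w_2,w_3,w_4\}$ and edges $v_1v_2,\ v_2v_3,\ v_3v_4,\ v_4v_1,\ w_1w_2,\ w_2w_3,\ w_3w_4,\ w_4w_1,\ v_1w_2,\ w_2v_3,\ v_3w_4,\ w_4v_1$, and let $W$ be the right-angled Coxeter group with defining graph $\Gamma$. Then $W$ acts geometrically on the Croke–Kleiner space $X$ tiled by unit squares.
   Context: The right-angled Coxeter group with defining graph $\Gamma$ is the group generated by the vertices of $\Gamma$, subject to the relations that each vertex has order 2 and that two vertices joined by an edge commute. Croke–Kleiner space tiled by unit squares: let $T_1,T_2,T_3$ be flat tori, each obtained from a unit Euclidean square by identifying opposite sides by translation. Let the two perpendicular simple closed geodesics of length 1 coming from the sides of the square be $a,b_1$ in $T_1$, $b,c$ in $T_2$, and $c_1,d$ in $T_3$. Let $Y$ be the union of $T_1,T_2,T_3$ with $b_1$ identified isometrically with $b$ and $c_1$ identified isometrically with $c$. Then $X$ is the universal cover of $Y$ with the induced length metric; it is a CAT(0) square complex. A group acts geometrically on a metric space if it acts properly discontinuously, cocompactly, and by isometries. *)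

theory Defs
  imports "HOL-Analysis.Analysis" "HOL-Algebra.Group_Action"
begin

section \<open>Group presentations and right-angled Coxeter groups\<close>

text \<open>A word over the generating set \<open>S\<close> is a list of letters \<open>(s, b)\<close>, where \<open>(s, True)\<close> stands
  for \<open>s\<close> and \<open>(s, False)\<close> for the inverse of \<open>s\<close>.\<close>

type_synonym 's word = "('s \<times> bool) list"

definition words :: "'s set \<Rightarrow> 's word set" where
  "words S = lists (S \<times> UNIV)"

inductive elementary_reduction :: "'s set \<Rightarrow> 's word set \<Rightarrow> 's word \<Rightarrow> 's word \<Rightarrow> bool"
  for S :: "'s set" and R :: "'s word set"
where
  cancel: "\<lbrakk>u \<in> words S; v \<in> words S; s \<in> S\<rbrakk>
    \<Longrightarrow> elementary_reduction S R (u @ [(s, b), (s, \<not> b)] @ v) (u @ v)"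
| relator: "\<lbrakk>u \<in> words S; v \<in> words S; r \<in> R \<inter> words S\<rbrakk>
    \<Longrightarrow> elementary_reduction S R (u @ r @ v) (u @ v)"

definition presentation_rel :: "'s set \<Rightarrow> 's word set \<Rightarrow> 's word rel" where
  "presentation_rel S R =
    {(u, v). u \<in> words S \<and> v \<in> words S \<and> equivclp (elementary_reduction S R) u v}"

definition presented_group :: "'s set \<Rightarrow> 's word set \<Rightarrow> 's word set monoid" where
  "presented_group S R =
    \<lparr>carrier = words S // presentation_rel S R,
     monoid.mult = (\<lambda>A B. \<Union>u\<in>A. \<Union>v\<in>B. presentation_rel S R `` {u @ v}),
     one = presentation_rel S R `` {[]}\<rparr>"

text \<open>The relators are the squares of the vertices and the commutators of adjacent vertices.\<close>

definition right_angled_coxeter_group :: "'v set \<Rightarrow> 'v set set \<Rightarrow> 'v word set monoid" where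
  "right_angled_coxeter_group V E = presented_group V
    ({[(v, True), (v, True)] | v. v \<in> V} \<union>
     {[(v, True), (w, True), (v, False), (w, False)] | v w. v \<in> V \<and> w \<in> V \<and> {v, w} \<in> E})"

datatype vertex = v1 | v2 | v3 | v4 | w1 | w2 | w3 | w4

definition Gamma_edges :: "vertex set set" where
  "Gamma_edges =
    {{v1, v2}, {v2, v3}, {v3, v4}, {v4, v1},
     {w1, w2}, {w2, w3}, {w3, w4}, {w4, w1},
     {v1, w2}, {w2, v3}, {v3, w4}, {w4, v1}}"


section \<open>Gluing metric spaces\<close>

text \<open>The disjoint union of a family of metric spaces is represented by a set \<open>P\<close> of pairs
  \<open>(i, x)\<close>, where \<open>i\<close> names the piece; points in different pieces are infinitely far apart.
  For an equivalence relation \<open>R\<close> on \<open>P\<close>, the quotient pseudometric between two classes is the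
  infimum of the total lengths of the chains that jump inside the pieces and pass for free
  between \<open>R\<close>-related points.\<close>

definition gluing_chains ::
  "('i \<times> 'a::metric_space) set \<Rightarrow> ('i \<times> 'a) rel \<Rightarrow> ('i \<times> 'a) set \<Rightarrow> ('i \<times> 'a) set
    \<Rightarrow> (('i \<times> 'a) \<times> ('i \<times> 'a)) list set"
where
  "gluing_chains P R A B =
    {c. c \<noteq> [] \<and>
        (\<forall>(x, y) \<in> set c. x \<in> P \<and> y \<in> P \<and> fst x = fst y) \<and>
        fst (hd c) \<in> A \<and> snd (last c) \<in> B \<and>
        (\<forall>k. Suc k < length c \<longrightarrow> (snd (c ! k), fst (c ! Suc k)) \<in> R)}"

definition quotient_dist ::
  "('i \<times> 'a::metric_space) set \<Rightarrow> ('i \<times> 'a) rel \<Rightarrow> ('i \<times> 'a) set \<Rightarrow> ('i \<times> 'a) set \<Rightarrow> real"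
where
  "quotient_dist P R A B =
    enn2real (INF c \<in> gluing_chains P R A B. ennreal (\<Sum>(x, y)\<leftarrow>c. dist (snd x) (snd y)))"


section \<open>The three tori\<close>

text \<open>The torus \<open>Ti\<close> is the unit square \<open>{(i, s, t). 0 \<le> s, t \<le> 1}\<close> (\<open>dist\<close> on \<^typ>\<open>real \<times> real\<close> is
  Euclidean) with opposite sides identified. Its two closed geodesics are the images of the sides
  \<open>t = 0\<close> and \<open>s = 0\<close>, that is, respectively,
  \<open>a\<close> and \<open>b\<^sub>1\<close> in \<open>T1\<close>, \<open>b\<close> and \<open>c\<close> in \<open>T2\<close>, \<open>c\<^sub>1\<close> and \<open>d\<close> in \<open>T3\<close>.
  They are identified by their arc length parameters; any other isometric identification
  differs from this one by an isometry of \<open>T1\<close> or \<open>T3\<close> and so yields an isometric space.\<close>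

datatype torus = T1 | T2 | T3

type_synonym square_point = "torus \<times> real \<times> real"

definition unit_squares :: "square_point set" where
  "unit_squares = UNIV \<times> {0..1} \<times> {0..1}"

definition side_pairings :: "square_point rel" where
  "side_pairings =
    {((i, 0, t), (i, 1, t)) | i t. t \<in> {0..1}} \<union> {((i, s, 0), (i, s, 1)) | i s. s \<in> {0..1}}"

definition geodesic_gluings :: "square_point rel" where
  "geodesic_gluings =
    {((T1, 0, t), (T2, t, 0)) | t. t \<in> {0..1}} \<union>
    {((T2, 0, t), (T3, t, 0)) | t. t \<in> {0..1}}"

definition Y_rel :: "square_point rel" where
  "Y_rel = Restr ((side_pairings \<union> geodesic_gluings \<union> (side_pairings \<union> geodesic_gluings)\<inverse>)\<^sup>*)
             unit_squares"

definition Y_space :: "square_point set set" where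
  "Y_space = unit_squares // Y_rel"

definition Y_dist :: "square_point set \<Rightarrow> square_point set \<Rightarrow> real" where
  "Y_dist = quotient_dist unit_squares Y_rel"

definition Y_topology :: "square_point set topology" where
  "Y_topology = Metric_space.mtopology Y_space Y_dist"


section \<open>Universal covers and the induced length metric\<close>

text \<open>The analogue for abstract topologies of \<^const>\<open>covering_space\<close>.\<close>

definition covering_map :: "'a topology \<Rightarrow> 'b topology \<Rightarrow> ('a \<Rightarrow> 'b) \<Rightarrow> bool" where
  "covering_map X Y p \<longleftrightarrow>
    continuous_map X Y p \<and> p ` topspace X = topspace Y \<and>
    (\<forall>y \<in> topspace Y. \<exists>U. openin Y U \<and> y \<in> U \<and>
      (\<exists>\<V>. \<Union>\<V> = {x \<in> topspace X. p x \<in> U} \<and>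
           (\<forall>V \<in> \<V>. openin X V) \<and> pairwise disjnt \<V> \<and>
           (\<forall>V \<in> \<V>. homeomorphic_map (subtopology X V) (subtopology Y U) p)))"

definition simply_connected_space :: "'a topology \<Rightarrow> bool" where
  "simply_connected_space X \<longleftrightarrow>
    path_connected_space X \<and>
    (\<forall>g x. pathin X g \<and> g 0 = x \<and> g 1 = x \<longrightarrow>
      homotopic_with (\<lambda>h. h 0 = x \<and> h 1 = x) (top_of_set {0..1}) X g (\<lambda>_. x))"

definition universal_cover :: "'a topology \<Rightarrow> 'b topology \<Rightarrow> ('a \<Rightarrow> 'b) \<Rightarrow> bool" where
  "universal_cover X Y p \<longleftrightarrow> covering_map X Y p \<and> simply_connected_space X"

definition curve_length :: "('a \<Rightarrow> 'a \<Rightarrow> real) \<Rightarrow> (real \<Rightarrow> 'a) \<Rightarrow> ennreal" where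
  "curve_length d g =
    (SUP ts \<in> {ts. sorted ts \<and> set ts \<subseteq> {0..1}}.
      \<Sum>k < length ts - 1. ennreal (d (g (ts ! k)) (g (ts ! Suc k))))"

text \<open>The length of a curve upstairs is the length of its projection.\<close>

definition induced_length_dist ::
  "'a topology \<Rightarrow> ('a \<Rightarrow> 'b) \<Rightarrow> ('b \<Rightarrow> 'b \<Rightarrow> real) \<Rightarrow> 'a \<Rightarrow> 'a \<Rightarrow> real"
where
  "induced_length_dist X p d x y =
    enn2real (INF g \<in> {g. pathin X g \<and> g 0 = x \<and> g 1 = y}. curve_length d (p \<circ> g))"


section \<open>Geometric actions\<close>

definition geometric_action ::
  "('g, 'm) monoid_scheme \<Rightarrow> 'a set \<Rightarrow> ('a \<Rightarrow> 'a \<Rightarrow> real) \<Rightarrow> ('g \<Rightarrow> 'a \<Rightarrow> 'a) \<Rightarrow> bool"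
where
  "geometric_action G M d \<phi> \<longleftrightarrow>
    Metric_space M d \<and> group_action G M \<phi> \<and>
    (\<forall>g \<in> carrier G. \<forall>x \<in> M. \<forall>y \<in> M. d (\<phi> g x) (\<phi> g y) = d x y) \<and>
    (\<forall>K. compactin (Metric_space.mtopology M d) K \<longrightarrow>
      finite {g \<in> carrier G. \<phi> g ` K \<inter> K \<noteq> {}}) \<and>
    (\<exists>K. compactin (Metric_space.mtopology M d) K \<and> (\<Union>g \<in> carrier G. \<phi> g ` K) = M)"

end

theory Submission
  imports Defs
begin

text \<open>The complex \<open>Y\<close> has one vertex, four loops \<open>a, b, c, d\<close> and three squares, one for each of the
  pairs \<open>{a, b}\<close>, \<open>{b, c}\<close>, \<open>{c, d}\<close>. For every set of loops there is an isometry of \<open>Y\<close> that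
  reverses exactly these loops (\<open>reflect\<close>), and \<open>W\<close> acts on \<open>X\<close> by lifts of these sixteen
  isometries. Indeed \<open>\<Gamma>\<close> is the link of the vertex of \<open>Y\<close>: its vertices stand for the two directions
  of the four loops, namely \<open>v\<^sub>2, v\<^sub>4\<close> for \<open>a\<close>, then \<open>v\<^sub>1, v\<^sub>3\<close> for \<open>b\<close>, \<open>w\<^sub>2, w\<^sub>4\<close> for \<open>c\<close> and
  \<open>w\<^sub>1, w\<^sub>3\<close> for \<open>d\<close>, and its edges are the corners of the squares. Fix a vertex \<open>x\<^sub>0\<close> of \<open>X\<close>. A
  vertex of \<open>\<Gamma>\<close> that stands for a direction of the loop \<open>l\<close> acts by that lift of the reversal of
  \<open>l\<close> which takes \<open>x\<^sub>0\<close> to the other end of the edge leaving \<open>x\<^sub>0\<close> in this direction. The lift exchanges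
  the ends of the edge, so its square fixes \<open>x\<^sub>0\<close>; and for two loops of one torus the two
  products of lifts agree at \<open>x\<^sub>0\<close> because the squares of \<open>X\<close> close up. As a lift is determined by the image
  of one point, the defining relations of \<open>W\<close> hold (\<open>relator_value\<close>).

  \<^emph>\<open>Discontinuity.\<close> Only the image of \<open>x\<^sub>0\<close> under an element of \<open>W\<close> is needed to recover the element
  (\<open>act_determines_class\<close>). To see this, one builds from \<open>W\<close> a covering of \<open>Y\<close> with discrete fibre, by
  prescribing what happens to the fibre at the midpoints of the loops (\<open>holonomy_cocycle\<close>). The
  pullback of this covering to the simply connected space \<open>X\<close> has a section (\<open>cocycle_trivial\<close>), and
  the section has the value \<open>g\<close> at the vertex \<open>g x\<^sub>0\<close>. Since distinct points of a fibre of \<open>X \<rightarrow> Y\<close> have at least a fixed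
  distance (\<open>fibres_uniformly_separated\<close>), a totally bounded set meets only finitely many of its
  translates.

  \<^emph>\<open>Cocompactness.\<close> The chains that define the distance of \<open>Y\<close> lift to \<open>X\<close>, segment by segment
  (\<open>chain_lift\<close>). This yields short paths in \<open>X\<close>, hence the metric, and it shows that any
  two points of \<open>X\<close> are linked by finitely many flats, each of which meets the next. If two flats meet and one of them
  has its lattice points in the orbit of \<open>x\<^sub>0\<close>, then so has the other; therefore all vertices of
  \<open>X\<close> are in the orbit (\<open>flat_corner_in_orbit\<close>), and the translates of the squares at \<open>x\<^sub>0\<close> cover \<open>X\<close>.

  Both uses of simple connectivity, the existence of lifts and that of the section, rest on the
  lifting criterion for covering maps of abstract topologies, which is proved first.\<close>

section \<open>Lifting through covering maps of abstract topological spaces\<close>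

definition evenly_covered :: "'a topology \<Rightarrow> 'b topology \<Rightarrow> ('a \<Rightarrow> 'b) \<Rightarrow> 'b set \<Rightarrow> 'a set set \<Rightarrow> bool" where
  "evenly_covered E B q U \<V> \<longleftrightarrow> openin B U \<and> \<Union>\<V> = {x \<in> topspace E. q x \<in> U} \<and>
     (\<forall>V \<in> \<V>. openin E V) \<and> pairwise disjnt \<V> \<and>
     (\<forall>V \<in> \<V>. homeomorphic_map (subtopology E V) (subtopology B U) q)"

lemma covering_map_evenly_covered:
  assumes "covering_map E B q" "y \<in> topspace B"
  obtains U \<V> where "evenly_covered E B q U \<V>" "y \<in> U"
  using assms unfolding covering_map_def evenly_covered_def by meson

lemma covering_map_continuous: "covering_map E B q \<Longrightarrow> continuous_map E B q"
  and covering_map_surj: "covering_map E B q \<Longrightarrow> q ` topspace E = topspace B"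
  by (simp_all add: covering_map_def)

lemma evenly_covered_sheet:
  assumes "evenly_covered E B q U \<V>" "e \<in> topspace E" "q e \<in> U"
  obtains V where "V \<in> \<V>" "e \<in> V" "openin E V" "V \<subseteq> topspace E" "q ` V = U" "inj_on q V"
    "homeomorphic_map (subtopology E V) (subtopology B U) q"
proof -
  obtain V where V: "V \<in> \<V>" "e \<in> V"
    using assms unfolding evenly_covered_def by blast
  then have o: "openin E V" and h: "homeomorphic_map (subtopology E V) (subtopology B U) q"
    and U: "openin B U"
    using assms unfolding evenly_covered_def by blast+
  have sub: "V \<subseteq> topspace E" "U \<subseteq> topspace B"
    using o U by (auto dest: openin_subset)
  have "q ` V = U" "inj_on q V"
    using homeomorphic_imp_surjective_map[OF h] homeomorphic_imp_injective_map[OF h] sub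
    by (simp_all add: Int_absorb1)
  with V o h sub show ?thesis using that by blast
qed

lemma connected_space_local_relation:
  assumes X: "connected_space X"
    and loc: "\<And>x. x \<in> topspace X \<Longrightarrow> \<exists>N. openin X N \<and> x \<in> N \<and> (\<forall>z\<in>N. R x z)"
    and sym: "\<And>x y. R x y \<Longrightarrow> R y x" and trans: "\<And>x y z. R x y \<Longrightarrow> R y z \<Longrightarrow> R x z"
    and x: "x \<in> topspace X" and y: "y \<in> topspace X"
  shows "R x y"
proof -
  define S T where "S = {z \<in> topspace X. R x z}" and "T = {z \<in> topspace X. \<not> R x z}"
  have "openin X S"
  proof (subst openin_subopen, intro ballI)
    fix z assume z: "z \<in> S"
    then obtain N where N: "openin X N" "z \<in> N" "\<forall>w\<in>N. R z w" using loc unfolding S_def by blast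
    then have "N \<subseteq> S" using z trans openin_subset[OF N(1)] unfolding S_def by blast
    then show "\<exists>N. openin X N \<and> z \<in> N \<and> N \<subseteq> S" using N by blast
  qed
  moreover have "openin X T"
  proof (subst openin_subopen, intro ballI)
    fix z assume z: "z \<in> T"
    then obtain N where N: "openin X N" "z \<in> N" "\<forall>w\<in>N. R z w" using loc unfolding T_def by blast
    then have "N \<subseteq> T" using z trans sym openin_subset[OF N(1)] unfolding T_def by blast
    then show "\<exists>N. openin X N \<and> z \<in> N \<and> N \<subseteq> T" using N by blast
  qed
  moreover have "topspace X \<subseteq> S \<union> T" "S \<inter> T = {}" unfolding S_def T_def by blast+
  moreover have "x \<in> S"
  proof -
    obtain N where "x \<in> N" "\<forall>z\<in>N. R x z" using loc x by blast
    then show ?thesis unfolding S_def using x by blast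
  qed
  then have "S \<noteq> {}" by blast
  ultimately have "T = {}" using X unfolding connected_space_def by metis
  then show ?thesis using y unfolding T_def by blast
qed

text \<open>Near every point both lifts stay in one sheet each. The two sheets are equal or
  disjoint, so whether the lifts agree is locally constant.\<close>

lemma lift_unique:
  assumes q: "covering_map E B q" and Z: "connected_space Z"
    and F: "continuous_map Z E F" and G: "continuous_map Z E G"
    and FG: "\<And>z. z \<in> topspace Z \<Longrightarrow> q (F z) = q (G z)"
    and a: "a \<in> topspace Z" "F a = G a" and z: "z \<in> topspace Z"
  shows "F z = G z"
proof -
  have *: "\<exists>N. openin Z N \<and> z \<in> N \<and> (\<forall>x\<in>N. (F x = G x) = (F z = G z))" if z: "z \<in> topspace Z" for z
  proof -
    have E: "F z \<in> topspace E" "G z \<in> topspace E"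
      using F G z by (auto simp: continuous_map_def)
    then have "q (F z) \<in> topspace B"
      using covering_map_surj[OF q] by blast
    then obtain U \<V> where U: "evenly_covered E B q U \<V>" "q (F z) \<in> U"
      by (rule covering_map_evenly_covered[OF q])
    obtain V where V: "V \<in> \<V>" "F z \<in> V" "openin E V" "inj_on q V"
      by (rule evenly_covered_sheet[OF U(1) E(1) U(2)])
    have "q (G z) \<in> U" using U(2) FG z by simp
    then obtain V' where V': "V' \<in> \<V>" "G z \<in> V'" "openin E V'" "inj_on q V'"
      by (rule evenly_covered_sheet[OF U(1) E(2)])
    let ?N = "{x \<in> topspace Z. F x \<in> V} \<inter> {x \<in> topspace Z. G x \<in> V'}"
    have "openin Z ?N"
      using F G V(3) V'(3) by (auto intro!: openin_Int openin_continuous_map_preimage)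
    moreover have "z \<in> ?N" using z V V' by simp
    moreover have "(F x = G x) = (F z = G z)" if x: "x \<in> ?N" for x
    proof (cases "V = V'")
      case True
      then show ?thesis using V(4) V(2) V'(2) x FG z by (auto dest: inj_onD)
    next
      case False
      then have "V \<inter> V' = {}" using U(1) V(1) V'(1)
        unfolding evenly_covered_def pairwise_def disjnt_def by blast
      then show ?thesis using V V' x by auto
    qed
    ultimately show ?thesis by blast
  qed
  have "(F a = G a) = (F z = G z)"
  proof (rule connected_space_local_relation[OF Z _ _ _ a(1) z])
    show "\<exists>N. openin Z N \<and> x \<in> N \<and> (\<forall>y\<in>N. (F x = G x) = (F y = G y))" if "x \<in> topspace Z" for x
      using *[OF that] by metis
  qed simp_all
  then show ?thesis using a(2) by simp
qed

lemma lift_into_evenly_covered: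
  assumes U: "evenly_covered E B q U \<V>"
    and f: "continuous_map Z B f" "f ` topspace Z \<subseteq> U"
    and z: "z \<in> topspace Z" and e: "e \<in> topspace E" "q e = f z"
  obtains F where "continuous_map Z E F" "\<And>x. x \<in> topspace Z \<Longrightarrow> q (F x) = f x" "F z = e"
proof -
  have "q e \<in> U" using f z e by auto
  obtain V where V: "e \<in> V" "V \<subseteq> topspace E" "q ` V = U" "inj_on q V"
    "homeomorphic_map (subtopology E V) (subtopology B U) q"
    by (rule evenly_covered_sheet[OF U e(1) \<open>q e \<in> U\<close>])
  then obtain r where r: "homeomorphic_maps (subtopology E V) (subtopology B U) q r"
    using homeomorphic_map_maps by blast
  have top: "topspace (subtopology E V) = V" "topspace (subtopology B U) = U"
    using V(2) U by (auto simp: evenly_covered_def dest: openin_subset)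
  have cr: "continuous_map (subtopology B U) E r"
    using r by (auto simp: homeomorphic_maps_def continuous_map_in_subtopology)
  have cf: "continuous_map Z (subtopology B U) f"
    using f by (auto simp: continuous_map_in_subtopology)
  show ?thesis
  proof
    show "continuous_map Z E (r \<circ> f)" by (rule continuous_map_compose[OF cf cr])
    show "q ((r \<circ> f) x) = f x" if "x \<in> topspace Z" for x
      using r f that top unfolding homeomorphic_maps_def by auto
    show "(r \<circ> f) z = e"
      using r e V(1) top unfolding homeomorphic_maps_def by (metis comp_apply)
  qed
qed

text \<open>Unlike the existence of a single lift, the existence of a lift through every point above
  \<open>S\<close> is inherited by unions.\<close>

definition lifts_over :: "'a topology \<Rightarrow> ('a \<Rightarrow> 'b) \<Rightarrow> ('z::topological_space \<Rightarrow> 'b) \<Rightarrow> 'z set \<Rightarrow> bool" where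
  "lifts_over E q f S \<longleftrightarrow> (\<forall>z\<in>S. \<forall>e \<in> topspace E. q e = f z \<longrightarrow>
     (\<exists>F. continuous_map (top_of_set S) E F \<and> (\<forall>x\<in>S. q (F x) = f x) \<and> F z = e))"

lemma lifts_overD:
  assumes "lifts_over E q f S" "z \<in> S" "e \<in> topspace E" "q e = f z"
  obtains F where "continuous_map (top_of_set S) E F" "\<And>x. x \<in> S \<Longrightarrow> q (F x) = f x" "F z = e"
  using assms unfolding lifts_over_def by metis

text \<open>The lift over \<open>T\<close> is chosen to agree with the lift over \<open>S\<close> at one point of the
  connected intersection. By uniqueness they agree on the whole of it, and since the sets are closed the union of the lifts is
  continuous.\<close>

lemma lifts_over_Un_aux:
  assumes q: "covering_map E B q" and S: "lifts_over E q f S" and T: "lifts_over E q f T"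
    and cl: "closed S" "closed T" and ST: "connected (S \<inter> T)" "S \<inter> T \<noteq> {}"
    and z: "z \<in> S" and e: "e \<in> topspace E" "q e = f z"
  shows "\<exists>F. continuous_map (top_of_set (S \<union> T)) E F \<and> (\<forall>x\<in>S \<union> T. q (F x) = f x) \<and> F z = e"
proof -
  obtain F where F: "continuous_map (top_of_set S) E F" "\<And>x. x \<in> S \<Longrightarrow> q (F x) = f x" "F z = e"
    using lifts_overD[OF S z e] by metis
  obtain w where w: "w \<in> S" "w \<in> T" using ST by blast
  have "F w \<in> topspace E" using F(1) w by (auto simp: continuous_map_def)
  then obtain G where G: "continuous_map (top_of_set T) E G" "\<And>x. x \<in> T \<Longrightarrow> q (G x) = f x" "G w = F w"
    using lifts_overD[OF T w(2), of "F w"] F(2)[OF w(1)] by metis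
  have FG: "F x = G x" if "x \<in> S \<inter> T" for x
  proof -
    let ?I = "top_of_set (S \<inter> T)"
    have I: "connected_space ?I" using ST by (simp add: connectedin_def flip: connectedin_iff_connected)
    have c: "continuous_map ?I E F" "continuous_map ?I E G"
      using F(1) G(1) by (auto intro: continuous_map_from_subtopology_mono)
    show ?thesis
      by (rule lift_unique[OF q I c, of w]) (use F G w that in auto)
  qed
  define H where "H = (\<lambda>x. if x \<in> S then F x else G x)"
  have "continuous_map (top_of_set (S \<union> T)) E H"
  proof (rule pasting_lemma_closed[where I = "UNIV :: bool set" and T = "\<lambda>b. if b then S else T"
        and f = "\<lambda>b. if b then F else G"])
    show "closedin (top_of_set (S \<union> T)) (if b then S else T)" for b
      using closed_subset[of S "S \<union> T"] closed_subset[of T "S \<union> T"] cl by simp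
    show "continuous_map (subtopology (top_of_set (S \<union> T)) (if b then S else T)) E (if b then F else G)" for b
      using F(1) G(1) by (cases b) (simp_all add: subtopology_subtopology Int_absorb1)
    show "(if i then F else G) x = (if j then F else G) x"
      if "x \<in> topspace (top_of_set (S \<union> T)) \<inter> (if i then S else T) \<inter> (if j then S else T)" for i j x
      using that FG by (auto split: if_splits)
    show "\<exists>j. j \<in> UNIV \<and> x \<in> (if j then S else T) \<and> H x = (if j then F else G) x"
      if "x \<in> topspace (top_of_set (S \<union> T))" for x
    proof (cases "x \<in> S")
      case True then show ?thesis by (intro exI[of _ True]) (auto simp: H_def)
    next
      case False then show ?thesis using that by (intro exI[of _ False]) (auto simp: H_def)
    qed
  qed auto
  moreover have "\<forall>x\<in>S \<union> T. q (H x) = f x" using F(2) G(2) by (auto simp: H_def)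
  moreover have "H z = e" using z F(3) by (simp add: H_def)
  ultimately show ?thesis by blast
qed

lemma lifts_over_Un:
  assumes "covering_map E B q" "lifts_over E q f S" "lifts_over E q f T"
    and "closed S" "closed T" "connected (S \<inter> T)" "S \<inter> T \<noteq> {}"
  shows "lifts_over E q f (S \<union> T)"
  unfolding lifts_over_def
proof (intro ballI impI)
  fix z e assume z: "z \<in> S \<union> T" and e: "e \<in> topspace E" "q e = f z"
  show "\<exists>F. continuous_map (top_of_set (S \<union> T)) E F \<and> (\<forall>x\<in>S \<union> T. q (F x) = f x) \<and> F z = e"
  proof (cases "z \<in> S")
    case True
    then show ?thesis using lifts_over_Un_aux[OF assms True e] by blast
  next
    case False
    then have "z \<in> T" using z by blast
    then show ?thesis
      using lifts_over_Un_aux[OF assms(1,3,2,5,4) _ _ \<open>z \<in> T\<close> e] assms(6,7)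
      by (metis Un_commute Int_commute)
  qed
qed

text \<open>Lifting over a rectangle: both sides are subdivided by bisection. For the outer bisection
  the width of a strip that can be lifted has to be uniform along the strip, which the
  inner bisection achieves by carrying the width along.\<close>

lemma lifts_over_rectangle:
  fixes f :: "real \<times> real \<Rightarrow> 'b"
  assumes q: "covering_map E B q" and f: "continuous_map (top_of_set ({a..b} \<times> {c..d})) B f"
    and ab: "a \<le> b" "c \<le> d"
  shows "lifts_over E q f ({a..b} \<times> {c..d})"
proof -
  let ?R = "{a..b} \<times> {c..d}"
  let ?L = "\<lambda>s t u v. s \<le> t \<longrightarrow> u \<le> v \<longrightarrow> a \<le> s \<longrightarrow> t \<le> b \<longrightarrow> c \<le> u \<longrightarrow> v \<le> d \<longrightarrow> lifts_over E q f ({s..t} \<times> {u..v})"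
  have small: "\<exists>r>0. \<forall>s t u v. s \<le> x \<and> x \<le> t \<and> t - s < r \<and> u \<le> y \<and> y \<le> v \<and> v - u < r \<longrightarrow> ?L s t u v"
    if xy: "a \<le> x" "x \<le> b" "c \<le> y" "y \<le> d" for x y
  proof -
    have "f (x,y) \<in> topspace B" using f xy by (auto simp: continuous_map_def)
    then obtain U \<V> where U: "evenly_covered E B q U \<V>" "f (x,y) \<in> U"
      by (rule covering_map_evenly_covered[OF q])
    have "openin (top_of_set ?R) {z \<in> topspace (top_of_set ?R). f z \<in> U}"
      using f U by (intro openin_continuous_map_preimage) (auto simp: evenly_covered_def)
    then obtain O' where O': "open O'" "{z \<in> ?R. f z \<in> U} = ?R \<inter> O'"
      by (auto simp: openin_open)
    have "(x,y) \<in> O'" using O' U xy by auto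
    then obtain A C where AC: "open A" "open C" "x \<in> A" "y \<in> C" "A \<times> C \<subseteq> O'"
      using open_prod_elim[OF O'(1) \<open>(x,y) \<in> O'\<close>] by (metis mem_Sigma_iff)
    obtain r1 where r1: "r1 > 0" "\<And>x'. dist x' x < r1 \<Longrightarrow> x' \<in> A" using AC by (metis open_dist)
    obtain r2 where r2: "r2 > 0" "\<And>x'. dist x' y < r2 \<Longrightarrow> x' \<in> C" using AC by (metis open_dist)
    show ?thesis
    proof (intro exI[of _ "min r1 r2"] conjI allI impI)
      fix s t u v
      assume *: "s \<le> x \<and> x \<le> t \<and> t - s < min r1 r2 \<and> u \<le> y \<and> y \<le> v \<and> v - u < min r1 r2"
        and st: "a \<le> s" "t \<le> b" "c \<le> u" "v \<le> d"
      have sub: "{s..t} \<times> {u..v} \<subseteq> ?R" using st by auto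
      have "{s..t} \<subseteq> A" using * r1(2) by (force simp: dist_real_def)
      moreover have "{u..v} \<subseteq> C" using * r2(2) by (force simp: dist_real_def)
      ultimately have fU: "f ` ({s..t} \<times> {u..v}) \<subseteq> U" using AC(5) O'(2) sub by blast
      show "lifts_over E q f ({s..t} \<times> {u..v})"
        unfolding lifts_over_def
      proof (intro ballI impI)
        fix z e assume z: "z \<in> {s..t} \<times> {u..v}" and e: "e \<in> topspace E" "q e = f z"
        have "continuous_map (top_of_set ({s..t} \<times> {u..v})) B f"
          using f sub by (rule continuous_map_from_subtopology_mono)
        then obtain F where "continuous_map (top_of_set ({s..t} \<times> {u..v})) E F"
          "\<And>x. x \<in> {s..t} \<times> {u..v} \<Longrightarrow> q (F x) = f x" "F z = e"
          using lift_into_evenly_covered[OF U(1), of "top_of_set ({s..t} \<times> {u..v})" f z e] z e fU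
          unfolding topspace_euclidean_subtopology by metis
        then show "\<exists>F. continuous_map (top_of_set ({s..t} \<times> {u..v})) E F \<and>
            (\<forall>x\<in>{s..t} \<times> {u..v}. q (F x) = f x) \<and> F z = e"
          by (intro exI[of _ F] conjI ballI)
      qed
    qed (use r1 r2 in auto)
  qed
  have strip: "\<exists>r>0. \<forall>s t. s \<le> x \<and> x \<le> t \<and> t - s < r \<longrightarrow> ?L s t u v"
    if x: "a \<le> x" "x \<le> b" and uv: "c \<le> u" "u \<le> v" "v \<le> d" for x u v
  proof -
    show ?thesis using \<open>u \<le> v\<close>
    proof (induction rule: Bolzano)
      case (trans u v w)
      obtain r1 where r1: "r1 > 0" "\<forall>s t. s \<le> x \<and> x \<le> t \<and> t - s < r1 \<longrightarrow> ?L s t u v"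
        using trans(1) by (elim exE conjE) (rule that)
      obtain r2 where r2: "r2 > 0" "\<forall>s t. s \<le> x \<and> x \<le> t \<and> t - s < r2 \<longrightarrow> ?L s t v w"
        using trans(2) by (elim exE conjE) (rule that)
      show ?case
      proof (intro exI[of _ "min r1 r2"] conjI allI impI)
        fix s t assume st: "s \<le> x \<and> x \<le> t \<and> t - s < min r1 r2" "s \<le> t" "a \<le> s" "t \<le> b" "c \<le> u" "w \<le> d"
        have "{s..t} \<times> {u..v} \<inter> {s..t} \<times> {v..w} = {s..t} \<times> {v}" using trans(3,4) by auto
        moreover have "connected ({s..t} \<times> {v})" by (intro connected_Times) auto
        moreover have "{s..t} \<times> {v} \<noteq> {}" using st by auto
        moreover have "lifts_over E q f ({s..t} \<times> {u..v})" "lifts_over E q f ({s..t} \<times> {v..w})"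
          using spec[OF spec[OF r1(2), of s], of t] spec[OF spec[OF r2(2), of s], of t] st trans(3,4) by auto
        ultimately have "lifts_over E q f ({s..t} \<times> {u..v} \<union> {s..t} \<times> {v..w})"
          by (intro lifts_over_Un[OF q]) (auto intro!: closed_Times)
        moreover have "{s..t} \<times> {u..v} \<union> {s..t} \<times> {v..w} = {s..t} \<times> {u..w}" using trans(3,4) by auto
        ultimately show "lifts_over E q f ({s..t} \<times> {u..w})" by simp
      qed (use r1 r2 in auto)
    next
      case (local y)
      have "c \<le> y" "y \<le> d" using local uv by auto
      obtain r where r: "r > 0"
        "\<forall>s t u v. s \<le> x \<and> x \<le> t \<and> t - s < r \<and> u \<le> y \<and> y \<le> v \<and> v - u < r \<longrightarrow> ?L s t u v"
        using small[OF x \<open>c \<le> y\<close> \<open>y \<le> d\<close>] by (elim exE conjE) (rule that)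
      show ?case
      proof (intro exI[of _ r] conjI r allI impI)
        fix u v s t
        assume "u \<le> y \<and> y \<le> v \<and> v - u < r" "s \<le> x \<and> x \<le> t \<and> t - s < r"
          "s \<le> t" "u \<le> v" "a \<le> s" "t \<le> b" "c \<le> u" "v \<le> d"
        then show "lifts_over E q f ({s..t} \<times> {u..v})" by (intro r(2)[rule_format]) auto
      qed
    qed
  qed
  have "?L a b c d"
  proof (rule Bolzano[where P = "\<lambda>s t. ?L s t c d", OF ab(1)])
    fix s x t assume trans: "?L s x c d" "?L x t c d" "s \<le> x" "x \<le> t"
    show "?L s t c d"
    proof (intro impI)
      assume st: "a \<le> s" "t \<le> b"
      have "{s..x} \<times> {c..d} \<inter> {x..t} \<times> {c..d} = {x} \<times> {c..d}" using trans(3,4) by auto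
      moreover have "connected ({x} \<times> {c..d})" by (intro connected_Times) auto
      moreover have "{x} \<times> {c..d} \<noteq> {}" using ab by auto
      moreover have "lifts_over E q f ({s..x} \<times> {c..d})" "lifts_over E q f ({x..t} \<times> {c..d})"
        using trans st ab by auto
      ultimately have "lifts_over E q f ({s..x} \<times> {c..d} \<union> {x..t} \<times> {c..d})"
        by (intro lifts_over_Un[OF q]) (auto intro!: closed_Times)
      moreover have "{s..x} \<times> {c..d} \<union> {x..t} \<times> {c..d} = {s..t} \<times> {c..d}" using trans(3,4) by auto
      ultimately show "lifts_over E q f ({s..t} \<times> {c..d})" by simp
    qed
  next
    fix x assume "a \<le> x" "x \<le> b"
    then obtain r where r: "r > 0" "\<forall>s t. s \<le> x \<and> x \<le> t \<and> t - s < r \<longrightarrow> ?L s t c d"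
      using strip[of x c d] ab by auto
    show "\<exists>r>0. \<forall>s t. s \<le> x \<and> x \<le> t \<and> t - s < r \<longrightarrow> ?L s t c d"
      by (intro exI[of _ r] conjI r)
  qed
  then show ?thesis using ab by auto
qed

definition join_paths :: "(real \<Rightarrow> 'a) \<Rightarrow> (real \<Rightarrow> 'a) \<Rightarrow> real \<Rightarrow> 'a" where
  "join_paths g h = (\<lambda>t. if t \<le> 1/2 then g (2 * t) else h (2 * t - 1))"

lemma join_paths_0 [simp]: "join_paths g h 0 = g 0"
  and join_paths_1 [simp]: "join_paths g h 1 = h 1"
  by (simp_all add: join_paths_def)

lemma pathin_compose: "pathin X g \<Longrightarrow> continuous_map X Y f \<Longrightarrow> pathin Y (\<lambda>t. f (g t))"
  unfolding pathin_def using continuous_map_compose[of _ X g Y f] by (simp add: o_def)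

lemma pathin_reparam:
  assumes "pathin X g" "continuous_on {0..1} f" "f ` {0..1} \<subseteq> {0..1}"
  shows "pathin X (\<lambda>t. g (f t))"
  using continuous_map_compose[of "top_of_set {0..1}" "top_of_set {0..1}" f X g] assms
  by (auto simp: pathin_def o_def)

lemma pathin_reverse: "pathin X g \<Longrightarrow> pathin X (\<lambda>t. g (1 - t))"
  by (erule pathin_reparam) (auto intro!: continuous_intros)

lemma pathin_join:
  assumes g: "pathin X g" and h: "pathin X h" and gh: "g 1 = h 0"
  shows "pathin X (join_paths g h)"
  unfolding pathin_def join_paths_def
proof (rule continuous_map_cases_le)
  have *: "continuous_map (subtopology (top_of_set {0..1}) S) X (\<lambda>t. k (a t))"
    if "pathin X k" "continuous_on ({0..1} \<inter> S) a" "a ` ({0..1} \<inter> S) \<subseteq> {0..1}" for k a S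
    using continuous_map_compose[of "subtopology (top_of_set {0..1}) S" "top_of_set {0..1}" a X k] that
    by (auto simp: pathin_def o_def subtopology_subtopology)
  show "continuous_map (subtopology (top_of_set {0..1}) {t \<in> topspace (top_of_set {0..1}). t \<le> 1/2}) X (\<lambda>t. g (2 * t))"
    by (rule *[OF g]) (auto intro!: continuous_intros)
  show "continuous_map (subtopology (top_of_set {0..1}) {t \<in> topspace (top_of_set {0..1}). 1/2 \<le> t}) X (\<lambda>t. h (2 * t - 1))"
    by (rule *[OF h]) (auto intro!: continuous_intros)
  show "g (2 * t) = h (2 * t - 1)" if "t \<in> topspace (top_of_set {0..1})" "t = 1/2" for t :: real
    using gh that(2) by (simp add: that(2))
qed (auto intro!: continuous_intros)

lemma continuous_on_Pair_const: "continuous_on S (Pair s)" "continuous_on S (\<lambda>t. (t, s))"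
  by (rule continuous_on_Pair continuous_on_const continuous_on_id)+

text \<open>A path is regarded as a map of the square that is constant in the first variable.\<close>

lemma lift_path:
  assumes q: "covering_map E B q" and g: "pathin B g" and e: "e \<in> topspace E" "q e = g 0"
  obtains G where "pathin E G" "\<And>t. t \<in> {0..1} \<Longrightarrow> q (G t) = g t" "G 0 = e"
proof -
  have "continuous_map (top_of_set ({0..1} \<times> {0..1})) B (g \<circ> snd)"
    using g by (intro continuous_map_compose[of _ "top_of_set {0..1}"]) (auto simp: pathin_def intro!: continuous_intros)
  then have "lifts_over E q (g \<circ> snd) ({0..1::real} \<times> {0..1})"
    by (intro lifts_over_rectangle[OF q]) auto
  then obtain F where F: "continuous_map (top_of_set ({0..1} \<times> {0..1})) E F"
    "\<And>x. x \<in> {0..1::real} \<times> {0..1} \<Longrightarrow> q (F x) = (g \<circ> snd) x" "F (0,0) = e"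
    by (rule lifts_overD[of E q "g \<circ> snd" _ "(0,0)" e]) (use e in auto)
  show ?thesis
  proof
    show "pathin E (\<lambda>t. F (0, t))"
      using continuous_map_compose[of "top_of_set {0..1}" "top_of_set ({0..1} \<times> {0..1})" "Pair 0" E F] F(1)
      by (auto simp: pathin_def o_def continuous_on_Pair_const)
  qed (use F in auto)
qed

lemma connected_unit_interval: "connected_space (top_of_set {0..1::real})"
  by (simp add: connectedin_def flip: connectedin_iff_connected)

lemma path_stays_in_sheet:
  assumes U: "evenly_covered E B q U \<V>" and V: "V \<in> \<V>"
    and g: "pathin E g" "\<And>t. t \<in> {0..1} \<Longrightarrow> q (g t) \<in> U" "g 0 \<in> V" and t: "t \<in> {0..1}"
  shows "g t \<in> V"
proof -
  let ?I = "top_of_set {0..1::real}" and ?V' = "\<Union>(\<V> - {V})"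
  have o: "openin E V" "openin E ?V'" and un: "\<Union>\<V> = {x \<in> topspace E. q x \<in> U}"
    using U V by (auto simp: evenly_covered_def)
  have dj: "V \<inter> ?V' = {}"
  proof -
    have "V \<inter> V' = {}" if "V' \<in> \<V> - {V}" for V'
      using U V that unfolding evenly_covered_def by (metis Diff_iff insertI1 pairwiseD disjnt_def)
    then show ?thesis by blast
  qed
  have c: "continuous_map ?I E g" using g(1) by (simp add: pathin_def)
  have "(g 0 \<in> V) = (g t \<in> V)"
  proof (rule connected_space_local_relation[OF connected_unit_interval])
    fix s assume s: "s \<in> topspace ?I"
    then have "g s \<in> topspace E" "q (g s) \<in> U" using g(2) c by (auto simp: continuous_map_def)
    then have sV: "g s \<in> V \<or> g s \<in> ?V'" using un V by blast
    have o1: "openin ?I {t \<in> topspace ?I. g t \<in> V}" and o2: "openin ?I {t \<in> topspace ?I. g t \<in> ?V'}"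
      by (rule openin_continuous_map_preimage[OF c o(1)], rule openin_continuous_map_preimage[OF c o(2)])
    show "\<exists>N. openin ?I N \<and> s \<in> N \<and> (\<forall>t\<in>N. (g s \<in> V) = (g t \<in> V))"
    proof (cases "g s \<in> V")
      case True
      then show ?thesis using o1 s by (intro exI[of _ "{t \<in> topspace ?I. g t \<in> V}"]) simp
    next
      case False
      then have "g s \<in> ?V'" using sV by blast
      moreover have "g t \<notin> V" if "g t \<in> ?V'" for t using that dj by blast
      ultimately show ?thesis
        using o2 s False by (intro exI[of _ "{t \<in> topspace ?I. g t \<in> ?V'}"] conjI ballI) auto
    qed
  qed (use t in simp_all)
  then show ?thesis using g(3) by simp
qed

lemma lift_constant:
  assumes q: "covering_map E B q" and G: "pathin E G" and c: "\<And>t. t \<in> {0..1} \<Longrightarrow> q (G t) = b"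
    and st: "s \<in> {0..1}" "t \<in> {0..1}"
  shows "G s = G t"
proof -
  have "G t \<in> topspace E" using G st by (auto simp: pathin_def continuous_map_def)
  then have const: "continuous_map (top_of_set {0..1::real}) E (\<lambda>_. G t)" by simp
  have "continuous_map (top_of_set {0..1}) E G" using G by (simp add: pathin_def)
  from lift_unique[OF q connected_unit_interval this const _ _ _ , of t s] show ?thesis
    using c st by (metis topspace_euclidean_subtopology)
qed

text \<open>A null homotopy of the loop is constant on three sides of the square, hence so is its
  lift. The fourth side is the lift of the loop.\<close>

lemma lift_loop_closed:
  assumes q: "covering_map E B q" and Z: "simply_connected_space Z" and f: "continuous_map Z B f"
    and g: "pathin Z g" "g 0 = g 1" and G: "pathin E G" "\<And>t. t \<in> {0..1} \<Longrightarrow> q (G t) = f (g t)"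
  shows "G 0 = G 1"
proof -
  let ?S = "{0..1::real} \<times> {0..1::real}"
  have "homotopic_with (\<lambda>h. h 0 = g 0 \<and> h 1 = g 0) (top_of_set {0..1}) Z g (\<lambda>_. g 0)"
    using Z g(1) g(2)[symmetric] unfolding simply_connected_space_def by blast
  then obtain k where k: "continuous_map (prod_topology (top_of_set {0..1::real}) (top_of_set {0..1::real})) Z k"
    "\<And>t. k (0, t) = g t" "\<And>t. k (1, t) = g 0" "\<And>s. s \<in> {0..1} \<Longrightarrow> k (s, 0) = g 0 \<and> k (s, 1) = g 0"
    unfolding homotopic_with_def by auto
  then have ck: "continuous_map (top_of_set ?S) Z k" by (simp add: prod_topology_subtopology_eu)
  have cfk: "continuous_map (top_of_set ?S) B (f \<circ> k)" by (rule continuous_map_compose[OF ck f])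
  have "G 0 \<in> topspace E" using G by (auto simp: pathin_def continuous_map_def)
  then obtain K where K: "continuous_map (top_of_set ?S) E K"
    "\<And>x. x \<in> ?S \<Longrightarrow> q (K x) = (f \<circ> k) x" "K (0,0) = G 0"
    using lifts_overD[OF lifts_over_rectangle[OF q cfk], of "(0,0)" "G 0"] k(2) G(2) by auto
  have row: "pathin E (\<lambda>t. K (s, t))" if "s \<in> {0..1}" for s
    using continuous_map_compose[of "top_of_set {0..1}" "top_of_set ?S" "Pair s" E K] K(1) that
    by (auto simp: pathin_def o_def continuous_on_Pair_const)
  have col: "pathin E (\<lambda>s. K (s, t))" if "t \<in> {0..1}" for t
    using continuous_map_compose[of "top_of_set {0..1}" "top_of_set ?S" "\<lambda>s. (s, t)" E K] K(1) that
    by (auto simp: pathin_def o_def continuous_on_Pair_const)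
  have "G 1 = K (0, 1)"
    using lift_unique[OF q connected_unit_interval, of G "\<lambda>t. K (0, t)" 0 1] G row[of 0] K k
    by (auto simp: pathin_def)
  also have "\<dots> = K (1, 1)"
    using lift_constant[OF q col[of 1], of "f (g 0)" 0 1] K(2) k(4) by auto
  also have "\<dots> = K (1, 0)"
    using lift_constant[OF q row[of 1], of "f (g 0)" 0 1] K(2) k(3) by auto
  also have "\<dots> = K (0, 0)"
    using lift_constant[OF q col[of 0], of "f (g 0)" 0 1] K(2) k(4) by auto
  finally show ?thesis using K(3) by simp
qed

definition lift_reaches ::
  "'a topology \<Rightarrow> ('a \<Rightarrow> 'b) \<Rightarrow> 'z topology \<Rightarrow> ('z \<Rightarrow> 'b) \<Rightarrow> 'z \<Rightarrow> 'a \<Rightarrow> 'z \<Rightarrow> 'a \<Rightarrow> bool" where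
  "lift_reaches E q Z f z e z' e' \<longleftrightarrow> (\<exists>g G. pathin Z g \<and> g 0 = z \<and> g 1 = z' \<and> pathin E G \<and>
     (\<forall>t\<in>{0..1}. q (G t) = f (g t)) \<and> G 0 = e \<and> G 1 = e')"

lemma lift_reaches_trans:
  assumes "lift_reaches E q Z f z e z' e'" "lift_reaches E q Z f z' e' z'' e''"
  shows "lift_reaches E q Z f z e z'' e''"
proof -
  obtain g G where 1: "pathin Z g" "g 0 = z" "g 1 = z'" "pathin E G"
     "\<forall>t\<in>{0..1}. q (G t) = f (g t)" "G 0 = e" "G 1 = e'"
    using assms(1) unfolding lift_reaches_def by blast
  obtain h H where 2: "pathin Z h" "h 0 = z'" "h 1 = z''" "pathin E H"
     "\<forall>t\<in>{0..1}. q (H t) = f (h t)" "H 0 = e'" "H 1 = e''"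
    using assms(2) unfolding lift_reaches_def by blast
  have "q (join_paths G H t) = f (join_paths g h t)" if "t \<in> {0..1}" for t
    using that 1(5) 2(5) by (simp add: join_paths_def)
  moreover have "pathin Z (join_paths g h)" "pathin E (join_paths G H)"
    using 1 2 by (auto intro: pathin_join)
  ultimately show ?thesis
    unfolding lift_reaches_def using 1 2
    by (intro exI[of _ "join_paths g h"] exI[of _ "join_paths G H"]) simp
qed

lemma lift_reaches_sym:
  assumes "lift_reaches E q Z f z e z' e'"
  shows "lift_reaches E q Z f z' e' z e"
proof -
  obtain g G where 1: "pathin Z g" "g 0 = z" "g 1 = z'" "pathin E G"
     "\<forall>t\<in>{0..1}. q (G t) = f (g t)" "G 0 = e" "G 1 = e'"
    using assms(1) unfolding lift_reaches_def by blast
  show ?thesis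
    unfolding lift_reaches_def
    by (intro exI[of _ "\<lambda>t. g (1 - t)"] exI[of _ "\<lambda>t. G (1 - t)"])
      (use 1 in \<open>auto intro!: pathin_reverse\<close>)
qed

lemma lift_reaches_functional:
  assumes q: "covering_map E B q" and Z: "simply_connected_space Z" and f: "continuous_map Z B f"
    and 1: "lift_reaches E q Z f z e z' e1" and 2: "lift_reaches E q Z f z e z' e2"
  shows "e1 = e2"
proof -
  have "lift_reaches E q Z f z' e1 z' e2"
    using lift_reaches_trans[OF lift_reaches_sym[OF 1] 2] .
  then obtain g G where "pathin Z g" "g 0 = g 1" "pathin E G" "\<forall>t\<in>{0..1}. q (G t) = f (g t)"
    "G 0 = e1" "G 1 = e2"
    unfolding lift_reaches_def by auto
  then show ?thesis using lift_loop_closed[OF q Z f, of g G] by auto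
qed

text \<open>The lift sends \<open>z\<close> to the end of the lifted image of an arbitrary path from \<open>z0\<close> to
  \<open>z\<close>. Two paths give the same point because together they form a loop. Points near \<open>z\<close> are reached by paths
  that stay over an evenly covered set, and there the lift is \<open>f\<close> followed by the inverse of \<open>q\<close> on
  a sheet.\<close>

theorem lifting_criterion:
  assumes q: "covering_map E B q" and Z: "simply_connected_space Z" "locally_path_connected_space Z"
    and f: "continuous_map Z B f"
    and z0: "z0 \<in> topspace Z" and e0: "e0 \<in> topspace E" "q e0 = f z0"
  obtains F where "continuous_map Z E F" "\<And>z. z \<in> topspace Z \<Longrightarrow> q (F z) = f z" "F z0 = e0"
proof -
  let ?R = "lift_reaches E q Z f z0 e0"
  define F where "F z = (THE e. ?R z e)" for z
  have F_eq: "F z = e" if "?R z e" for z e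
    unfolding F_def using that lift_reaches_functional[OF q Z(1) f] by blast
  have ex: "\<exists>e. ?R z e" if z: "z \<in> topspace Z" for z
  proof -
    obtain g where g: "pathin Z g" "g 0 = z0" "g 1 = z"
      using Z(1) z z0 unfolding simply_connected_space_def path_connected_space_def by metis
    obtain G where "pathin E G" "\<And>t. t \<in> {0..1} \<Longrightarrow> q (G t) = f (g t)" "G 0 = e0"
      by (rule lift_path[OF q pathin_compose[OF g(1) f] e0(1)]) (use e0 g in auto)
    then show ?thesis unfolding lift_reaches_def using g by metis
  qed
  have R: "?R z (F z)" if "z \<in> topspace Z" for z
    using ex[OF that] F_eq by metis
  have qF: "q (F z) = f z" "F z \<in> topspace E" if z: "z \<in> topspace Z" for z
  proof -
    obtain g G where g: "g 1 = z" "pathin E G" "\<forall>t\<in>{0..1}. q (G t) = f (g t)" "G 1 = F z"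
      using R[OF z] unfolding lift_reaches_def by blast
    show "q (F z) = f z" using bspec[OF g(3), of 1] g by simp
    have "G 1 \<in> topspace E" using g(2) by (auto simp: pathin_def continuous_map_def)
    then show "F z \<in> topspace E" using g(4) by simp
  qed
  have loc: "\<exists>N. openin Z N \<and> z \<in> N \<and> continuous_map (subtopology Z N) E F" if z: "z \<in> topspace Z" for z
  proof -
    have "f z \<in> topspace B" using f z by (auto simp: continuous_map_def)
    then obtain U \<V> where U: "evenly_covered E B q U \<V>" "f z \<in> U"
      by (rule covering_map_evenly_covered[OF q])
    have "openin Z {x \<in> topspace Z. f x \<in> U}"
      using f U by (intro openin_continuous_map_preimage) (auto simp: evenly_covered_def)
    then obtain N where N: "openin Z N" "path_connectedin Z N" "z \<in> N" "N \<subseteq> {x \<in> topspace Z. f x \<in> U}"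
      using Z(2) z U(2) unfolding locally_path_connected_space
      by (metis (mono_tags, lifting) mem_Collect_eq)
    have top: "topspace (subtopology Z N) = N" using N(4) by auto
    have cN: "continuous_map (subtopology Z N) B f" by (rule continuous_map_from_subtopology[OF f])
    obtain F' where F': "continuous_map (subtopology Z N) E F'" "\<And>x. x \<in> N \<Longrightarrow> q (F' x) = f x" "F' z = F z"
      using lift_into_evenly_covered[OF U(1) cN, of z "F z"] qF[OF z] N(3,4) unfolding top by blast
    have "F x = F' x" if x: "x \<in> N" for x
    proof -
      obtain g where g: "pathin (subtopology Z N) g" "g 0 = z" "g 1 = x"
        using N(2,3) x unfolding path_connectedin_def path_connected_space_def top by blast
      have "g t \<in> N" if "t \<in> {0..1}" for t
        using g(1) that top by (auto simp: pathin_def continuous_map_def)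
      then have "lift_reaches E q Z f z (F z) x (F' x)"
        unfolding lift_reaches_def using g F' pathin_compose[OF g(1) F'(1)] g(1)[unfolded pathin_subtopology]
        by (intro exI[of _ g] exI[of _ "\<lambda>t. F' (g t)"]) auto
      then show ?thesis using F_eq lift_reaches_trans[OF R[OF z]] by blast
    qed
    then have "continuous_map (subtopology Z N) E F"
      using F'(1) top by (metis (no_types, lifting) continuous_map_eq)
    then show ?thesis using N by blast
  qed
  have "continuous_map Z E F"
  proof (rule pasting_lemma[where I = "{N. openin Z N \<and> continuous_map (subtopology Z N) E F}"
        and T = "\<lambda>N. N" and f = "\<lambda>_. F"])
    show "\<exists>j. j \<in> {N. openin Z N \<and> continuous_map (subtopology Z N) E F} \<and> x \<in> j \<and> F x = F x"
      if "x \<in> topspace Z" for x using loc[OF that] by blast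
  qed auto
  moreover have "F z0 = e0"
  proof (rule F_eq)
    show "?R z0 e0"
      unfolding lift_reaches_def using z0 e0
      by (intro exI[of _ "\<lambda>_. z0"] exI[of _ "\<lambda>_. e0"]) (auto simp: pathin_def)
  qed
  ultimately show ?thesis using that qF by blast
qed

lemma euclidean_convex_simply_connected:
  fixes S :: "'a::euclidean_space set"
  assumes "convex S"
  shows "simply_connected_space (top_of_set S)"
  unfolding simply_connected_space_def
proof (intro conjI allI impI)
  have "path_connected S" using assms by (rule convex_imp_path_connected)
  then show "path_connected_space (top_of_set S)"
    using path_connectedin_def[of euclidean S] by simp
next
  fix g :: "real \<Rightarrow> 'a" and x
  assume g: "pathin (top_of_set S) g \<and> g 0 = x \<and> g 1 = x"
  then have gS: "g ` {0..1} \<subseteq> S" "continuous_on {0..1} g" by (auto simp: pathin_def)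
  have "0 \<in> {0..1::real}" by simp
  then have x: "x \<in> S" using gS g by blast
  let ?h = "\<lambda>(s, t). (1 - s) *\<^sub>R g t + s *\<^sub>R x"
  have "continuous_on ({0..1} \<times> {0..1}) ?h"
    unfolding case_prod_unfold
    by (intro continuous_intros continuous_on_compose2[OF gS(2)]) auto
  moreover have "?h ` ({0..1} \<times> {0..1}) \<subseteq> S"
    using assms gS x by (auto intro!: convexD_alt[of S _ _ ] simp: image_subset_iff)
  ultimately show "homotopic_with (\<lambda>h. h 0 = x \<and> h 1 = x) (top_of_set {0..1}) (top_of_set S) g (\<lambda>_. x)"
    unfolding homotopic_with_def prod_topology_subtopology_eu
    using g by (intro exI[of _ ?h]) (auto simp: algebra_simps simp flip: scaleR_add_left)
qed

lemma euclidean_space_locally_path_connected: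
  "locally_path_connected_space (euclidean :: 'a::euclidean_space topology)"
  unfolding locally_path_connected_space
proof (intro allI impI)
  fix V and x :: 'a assume "openin euclidean V \<and> x \<in> V"
  then obtain r where "r > 0" "ball x r \<subseteq> V" by (auto simp: open_contains_ball)
  then show "\<exists>U. openin euclidean U \<and> path_connectedin euclidean U \<and> x \<in> U \<and> U \<subseteq> V"
    by (intro exI[of _ "ball x r"]) (auto intro!: convex_imp_path_connected)
qed

section \<open>Covering spaces from cocycles\<close>

text \<open>The map \<open>\<tau> y u\<close> compares the fibres of the product \<open>B \<times> F\<close> over the nearby points \<open>y\<close>
  and \<open>u\<close>; the last condition says that a detour over a third nearby point makes no difference.\<close>

definition cocycle_on ::
  "'b topology \<Rightarrow> 'f set \<Rightarrow> ('b \<Rightarrow> 'b set) \<Rightarrow> ('b \<Rightarrow> 'b \<Rightarrow> 'f \<Rightarrow> 'f) \<Rightarrow> bool" where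
  "cocycle_on B F N \<tau> \<longleftrightarrow>
     (\<forall>y \<in> topspace B. openin B (N y) \<and> y \<in> N y) \<and>
     (\<forall>y u. u \<in> N y \<longrightarrow> y \<in> N u) \<and>
     (\<forall>y \<in> topspace B. \<forall>f \<in> F. \<tau> y y f = f) \<and>
     (\<forall>y u f. u \<in> N y \<longrightarrow> f \<in> F \<longrightarrow> \<tau> y u f \<in> F) \<and>
     (\<forall>y u v f. u \<in> N y \<longrightarrow> v \<in> N y \<longrightarrow> v \<in> N u \<longrightarrow> f \<in> F \<longrightarrow> \<tau> u v (\<tau> y u f) = \<tau> y v f)"

lemma cocycle_onD:
  assumes "cocycle_on B F N \<tau>"
  shows "y \<in> topspace B \<Longrightarrow> openin B (N y)" "y \<in> topspace B \<Longrightarrow> y \<in> N y"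
    "u \<in> N y \<Longrightarrow> y \<in> N u" "y \<in> topspace B \<Longrightarrow> f \<in> F \<Longrightarrow> \<tau> y y f = f"
    "u \<in> N y \<Longrightarrow> f \<in> F \<Longrightarrow> \<tau> y u f \<in> F"
    "u \<in> N y \<Longrightarrow> v \<in> N y \<Longrightarrow> v \<in> N u \<Longrightarrow> f \<in> F \<Longrightarrow> \<tau> u v (\<tau> y u f) = \<tau> y v f"
  using assms unfolding cocycle_on_def by simp_all

text \<open>With a point, an open set contains the nearby points of its flat continuation. Thus the
  fibres are discrete, and the topology is in general not the product topology.\<close>

definition bundle_open ::
  "'b topology \<Rightarrow> 'f set \<Rightarrow> ('b \<Rightarrow> 'b set) \<Rightarrow> ('b \<Rightarrow> 'b \<Rightarrow> 'f \<Rightarrow> 'f) \<Rightarrow> ('b \<times> 'f) set \<Rightarrow> bool" where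
  "bundle_open B F N \<tau> W \<longleftrightarrow> W \<subseteq> topspace B \<times> F \<and>
     (\<forall>(y, f) \<in> W. \<exists>U. openin B U \<and> y \<in> U \<and> U \<subseteq> N y \<and> (\<forall>z \<in> U. (z, \<tau> y z f) \<in> W))"

definition bundle_topology ::
  "'b topology \<Rightarrow> 'f set \<Rightarrow> ('b \<Rightarrow> 'b set) \<Rightarrow> ('b \<Rightarrow> 'b \<Rightarrow> 'f \<Rightarrow> 'f) \<Rightarrow> ('b \<times> 'f) topology" where
  "bundle_topology B F N \<tau> = topology (bundle_open B F N \<tau>)"

lemma bundle_openD:
  assumes "bundle_open B F N \<tau> W" "(y, f) \<in> W"
  obtains U where "openin B U" "y \<in> U" "U \<subseteq> N y" "\<And>z. z \<in> U \<Longrightarrow> (z, \<tau> y z f) \<in> W"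
  using assms unfolding bundle_open_def by fast

lemma bundle_openI:
  assumes "W \<subseteq> topspace B \<times> F"
    and "\<And>y f. (y, f) \<in> W \<Longrightarrow> \<exists>U. openin B U \<and> y \<in> U \<and> U \<subseteq> N y \<and> (\<forall>z \<in> U. (z, \<tau> y z f) \<in> W)"
  shows "bundle_open B F N \<tau> W"
  using assms unfolding bundle_open_def by auto

lemma openin_bundle: "openin (bundle_topology B F N \<tau>) = bundle_open B F N \<tau>"
  unfolding bundle_topology_def
proof (rule topology_inverse', unfold istopology_def, intro conjI allI impI)
  fix S T assume S: "bundle_open B F N \<tau> S" and T: "bundle_open B F N \<tau> T"
  show "bundle_open B F N \<tau> (S \<inter> T)"
  proof (rule bundle_openI)
    show "S \<inter> T \<subseteq> topspace B \<times> F" using S by (auto simp: bundle_open_def)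
    fix y f assume yf: "(y, f) \<in> S \<inter> T"
    obtain U where U: "openin B U" "y \<in> U" "U \<subseteq> N y" "\<And>z. z \<in> U \<Longrightarrow> (z, \<tau> y z f) \<in> S"
      using bundle_openD[OF S] yf by blast
    obtain V where V: "openin B V" "y \<in> V" "V \<subseteq> N y" "\<And>z. z \<in> V \<Longrightarrow> (z, \<tau> y z f) \<in> T"
      using bundle_openD[OF T] yf by blast
    show "\<exists>U. openin B U \<and> y \<in> U \<and> U \<subseteq> N y \<and> (\<forall>z\<in>U. (z, \<tau> y z f) \<in> S \<inter> T)"
      using U V by (intro exI[of _ "U \<inter> V"]) auto
  qed
next
  fix \<K> assume K: "\<forall>W\<in>\<K>. bundle_open B F N \<tau> W"
  show "bundle_open B F N \<tau> (\<Union>\<K>)"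
  proof (rule bundle_openI)
    show "\<Union>\<K> \<subseteq> topspace B \<times> F" using K unfolding bundle_open_def by blast
    fix y f assume "(y, f) \<in> \<Union>\<K>"
    then obtain W where W: "W \<in> \<K>" "(y, f) \<in> W" by blast
    then obtain U where U: "openin B U" "y \<in> U" "U \<subseteq> N y" "\<And>z. z \<in> U \<Longrightarrow> (z, \<tau> y z f) \<in> W"
      using bundle_openD K by metis
    then show "\<exists>U. openin B U \<and> y \<in> U \<and> U \<subseteq> N y \<and> (\<forall>z\<in>U. (z, \<tau> y z f) \<in> \<Union>\<K>)"
      using W(1) by (intro exI[of _ U]) blast
  qed
qed

context
  fixes B :: "'b topology" and F :: "'f set" and N \<tau>
  assumes co: "cocycle_on B F N \<tau>"
begin

lemma topspace_bundle: "topspace (bundle_topology B F N \<tau>) = topspace B \<times> F"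
proof -
  have "bundle_open B F N \<tau> (topspace B \<times> F)"
  proof (rule bundle_openI)
    fix y f assume "(y, f) \<in> topspace B \<times> F"
    then show "\<exists>U. openin B U \<and> y \<in> U \<and> U \<subseteq> N y \<and> (\<forall>z\<in>U. (z, \<tau> y z f) \<in> topspace B \<times> F)"
      using cocycle_onD(1,2,5)[OF co] openin_subset by (intro exI[of _ "N y"]) blast
  qed auto
  moreover have "bundle_open B F N \<tau> (topspace (bundle_topology B F N \<tau>))"
    using openin_topspace[of "bundle_topology B F N \<tau>"] unfolding openin_bundle .
  ultimately show ?thesis
    using openin_subset[of "bundle_topology B F N \<tau>"] unfolding openin_bundle
    by (simp add: bundle_open_def subset_antisym)
qed

definition sheet :: "'b \<Rightarrow> 'f \<Rightarrow> ('b \<times> 'f) set" where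
  "sheet y f = (\<lambda>z. (z, \<tau> y z f)) ` N y"

lemma openin_sheet:
  assumes "y \<in> topspace B" "f \<in> F"
  shows "openin (bundle_topology B F N \<tau>) (sheet y f)"
  unfolding openin_bundle
proof (rule bundle_openI)
  have Ny: "N y \<subseteq> topspace B" using cocycle_onD(1)[OF co assms(1)] by (rule openin_subset)
  show "sheet y f \<subseteq> topspace B \<times> F"
    using assms Ny cocycle_onD(5)[OF co] by (auto simp: sheet_def)
  fix u g assume "(u, g) \<in> sheet y f"
  then have u: "u \<in> N y" "g = \<tau> y u f" by (auto simp: sheet_def)
  show "\<exists>U. openin B U \<and> u \<in> U \<and> U \<subseteq> N u \<and> (\<forall>z\<in>U. (z, \<tau> u z g) \<in> sheet y f)"
  proof (intro exI[of _ "N y \<inter> N u"] conjI ballI)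
    show "openin B (N y \<inter> N u)" using cocycle_onD(1)[OF co] assms u(1) Ny by blast
    show "u \<in> N y \<inter> N u" using cocycle_onD(2)[OF co] u(1) Ny by blast
    show "(z, \<tau> u z g) \<in> sheet y f" if "z \<in> N y \<inter> N u" for z
      using that u cocycle_onD(6)[OF co u(1), of z f] assms by (auto simp: sheet_def)
  qed auto
qed

lemma covering_map_bundle:
  assumes "F \<noteq> {}"
  shows "covering_map (bundle_topology B F N \<tau>) B fst"
proof -
  let ?E = "bundle_topology B F N \<tau>"
  have cont: "continuous_map ?E B fst"
    unfolding continuous_map topspace_bundle
  proof (intro conjI allI impI)
    fix U assume U: "openin B U"
    show "openin ?E {x \<in> topspace B \<times> F. fst x \<in> U}"
      unfolding openin_bundle
    proof (rule bundle_openI)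
      fix y f assume yf: "(y, f) \<in> {x \<in> topspace B \<times> F. fst x \<in> U}"
      then have y: "y \<in> topspace B" "f \<in> F" "y \<in> U" by auto
      have o: "openin B (U \<inter> N y)" using U cocycle_onD(1)[OF co y(1)] by blast
      show "\<exists>V. openin B V \<and> y \<in> V \<and> V \<subseteq> N y \<and> (\<forall>z\<in>V. (z, \<tau> y z f) \<in> {x \<in> topspace B \<times> F. fst x \<in> U})"
        using o openin_subset[OF o] y cocycle_onD(2,5)[OF co] by (intro exI[of _ "U \<inter> N y"]) auto
    qed auto
  qed auto
  have opn: "openin B (fst ` W)" if W: "openin ?E W" for W
  proof (subst openin_subopen, intro ballI)
    fix y assume "y \<in> fst ` W"
    then obtain f where "(y, f) \<in> W" by auto
    then obtain U where "openin B U" "y \<in> U" "\<And>z. z \<in> U \<Longrightarrow> (z, \<tau> y z f) \<in> W"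
      using bundle_openD W unfolding openin_bundle by metis
    then show "\<exists>U. openin B U \<and> y \<in> U \<and> U \<subseteq> fst ` W"
      by (intro exI[of _ U]) force
  qed
  have ev: "\<exists>U. openin B U \<and> y \<in> U \<and>
      (\<exists>\<V>. \<Union>\<V> = {x \<in> topspace ?E. fst x \<in> U} \<and> (\<forall>V \<in> \<V>. openin ?E V) \<and> pairwise disjnt \<V> \<and>
           (\<forall>V \<in> \<V>. homeomorphic_map (subtopology ?E V) (subtopology B U) fst))"
    if y: "y \<in> topspace B" for y
  proof (intro exI[of _ "N y"] exI[of _ "sheet y ` F"] conjI ballI)
    have Ny: "N y \<subseteq> topspace B" using cocycle_onD(1)[OF co y] by (rule openin_subset)
    have yN: "y \<in> N u" "u \<in> N u" "u \<in> topspace B" if "u \<in> N y" for u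
      using that Ny cocycle_onD(2,3)[OF co] by blast+
    show "openin B (N y)" "y \<in> N y" using cocycle_onD(1,2)[OF co y] by auto
    show "\<Union>(sheet y ` F) = {x \<in> topspace ?E. fst x \<in> N y}"
    proof (intro equalityI subsetI)
      fix x assume "x \<in> \<Union>(sheet y ` F)"
      then show "x \<in> {x \<in> topspace ?E. fst x \<in> N y}"
        using cocycle_onD(5)[OF co] Ny by (auto simp: sheet_def topspace_bundle)
    next
      fix x assume "x \<in> {x \<in> topspace ?E. fst x \<in> N y}"
      then obtain u g where x: "x = (u, g)" "u \<in> N y" "g \<in> F" by (cases x) (auto simp: topspace_bundle)
      have "\<tau> y u (\<tau> u y g) = \<tau> u u g"
        using cocycle_onD(6)[OF co yN(1)[OF x(2)] yN(2)[OF x(2)] x(2) x(3)] .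
      then have "x \<in> sheet y (\<tau> u y g)"
        using x cocycle_onD(4)[OF co yN(3)[OF x(2)] x(3)] by (auto simp: sheet_def)
      then show "x \<in> \<Union>(sheet y ` F)"
        using cocycle_onD(5)[OF co yN(1)[OF x(2)] x(3)] by blast
    qed
    have inj: "f = f'" if "f \<in> F" "f' \<in> F" "u \<in> N y" "\<tau> y u f = \<tau> y u f'" for f f' u
    proof -
      have *: "\<tau> u y (\<tau> y u k) = k" if k: "k \<in> F" for k
        by (rule trans[OF cocycle_onD(6)[OF co \<open>u \<in> N y\<close> \<open>y \<in> N y\<close> yN(1)[OF \<open>u \<in> N y\<close>] k]
          cocycle_onD(4)[OF co y k]])
      have "f = \<tau> u y (\<tau> y u f)" using *[OF that(1)] by (rule sym)
      also have "\<dots> = f'" unfolding that(4) by (rule *[OF that(2)])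
      finally show ?thesis .
    qed
    show "pairwise disjnt (sheet y ` F)"
      unfolding pairwise_def disjnt_def by (auto simp: sheet_def dest: inj)
    fix V assume "V \<in> sheet y ` F"
    then obtain f where f: "f \<in> F" "V = sheet y f" by blast
    show oV: "openin ?E V" using openin_sheet y f by blast
    have top: "topspace (subtopology ?E V) = V" "topspace (subtopology B (N y)) = N y"
      using openin_subset[OF oV] Ny by auto
    have img: "fst ` V = N y" "inj_on fst V" using f by (auto simp: sheet_def inj_on_def image_image)
    show "homeomorphic_map (subtopology ?E V) (subtopology B (N y)) fst"
    proof (rule bijective_open_imp_homeomorphic_map)
      show "continuous_map (subtopology ?E V) (subtopology B (N y)) fst"
        using img continuous_map_from_subtopology[OF cont] top by (auto simp: continuous_map_in_subtopology)
      show "open_map (subtopology ?E V) (subtopology B (N y)) fst"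
        unfolding open_map_def
      proof (intro allI impI)
        fix S assume "openin (subtopology ?E V) S"
        then have S: "openin ?E S" "S \<subseteq> V" using oV by (auto simp: openin_open_subtopology)
        then have "fst ` S \<subseteq> N y" using img by blast
        then show "openin (subtopology B (N y)) (fst ` S)"
          using opn[OF S(1)] by (metis openin_subtopology Int_absorb2)
      qed
    qed (use img top in auto)
  qed
  show ?thesis
    unfolding covering_map_def using cont ev assms by (auto simp: topspace_bundle)
qed

end

text \<open>The flat section \<open>h\<close> is the second component of a lift of \<open>p\<close> to the covering built
  from the cocycle.\<close>

theorem cocycle_trivial:
  assumes co: "cocycle_on B F N \<tau>"
    and X: "simply_connected_space X" "locally_path_connected_space X" and p: "continuous_map X B p"
    and x0: "x0 \<in> topspace X" and f0: "f0 \<in> F"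
  obtains h where "h x0 = f0" "\<And>x. x \<in> topspace X \<Longrightarrow> h x \<in> F"
    "\<And>x. x \<in> topspace X \<Longrightarrow> \<exists>O'. openin X O' \<and> x \<in> O' \<and> (\<forall>z \<in> O'. h z = \<tau> (p x) (p z) (h x))"
proof -
  let ?E = "bundle_topology B F N \<tau>"
  have cov: "covering_map ?E B fst" using f0 by (intro covering_map_bundle[OF co]) auto
  have pX: "p x \<in> topspace B" if "x \<in> topspace X" for x
    using p that by (auto simp: continuous_map_def)
  have e: "(p x0, f0) \<in> topspace ?E" "fst (p x0, f0) = p x0"
    using pX[OF x0] f0 by (simp_all add: topspace_bundle[OF co])
  obtain H where H: "continuous_map X ?E H" "\<And>x. x \<in> topspace X \<Longrightarrow> fst (H x) = p x" "H x0 = (p x0, f0)"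
    using lifting_criterion[OF cov X p x0 e] by metis
  have hF: "snd (H x) \<in> F" if "x \<in> topspace X" for x
    using continuous_map_image_subset_topspace[OF H(1)] that topspace_bundle[OF co]
    by (metis image_subset_iff mem_Times_iff)
  show ?thesis
  proof (rule that)
    show "snd (H x0) = f0" using H(3) by simp
    show "\<And>x. x \<in> topspace X \<Longrightarrow> snd (H x) \<in> F" by (rule hF)
    fix x assume x: "x \<in> topspace X"
    let ?S = "sheet N \<tau> (p x) (snd (H x))"
    let ?O = "{z \<in> topspace X. H z \<in> ?S}"
    have O1: "openin X ?O"
      using H(1) openin_sheet[OF co pX[OF x] hF[OF x]] by (rule openin_continuous_map_preimage)
    have "H x \<in> ?S"
      unfolding sheet_def[OF co]
      using cocycle_onD(4)[OF co pX[OF x] hF[OF x]] cocycle_onD(2)[OF co pX[OF x]] H(2)[OF x]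
      by (intro image_eqI[of _ _ "p x"]) (auto simp: prod_eq_iff)
    then have O2: "x \<in> ?O" using x by simp
    have O3: "snd (H z) = \<tau> (p x) (p z) (snd (H x))" if "z \<in> ?O" for z
      using that H(2)[of z] unfolding sheet_def[OF co] by auto
    show "\<exists>O'. openin X O' \<and> x \<in> O' \<and> (\<forall>z \<in> O'. snd (H z) = \<tau> (p x) (p z) (snd (H x)))"
      using O1 O2 O3 by (intro exI[of _ ?O] conjI ballI)
  qed
qed

section \<open>Lengths of curves and the induced length metric\<close>

lemma enn2real_INF_less:
  assumes "a \<in> A" "f a < \<infinity>" "enn2real (INF a \<in> A. f a) < r"
  obtains b where "b \<in> A" "f b < ennreal r"
proof -
  have "(INF a \<in> A. f a) < \<infinity>" using INF_lower[OF assms(1), of f] assms(2) by (rule le_less_trans)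
  then have "(INF a \<in> A. f a) = ennreal (enn2real (INF a \<in> A. f a))" by (simp add: less_top)
  also have "\<dots> < ennreal r"
    using assms(3) by (intro ennreal_lessI) (auto intro: le_less_trans[OF enn2real_nonneg])
  finally show ?thesis using that unfolding INF_less_iff by blast
qed

text \<open>The sums in \<^const>\<open>curve_length\<close>, in a form suited to induction on the partition.\<close>

fun variation :: "('a \<Rightarrow> 'a \<Rightarrow> real) \<Rightarrow> (real \<Rightarrow> 'a) \<Rightarrow> real list \<Rightarrow> ennreal" where
  "variation d g (x # y # zs) = ennreal (d (g x) (g y)) + variation d g (y # zs)"
| "variation d g zs = 0"

lemma variation_eq_sum:
  "variation d g ts = (\<Sum>k < length ts - 1. ennreal (d (g (ts ! k)) (g (ts ! Suc k))))"
proof (induction d g ts rule: variation.induct)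
  case (1 d g x y zs)
  then show ?case by (simp add: sum.lessThan_Suc_shift del: sum.lessThan_Suc)
qed auto

lemma curve_length_variation:
  "curve_length d g = (SUP ts \<in> {ts. sorted ts \<and> set ts \<subseteq> {0..1}}. variation d g ts)"
  unfolding curve_length_def variation_eq_sum ..

lemma variation_le_length: "sorted ts \<Longrightarrow> set ts \<subseteq> {0..1} \<Longrightarrow> variation d g ts \<le> curve_length d g"
  unfolding curve_length_variation by (rule SUP_upper) auto

lemma curve_length_leI:
  "(\<And>ts. sorted ts \<Longrightarrow> set ts \<subseteq> {0..1} \<Longrightarrow> variation d g ts \<le> L) \<Longrightarrow> curve_length d g \<le> L"
  unfolding curve_length_variation by (rule SUP_least) auto

lemma dist_le_curve_length:
  assumes "0 \<le> s" "s \<le> t" "t \<le> 1"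
  shows "ennreal (d (g s) (g t)) \<le> curve_length d g"
  using variation_le_length[of "[s, t]" d g] assms by simp

lemma variation_cong:
  assumes "\<And>t. t \<in> set ts \<Longrightarrow> g t = h t"
  shows "variation d g ts = variation d h ts"
  using assms by (induction d g ts rule: variation.induct) auto

lemma variation_map: "variation d (\<lambda>t. g (f t)) ts = variation d g (map f ts)"
  by (induction d g ts rule: variation.induct) auto

lemma variation_snoc: "variation d g (ts @ [x, y]) = variation d g (ts @ [x]) + ennreal (d (g x) (g y))"
proof (induction ts)
  case (Cons a ts)
  then show ?case by (cases ts) (auto simp: add.assoc)
qed simp

lemma variation_rev:
  assumes "\<And>x y. d x y = d y x"
  shows "variation d g (rev ts) = variation d g ts"
proof (induction ts rule: induct_list012)
  case (3 x y zs)
  have "variation d g (rev (x # y # zs)) = variation d g (rev (y # zs)) + ennreal (d (g y) (g x))"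
    using variation_snoc[of d g "rev zs" y x] by simp
  then show ?case using 3 assms[of "g y" "g x"] by (simp add: add.commute)
qed auto

lemma curve_length_reverse:
  assumes "\<And>x y. d x y = d y x"
  shows "curve_length d (\<lambda>t. g (1 - t)) = curve_length d g"
proof -
  have *: "curve_length d (\<lambda>t. g (1 - t)) \<le> curve_length d g" for g :: "real \<Rightarrow> 'a"
  proof (rule curve_length_leI)
    fix ts :: "real list" assume ts: "sorted ts" "set ts \<subseteq> {0..1}"
    have "sorted (rev (map (\<lambda>t. 1 - t) ts))"
      using ts(1) by (simp add: sorted_wrt_rev sorted_wrt_map)
    moreover have "set (rev (map (\<lambda>t. 1 - t) ts)) \<subseteq> {0..1}" using ts(2) by auto
    moreover have "variation d (\<lambda>t. g (1 - t)) ts = variation d g (rev (map (\<lambda>t. 1 - t) ts))"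
      unfolding variation_rev[of d, OF assms] by (rule variation_map)
    ultimately show "variation d (\<lambda>t. g (1 - t)) ts \<le> curve_length d g"
      by (metis variation_le_length)
  qed
  have "curve_length d g \<le> curve_length d (\<lambda>t. g (1 - t))"
    using *[of "\<lambda>t. g (1 - t)"] by simp
  then show ?thesis using * by (metis antisym)
qed

lemma variation_split:
  assumes tri: "\<And>x y z. x \<in> A \<Longrightarrow> y \<in> A \<Longrightarrow> z \<in> A \<Longrightarrow> d (g x) (g z) \<le> d (g x) (g y) + d (g y) (g z)"
    and nn: "\<And>x y. 0 \<le> d x y"
    and A: "set xs \<subseteq> A" "m \<in> A" "set ys \<subseteq> A"
  shows "variation d g (xs @ ys) \<le> variation d g (xs @ [m]) + variation d g (m # ys)"
  using A(1)
proof (induction xs)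
  case Nil
  then show ?case by (cases ys) auto
next
  case (Cons x xs)
  show ?case
  proof (cases xs)
    case Nil
    show ?thesis
    proof (cases ys)
      case (Cons y zs)
      have "ennreal (d (g x) (g y)) \<le> ennreal (d (g x) (g m) + d (g m) (g y))"
        using tri[of x m y] Cons.prems A Cons by (intro ennreal_leI) auto
      also have "\<dots> = ennreal (d (g x) (g m)) + ennreal (d (g m) (g y))"
        using nn by simp
      finally show ?thesis using Nil Cons by (simp add: add.assoc[symmetric] add_mono)
    qed (use Nil in auto)
  next
    case (Cons x' xs')
    then show ?thesis using Cons.IH Cons.prems by (simp add: add.assoc add_left_mono)
  qed
qed

text \<open>A partition of the joined path becomes no shorter when the point \<open>1/2\<close> is inserted,
  and then it splits into partitions of the two paths.\<close>

lemma curve_length_join: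
  assumes tri: "\<And>x y z. x \<in> M \<Longrightarrow> y \<in> M \<Longrightarrow> z \<in> M \<Longrightarrow> d x z \<le> d x y + d y z"
    and nn: "\<And>x y. 0 \<le> d x y"
    and g: "g ` {0..1} \<subseteq> M" and h: "h ` {0..1} \<subseteq> M" and gh: "g 1 = h 0"
  shows "curve_length d (join_paths g h) \<le> curve_length d g + curve_length d h"
proof (rule curve_length_leI)
  let ?j = "join_paths g h"
  fix ts :: "real list" assume ts: "sorted ts" "set ts \<subseteq> {0..1}"
  define xs ys where "xs = takeWhile (\<lambda>t. t \<le> 1/2) ts" and "ys = dropWhile (\<lambda>t. t \<le> 1/2) ts"
  have split: "ts = xs @ ys" by (simp add: xs_def ys_def)
  have xs: "0 \<le> t \<and> t \<le> 1/2" if "t \<in> set xs" for t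
    using subsetD[OF ts(2), of t] set_takeWhileD[of t "\<lambda>t. t \<le> 1/2" ts] that unfolding xs_def by auto
  have ys0: "\<And>t. t \<in> set ys \<Longrightarrow> 1/2 \<le> t"
  proof -
    fix t assume t: "t \<in> set ys"
    then have "ys \<noteq> []" by auto
    then have "\<not> hd ys \<le> 1/2" unfolding ys_def by (rule hd_dropWhile)
    moreover have "sorted ys" using ts(1) split by (simp add: sorted_append)
    ultimately show "1/2 \<le> t" using t by (cases ys) auto
  qed
  have ys: "1/2 \<le> t \<and> t \<le> 1" if "t \<in> set ys" for t
    using ys0[OF that] that ts(2) split by auto
  have j1: "?j t = g (2 * t)" if "t \<le> 1/2" for t using that by (simp add: join_paths_def)
  have j2: "?j t = h (2 * t - 1)" if "1/2 \<le> t" for t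
  proof (cases "t = 1/2")
    case True
    show ?thesis unfolding True using gh by (simp add: join_paths_def)
  qed (use that in \<open>simp add: join_paths_def\<close>)
  have jM: "?j t \<in> M" if "t \<in> {0..1}" for t
    using that g h by (auto simp: join_paths_def image_subset_iff)
  have xs': "0 \<le> 2 * t \<and> 2 * t \<le> 1" if "t \<in> set xs" for t using xs[OF that] by linarith
  have ys': "0 \<le> 2 * t - 1 \<and> 2 * t - 1 \<le> 1" if "t \<in> set ys" for t using ys[OF that] by linarith
  have sxs: "sorted (map (\<lambda>t. 2 * t) (xs @ [1/2]))" "set (map (\<lambda>t. 2 * t) (xs @ [1/2])) \<subseteq> {0..1}"
    using ts(1) split xs' by (simp_all add: sorted_append sorted_wrt_map image_subset_iff)
  have sys: "sorted (map (\<lambda>t. 2 * t - 1) (1/2 # ys))" "set (map (\<lambda>t. 2 * t - 1) (1/2 # ys)) \<subseteq> {0..1}"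
    using ts(1) split ys' by (simp_all add: sorted_append sorted_wrt_map image_subset_iff)
  have "variation d ?j (xs @ ys) \<le> variation d ?j (xs @ [1/2]) + variation d ?j (1/2 # ys)"
    by (rule variation_split[where A = "{0..1}"]) (use tri jM nn ts(2) split in auto)
  also have "\<dots> \<le> curve_length d g + curve_length d h"
  proof (rule add_mono)
    have "variation d ?j (xs @ [1/2]) = variation d g (map (\<lambda>t. 2 * t) (xs @ [1/2]))"
      unfolding variation_map[symmetric] using xs by (intro variation_cong j1) auto
    then show "variation d ?j (xs @ [1/2]) \<le> curve_length d g"
      using variation_le_length[OF sxs] by simp
    have "variation d ?j (1/2 # ys) = variation d h (map (\<lambda>t. 2 * t - 1) (1/2 # ys))"
      unfolding variation_map[symmetric] using ys by (intro variation_cong j2) auto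
    then show "variation d ?j (1/2 # ys) \<le> curve_length d h"
      using variation_le_length[OF sys] by simp
  qed
  finally show "variation d ?j ts \<le> curve_length d g + curve_length d h"
    unfolding split .
qed

lemma curve_length_Lipschitz:
  assumes L: "\<And>s t. 0 \<le> s \<Longrightarrow> s \<le> t \<Longrightarrow> t \<le> 1 \<Longrightarrow> d (g s) (g t) \<le> L * (t - s)" and "0 \<le> L"
  shows "curve_length d g \<le> ennreal L"
proof (rule curve_length_leI)
  fix ts :: "real list" assume ts: "sorted ts" "set ts \<subseteq> {0..1}"
  have "variation d g (x # zs) \<le> ennreal (L * (last (x # zs) - x))"
    if "sorted (x # zs)" "set (x # zs) \<subseteq> {0..1}" for x zs
    using that
  proof (induction zs arbitrary: x)
    case (Cons y zs)
    have le: "y \<le> last (y # zs)" using Cons.prems by (cases zs) auto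
    have "variation d g (x # y # zs) \<le> ennreal (L * (y - x)) + ennreal (L * (last (y # zs) - y))"
      using Cons.IH[of y] Cons.prems L[of x y] by (auto intro!: add_mono ennreal_leI)
    also have "\<dots> = ennreal (L * (last (y # zs) - x))"
    proof -
      have "0 \<le> L * (y - x)" "0 \<le> L * (last (y # zs) - y)"
        using Cons.prems le \<open>0 \<le> L\<close> by (auto intro!: mult_nonneg_nonneg)
      then show ?thesis by (subst ennreal_plus[symmetric]) (auto simp: algebra_simps)
    qed
    finally show ?case by simp
  qed simp
  note part = this
  have bound: "L * (last (x # zs) - x) \<le> L" if "set (x # zs) \<subseteq> {0..1}" for x zs
  proof -
    have "last (x # zs) \<le> 1" "0 \<le> x" using that last_in_set[of "x # zs"] by auto
    then show ?thesis using \<open>0 \<le> L\<close> mult_left_mono[of "last (x # zs) - x" 1 L] by auto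
  qed
  show "variation d g ts \<le> ennreal L"
  proof (cases ts)
    case (Cons x zs)
    show ?thesis
      using order_trans[OF part ennreal_leI[OF bound], of x zs] ts unfolding Cons by blast
  qed simp
qed

text \<open>The assumption \<open>rect\<close> excludes infinite distances, which \<^const>\<open>enn2real\<close> would turn
  into \<open>0\<close>.\<close>

locale length_cover = Metric_space M d for M :: "'b set" and d +
  fixes X :: "'a topology" and p :: "'a \<Rightarrow> 'b"
  assumes cov: "covering_map X mtopology p"
    and rect: "\<And>x y. x \<in> topspace X \<Longrightarrow> y \<in> topspace X \<Longrightarrow>
      \<exists>g. pathin X g \<and> g 0 = x \<and> g 1 = y \<and> curve_length d (p \<circ> g) < \<infinity>"
begin

abbreviation "D \<equiv> induced_length_dist X p d"

lemma pM: "x \<in> topspace X \<Longrightarrow> p x \<in> M"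
  using covering_map_surj[OF cov] by auto

lemma path_in_X: "pathin X g \<Longrightarrow> t \<in> {0..1} \<Longrightarrow> g t \<in> topspace X"
  by (auto simp: pathin_def continuous_map_def)

lemma D_le:
  assumes "pathin X g" "g 0 = x" "g 1 = y" "curve_length d (p \<circ> g) \<le> ennreal r" "0 \<le> r"
  shows "D x y \<le> r"
proof -
  have "(INF g \<in> {g. pathin X g \<and> g 0 = x \<and> g 1 = y}. curve_length d (p \<circ> g)) \<le> ennreal r"
    using assms by (intro INF_lower2[of g]) auto
  then show ?thesis
    unfolding induced_length_dist_def using assms(5) by (intro enn2real_leI)
qed

lemma D_less:
  assumes "x \<in> topspace X" "y \<in> topspace X" "D x y < r"
  obtains g where "pathin X g" "g 0 = x" "g 1 = y" "curve_length d (p \<circ> g) < ennreal r"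
proof -
  obtain g where g: "g \<in> {g. pathin X g \<and> g 0 = x \<and> g 1 = y}" "curve_length d (p \<circ> g) < \<infinity>"
    using rect assms by blast
  show ?thesis
    by (rule enn2real_INF_less[OF g assms(3)[unfolded induced_length_dist_def]]) (use that in blast)
qed

lemma D_nonneg: "0 \<le> D x y"
  by (simp add: induced_length_dist_def)

lemma D_commute: "D x y = D y x"
proof -
  have *: "(INF g \<in> {g. pathin X g \<and> g 0 = x \<and> g 1 = y}. curve_length d (p \<circ> g)) \<le>
      (INF g \<in> {g. pathin X g \<and> g 0 = y \<and> g 1 = x}. curve_length d (p \<circ> g))" for x y
  proof (rule INF_greatest)
    fix g assume g: "g \<in> {g. pathin X g \<and> g 0 = y \<and> g 1 = x}"
    have "curve_length d (p \<circ> (\<lambda>t. g (1 - t))) = curve_length d (p \<circ> g)"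
      using curve_length_reverse[of d "p \<circ> g"] commute by (simp add: o_def)
    then show "(INF g \<in> {g. pathin X g \<and> g 0 = x \<and> g 1 = y}. curve_length d (p \<circ> g)) \<le> curve_length d (p \<circ> g)"
      using g pathin_reverse[of X g] by (intro INF_lower2[of "\<lambda>t. g (1 - t)"]) auto
  qed
  show ?thesis
    unfolding induced_length_dist_def by (intro arg_cong[where f = enn2real] antisym *)
qed

lemma D_refl: "x \<in> topspace X \<Longrightarrow> D x x = 0"
  using D_le[of "\<lambda>_. x" x x 0] curve_length_Lipschitz[of d "p \<circ> (\<lambda>_. x)" 0] mdist_zero[OF pM] D_nonneg[of x x]
  by (auto simp: pathin_def)

lemma path_near:
  assumes "pathin X g" "curve_length d (p \<circ> g) < ennreal r" "t \<in> {0..1}"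
  shows "p (g t) \<in> mball (p (g 0)) r"
proof -
  have "ennreal (d (p (g 0)) (p (g t))) < ennreal r"
    using dist_le_curve_length[of 0 t d "p \<circ> g"] assms by auto
  then have "d (p (g 0)) (p (g t)) < r" by (simp add: ennreal_less_iff)
  then show ?thesis using pM path_in_X[OF assms(1)] assms(3) by auto
qed

lemma D_ge:
  assumes "x \<in> topspace X" "y \<in> topspace X"
  shows "d (p x) (p y) \<le> D x y"
proof (rule dense_ge)
  fix r assume "D x y < r"
  then obtain g where "pathin X g" "g 0 = x" "g 1 = y" "curve_length d (p \<circ> g) < ennreal r"
    using D_less assms by blast
  then show "d (p x) (p y) \<le> r" using path_near[of g r 1] by auto
qed

lemma D_triangle:
  assumes x: "x \<in> topspace X" and y: "y \<in> topspace X" and z: "z \<in> topspace X"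
  shows "D x z \<le> D x y + D y z"
proof (rule field_le_epsilon)
  fix e :: real assume "0 < e"
  obtain g where g: "pathin X g" "g 0 = x" "g 1 = y" "curve_length d (p \<circ> g) < ennreal (D x y + e/2)"
    using D_less[OF x y, of "D x y + e/2"] \<open>0 < e\<close> by auto
  obtain h where h: "pathin X h" "h 0 = y" "h 1 = z" "curve_length d (p \<circ> h) < ennreal (D y z + e/2)"
    using D_less[OF y z, of "D y z + e/2"] \<open>0 < e\<close> by auto
  have "p \<circ> join_paths g h = join_paths (p \<circ> g) (p \<circ> h)" by (auto simp: join_paths_def)
  then have "curve_length d (p \<circ> join_paths g h) \<le> curve_length d (p \<circ> g) + curve_length d (p \<circ> h)"
    using g h pM path_in_X[OF g(1)] path_in_X[OF h(1)] unfolding \<open>p \<circ> join_paths g h = _\<close>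
    by (intro curve_length_join[of M] triangle nonneg) auto
  also have "\<dots> \<le> ennreal (D x y + e/2) + ennreal (D y z + e/2)"
    using g h by (intro add_mono) auto
  also have "\<dots> = ennreal (D x y + D y z + e)"
    using \<open>0 < e\<close> D_nonneg by (subst ennreal_plus[symmetric]) (auto simp: algebra_simps)
  finally show "D x z \<le> D x y + D y z + e"
    using g h \<open>0 < e\<close> D_nonneg by (intro D_le[of "join_paths g h"] pathin_join add_nonneg_nonneg) auto
qed

text \<open>A path that is shorter than \<open>r\<close> stays over the ball, hence in one sheet, and a sheet
  contains only one point of the fibre.\<close>

lemma fibre_separated:
  assumes U: "evenly_covered X mtopology p U \<V>" "mball (p x) r \<subseteq> U"
    and x: "x \<in> topspace X" and y: "y \<in> topspace X" and xy: "p x = p y" "D x y < r"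
  shows "x = y"
proof -
  obtain g where g: "pathin X g" "g 0 = x" "g 1 = y" "curve_length d (p \<circ> g) < ennreal r"
    using D_less[OF x y xy(2)] by blast
  have gU: "p (g t) \<in> U" if "t \<in> {0..1}" for t
    using path_near[OF g(1,4) that] U(2) g(2) by auto
  have "p x \<in> U" using gU[of 0] g(2) by auto
  obtain V where V: "V \<in> \<V>" "x \<in> V" "inj_on p V"
    by (rule evenly_covered_sheet[OF U(1) x \<open>p x \<in> U\<close>])
  have "y \<in> V" using path_stays_in_sheet[OF U(1) V(1) g(1) gU, of 1] V(2) g(2,3) by auto
  then show ?thesis using V xy(1) by (auto dest: inj_onD)
qed

lemma evenly_covered_ball:
  assumes "y \<in> M"
  obtains U \<V> r where "evenly_covered X mtopology p U \<V>" "r > 0" "mball y r \<subseteq> U"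
proof -
  obtain U \<V> where U: "evenly_covered X mtopology p U \<V>" "y \<in> U"
    using covering_map_evenly_covered[OF cov] assms by auto
  then have "openin mtopology U" by (simp add: evenly_covered_def)
  then obtain r where "r > 0" "mball y r \<subseteq> U" using U(2) by (auto simp: openin_mtopology)
  then show ?thesis using that U by blast
qed

lemma D_Metric_space: "Metric_space (topspace X) D"
proof
  fix x y assume x: "x \<in> topspace X" and y: "y \<in> topspace X"
  show "D x y = 0 \<longleftrightarrow> x = y"
  proof
    assume 0: "D x y = 0"
    then have "d (p x) (p y) \<le> 0" using D_ge[OF x y] by simp
    then have "p x = p y" using nonneg[of "p x" "p y"] zero[OF pM[OF x] pM[OF y]] by linarith
    moreover obtain U \<V> r where "evenly_covered X mtopology p U \<V>" "r > 0" "mball (p x) r \<subseteq> U"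
      using evenly_covered_ball[OF pM[OF x]] by blast
    ultimately show "x = y" using fibre_separated x y 0 by metis
  qed (use D_refl x in auto)
qed (use D_nonneg D_commute D_triangle in auto)

end

section \<open>Presented groups\<close>

lemma words_Nil [simp]: "[] \<in> words S"
  and words_append [simp]: "u @ v \<in> words S \<longleftrightarrow> u \<in> words S \<and> v \<in> words S"
  and words_Cons [simp]: "(s, b) # u \<in> words S \<longleftrightarrow> s \<in> S \<and> u \<in> words S"
  by (auto simp: words_def)

definition inverse_word :: "'s word \<Rightarrow> 's word" where
  "inverse_word u = rev (map (\<lambda>(s, b). (s, \<not> b)) u)"

lemma inverse_word_in_words [simp]: "inverse_word u \<in> words S \<longleftrightarrow> u \<in> words S"
  by (induction u) (auto simp: inverse_word_def)

lemma inverse_word_Cons: "inverse_word ((s, b) # u) = inverse_word u @ [(s, \<not> b)]"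
  by (simp add: inverse_word_def)

lemma elementary_reduction_context:
  assumes "elementary_reduction S R u v" "w \<in> words S" "w' \<in> words S"
  shows "elementary_reduction S R (w @ u @ w') (w @ v @ w')"
  using assms(1)
proof cases
  case (cancel a b s c)
  then show ?thesis
    using elementary_reduction.cancel[of "w @ a" S "b @ w'" s R c] assms(2,3) by simp
next
  case (relator a b r)
  then show ?thesis
    using elementary_reduction.relator[of "w @ a" S "b @ w'" r R] assms(2,3) by simp
qed

lemma equiv_presentation_rel: "equiv (words S) (presentation_rel S R)"
proof (rule equivI)
  show "presentation_rel S R \<subseteq> words S \<times> words S" by (auto simp: presentation_rel_def)
  show "refl_on (words S) (presentation_rel S R)"
    by (auto simp: refl_on_def presentation_rel_def)
  show "sym (presentation_rel S R)"
    by (auto simp: sym_def presentation_rel_def intro: equivclp_sym)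
  show "trans (presentation_rel S R)"
    by (auto simp: trans_def presentation_rel_def intro: equivclp_trans)
qed

lemma presentation_rel_context:
  assumes "(u, v) \<in> presentation_rel S R" "w \<in> words S" "w' \<in> words S"
  shows "(w @ u @ w', w @ v @ w') \<in> presentation_rel S R"
proof -
  have "equivclp (elementary_reduction S R) u v" using assms(1) by (simp add: presentation_rel_def)
  then have "equivclp (elementary_reduction S R) (w @ u @ w') (w @ v @ w')"
  proof (induction rule: equivclp_induct)
    case (step y z)
    from step(2) have "elementary_reduction S R (w @ y @ w') (w @ z @ w') \<or>
        elementary_reduction S R (w @ z @ w') (w @ y @ w')"
      using elementary_reduction_context assms(2,3) by blast
    then show ?case using step(3) equivclp_into_equivclp by metis
  qed auto
  then show ?thesis using assms by (simp add: presentation_rel_def)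
qed

abbreviation word_class :: "'s set \<Rightarrow> 's word set \<Rightarrow> 's word \<Rightarrow> 's word set" where
  "word_class S R u \<equiv> presentation_rel S R `` {u}"

lemma word_class_eq_iff:
  assumes "u \<in> words S" "v \<in> words S"
  shows "word_class S R u = word_class S R v \<longleftrightarrow> (u, v) \<in> presentation_rel S R"
  using eq_equiv_class_iff[OF equiv_presentation_rel assms] .

lemma word_class_reduce:
  assumes "elementary_reduction S R u v" "u \<in> words S" "v \<in> words S"
  shows "word_class S R u = word_class S R v"
  unfolding word_class_eq_iff[OF assms(2,3)] using assms by (auto simp: presentation_rel_def)

lemma presentation_rel_append:
  assumes "(u, u') \<in> presentation_rel S R" "(v, v') \<in> presentation_rel S R"
  shows "(u @ v, u' @ v') \<in> presentation_rel S R"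
proof -
  have w: "u' \<in> words S" "v \<in> words S" using assms by (auto simp: presentation_rel_def)
  have "(u @ v, u' @ v) \<in> presentation_rel S R"
    using presentation_rel_context[OF assms(1), of "[]" v] w by simp
  moreover have "(u' @ v, u' @ v') \<in> presentation_rel S R"
    using presentation_rel_context[OF assms(2), of u' "[]"] w by simp
  ultimately show ?thesis
    using equiv_presentation_rel[of S R] by (meson equivE transE)
qed

lemma presented_group_carrierE:
  assumes "A \<in> carrier (presented_group S R)"
  obtains u where "u \<in> words S" "A = word_class S R u"
  using assms by (auto simp: presented_group_def elim: quotientE)

lemma word_class_carrier [simp]: "u \<in> words S \<Longrightarrow> word_class S R u \<in> carrier (presented_group S R)"
  by (auto simp: presented_group_def intro: quotientI)

lemma word_class_mult:
  assumes u: "u \<in> words S" and v: "v \<in> words S"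
  shows "word_class S R u \<otimes>\<^bsub>presented_group S R\<^esub> word_class S R v = word_class S R (u @ v)"
proof -
  have "word_class S R (u' @ v') = word_class S R (u @ v)"
    if "u' \<in> word_class S R u" "v' \<in> word_class S R v" for u' v'
  proof -
    have *: "(u @ v, u' @ v') \<in> presentation_rel S R"
      using presentation_rel_append that by fast
    show ?thesis using equiv_class_eq[OF equiv_presentation_rel *] by simp
  qed
  then have "(\<Union>u'\<in>word_class S R u. \<Union>v'\<in>word_class S R v. word_class S R (u' @ v')) =
      (\<Union>u'\<in>word_class S R u. \<Union>v'\<in>word_class S R v. word_class S R (u @ v))"
    by (intro SUP_cong refl) blast
  also have "\<dots> = word_class S R (u @ v)"
  proof -
    have "word_class S R u \<noteq> {}" "word_class S R v \<noteq> {}"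
      using equiv_class_self[OF equiv_presentation_rel] u v by blast+
    then show ?thesis by (simp only: UN_constant if_False)
  qed
  finally show ?thesis by (simp add: presented_group_def)
qed

lemma word_class_one: "\<one>\<^bsub>presented_group S R\<^esub> = word_class S R []"
  by (simp add: presented_group_def)

lemma word_class_inverse:
  "u \<in> words S \<Longrightarrow> word_class S R (inverse_word u @ u) = word_class S R []"
proof (induction u)
  case (Cons a u)
  obtain s b where a: "a = (s, b)" by force
  have u: "u \<in> words S" "s \<in> S" using Cons.prems a by auto
  have "elementary_reduction S R (inverse_word u @ [(s, \<not> b), (s, \<not> \<not> b)] @ u) (inverse_word u @ u)"
    using u by (intro elementary_reduction.cancel) auto
  then have "word_class S R (inverse_word (a # u) @ a # u) = word_class S R (inverse_word u @ u)"
    using u a by (intro word_class_reduce) (auto simp: inverse_word_Cons)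
  then show ?case using Cons.IH u by simp
qed (simp add: inverse_word_def)

lemma group_presented_group: "group (presented_group S R)"
proof (rule groupI)
  show "\<one>\<^bsub>presented_group S R\<^esub> \<in> carrier (presented_group S R)" by (simp add: word_class_one)
  fix x assume "x \<in> carrier (presented_group S R)"
  then obtain u where u: "u \<in> words S" "x = word_class S R u" by (rule presented_group_carrierE)
  show "\<one>\<^bsub>presented_group S R\<^esub> \<otimes>\<^bsub>presented_group S R\<^esub> x = x"
    using u by (simp add: word_class_one word_class_mult)
  show "\<exists>y\<in>carrier (presented_group S R). y \<otimes>\<^bsub>presented_group S R\<^esub> x = \<one>\<^bsub>presented_group S R\<^esub>"
    using u word_class_inverse[OF u(1)]
    by (intro bexI[of _ "word_class S R (inverse_word u)"]) (auto simp: word_class_one word_class_mult)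
  fix y assume "y \<in> carrier (presented_group S R)"
  then obtain v where v: "v \<in> words S" "y = word_class S R v" by (rule presented_group_carrierE)
  show "x \<otimes>\<^bsub>presented_group S R\<^esub> y \<in> carrier (presented_group S R)"
    using u v by (simp add: word_class_mult)
  fix z assume "z \<in> carrier (presented_group S R)"
  then obtain w where w: "w \<in> words S" "z = word_class S R w" by (rule presented_group_carrierE)
  show "x \<otimes>\<^bsub>presented_group S R\<^esub> y \<otimes>\<^bsub>presented_group S R\<^esub> z =
      x \<otimes>\<^bsub>presented_group S R\<^esub> (y \<otimes>\<^bsub>presented_group S R\<^esub> z)"
    using u v w by (simp add: word_class_mult)
qed

definition letter_value :: "('g, 'm) monoid_scheme \<Rightarrow> ('s \<Rightarrow> 'g) \<Rightarrow> 's \<times> bool \<Rightarrow> 'g" where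
  "letter_value H f = (\<lambda>(s, b). if b then f s else inv\<^bsub>H\<^esub> f s)"

definition word_value :: "('g, 'm) monoid_scheme \<Rightarrow> ('s \<Rightarrow> 'g) \<Rightarrow> 's word \<Rightarrow> 'g" where
  "word_value H f u = foldr (\<lambda>l x. letter_value H f l \<otimes>\<^bsub>H\<^esub> x) u \<one>\<^bsub>H\<^esub>"

lemma word_value_Nil [simp]: "word_value H f [] = \<one>\<^bsub>H\<^esub>"
  and word_value_Cons: "word_value H f (l # u) = letter_value H f l \<otimes>\<^bsub>H\<^esub> word_value H f u"
  by (simp_all add: word_value_def)

context
  fixes H :: "('g, 'm) monoid_scheme" and f :: "'s \<Rightarrow> 'g" and S :: "'s set"
  assumes H: "group H" and f: "\<And>s. s \<in> S \<Longrightarrow> f s \<in> carrier H"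
begin

lemma letter_value_closed: "s \<in> S \<Longrightarrow> letter_value H f (s, b) \<in> carrier H"
  using f group.inv_closed[OF H] by (simp add: letter_value_def)

lemma word_value_closed: "u \<in> words S \<Longrightarrow> word_value H f u \<in> carrier H"
proof (induction u)
  case (Cons a u)
  then show ?case
    using letter_value_closed monoid.m_closed[OF group.is_monoid[OF H]]
    by (cases a) (auto simp: word_value_Cons)
qed (simp add: monoid.one_closed[OF group.is_monoid[OF H]])

lemma word_value_append:
  "u \<in> words S \<Longrightarrow> v \<in> words S \<Longrightarrow> word_value H f (u @ v) = word_value H f u \<otimes>\<^bsub>H\<^esub> word_value H f v"
proof (induction u)
  case Nil
  then show ?case using word_value_closed monoid.l_one[OF group.is_monoid[OF H]] by simp
next
  case (Cons a u)
  then show ?case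
    using letter_value_closed word_value_closed monoid.m_assoc[OF group.is_monoid[OF H]]
    by (cases a) (auto simp: word_value_Cons)
qed

lemma word_value_reduction:
  assumes R: "\<And>r. r \<in> R \<inter> words S \<Longrightarrow> word_value H f r = \<one>\<^bsub>H\<^esub>"
    and red: "elementary_reduction S R u v"
  shows "word_value H f u = word_value H f v"
  using red
proof cases
  case (cancel a b s c)
  have "word_value H f [(s, c), (s, \<not> c)] = \<one>\<^bsub>H\<^esub>"
    using f[OF cancel(5)] group.l_inv[OF H] group.r_inv[OF H] group.inv_closed[OF H]
      monoid.r_one[OF group.is_monoid[OF H]]
    by (cases c) (auto simp: word_value_Cons letter_value_def)
  then show ?thesis
    using cancel word_value_append word_value_closed monoid.l_one[OF group.is_monoid[OF H]]
      word_value_append[of "[(s, c), (s, \<not> c)]" b]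
    by simp
next
  case (relator a b r)
  then show ?thesis
    using R[of r] word_value_append word_value_closed monoid.l_one[OF group.is_monoid[OF H]] by simp
qed

theorem presented_group_universal:
  assumes R: "\<And>r. r \<in> R \<inter> words S \<Longrightarrow> word_value H f r = \<one>\<^bsub>H\<^esub>"
  obtains \<phi> where "\<phi> \<in> hom (presented_group S R) H"
    "\<And>u. u \<in> words S \<Longrightarrow> \<phi> (word_class S R u) = word_value H f u"
proof -
  define \<phi> where "\<phi> A = word_value H f (SOME u. u \<in> A)" for A
  have inv: "word_value H f u = word_value H f v" if "(u, v) \<in> presentation_rel S R" for u v
  proof -
    have "equivclp (elementary_reduction S R) u v" using that by (simp add: presentation_rel_def)
    then show ?thesis
    proof (induction rule: equivclp_induct)
      case (step y z)
      from step(2) have "word_value H f y = word_value H f z"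
        using word_value_reduction[OF R, of R] by metis
      then show ?case using step(3) by simp
    qed simp
  qed
  have val: "\<phi> (word_class S R u) = word_value H f u" if "u \<in> words S" for u
  proof -
    have "u \<in> word_class S R u" using equiv_class_self[OF equiv_presentation_rel that] .
    then have "(SOME v. v \<in> word_class S R u) \<in> word_class S R u" by (rule someI)
    then show ?thesis unfolding \<phi>_def using inv by auto
  qed
  have "\<phi> \<in> hom (presented_group S R) H"
  proof (rule homI)
    fix x y assume x: "x \<in> carrier (presented_group S R)" and y: "y \<in> carrier (presented_group S R)"
    obtain u where u: "u \<in> words S" "x = word_class S R u" by (rule presented_group_carrierE[OF x])
    obtain v where v: "v \<in> words S" "y = word_class S R v" by (rule presented_group_carrierE[OF y])
    show "\<phi> x \<in> carrier H" using u val word_value_closed by simp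
    show "\<phi> (x \<otimes>\<^bsub>presented_group S R\<^esub> y) = \<phi> x \<otimes>\<^bsub>H\<^esub> \<phi> y"
      using u v by (simp add: word_class_mult val word_value_append)
  qed
  then show ?thesis using that val by blast
qed

end

section \<open>The space of three tori\<close>

datatype circle = CA | CB | CC | CD

fun first_circle :: "torus \<Rightarrow> circle" where
  "first_circle T1 = CA" | "first_circle T2 = CB" | "first_circle T3 = CC"

fun second_circle :: "torus \<Rightarrow> circle" where
  "second_circle T1 = CB" | "second_circle T2 = CC" | "second_circle T3 = CD"

text \<open>Let the four loops be the coordinate circles of the torus \<open>\<real>\<^sup>4 / \<int>\<^sup>4\<close>. Then \<open>Y\<close> is the union
  of three of its coordinate 2-tori, and \<open>coord i z\<close> are the coordinates of the image of the point
  \<open>z\<close> of the plane that covers the torus \<open>i\<close>.\<close>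

definition coord :: "torus \<Rightarrow> real \<times> real \<Rightarrow> circle \<Rightarrow> real" where
  "coord i z l = (if l = first_circle i then fst z else if l = second_circle i then snd z else 0)"

lemma first_neq_second [simp]: "first_circle i \<noteq> second_circle i" "second_circle i \<noteq> first_circle i"
  by (cases i; simp)+

lemma coord_simps [simp]:
  "coord i z (first_circle i) = fst z" "coord i z (second_circle i) = snd z"
  "l \<noteq> first_circle i \<Longrightarrow> l \<noteq> second_circle i \<Longrightarrow> coord i z l = 0"
  by (auto simp: coord_def)

abbreviation gluing_steps :: "square_point rel" where
  "gluing_steps \<equiv> side_pairings \<union> geodesic_gluings \<union> (side_pairings \<union> geodesic_gluings)\<inverse>"

lemma gluing_steps_sym: "sym (gluing_steps\<^sup>*)"
  by (intro sym_rtrancl) (auto simp: sym_def)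

lemma Y_rel_eq: "Y_rel = Restr (gluing_steps\<^sup>*) unit_squares"
  by (simp add: Y_rel_def)

lemma gluing_steps_coord:
  assumes "(x, y) \<in> gluing_steps"
  shows "coord (fst x) (snd x) l - coord (fst y) (snd y) l \<in> \<int>"
  using assms by (auto simp: side_pairings_def geodesic_gluings_def coord_def)

lemma gluing_rtrancl_coord:
  assumes "(x, y) \<in> gluing_steps\<^sup>*"
  shows "coord (fst x) (snd x) l - coord (fst y) (snd y) l \<in> \<int>"
  using assms
proof (induction rule: rtrancl_induct)
  case (step y z)
  have "coord (fst x) (snd x) l - coord (fst z) (snd z) l =
      (coord (fst x) (snd x) l - coord (fst y) (snd y) l) + (coord (fst y) (snd y) l - coord (fst z) (snd z) l)"
    by simp
  then show ?case using step.IH gluing_steps_coord[OF step.hyps(2)] by (metis Ints_add)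
qed simp

lemma unit_interval_Ints_diff:
  fixes s s' :: real
  assumes "s \<in> {0..1}" "s' \<in> {0..1}" "s - s' \<in> \<int>"
  shows "s = s' \<or> s = 0 \<and> s' = 1 \<or> s = 1 \<and> s' = 0"
proof -
  obtain n where n: "s - s' = of_int n" using assms(3) by (auto elim: Ints_cases)
  have "-1 \<le> (of_int n :: real)" "(of_int n :: real) \<le> 1" using assms n by auto
  then have "n = -1 \<or> n = 0 \<or> n = 1" by linarith
  then show ?thesis using n assms by auto
qed

lemma gluing_within_square:
  assumes "s \<in> {0..1}" "s' \<in> {0..1}" "s - s' \<in> \<int>" "t \<in> {0..1}" "t' \<in> {0..1}" "t - t' \<in> \<int>"
  shows "((i, s, t), (i, s', t')) \<in> gluing_steps\<^sup>*"
proof -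
  have "((i, s, t), (i, s', t)) \<in> gluing_steps\<^sup>*"
    using unit_interval_Ints_diff[OF assms(1,2,3)] assms
    by (elim disjE) (auto simp: side_pairings_def intro: r_into_rtrancl)
  also have "((i, s', t), (i, s', t')) \<in> gluing_steps\<^sup>*"
    using unit_interval_Ints_diff[OF assms(4,5,6)] assms
    by (elim disjE) (auto simp: side_pairings_def intro: r_into_rtrancl)
  finally show ?thesis .
qed

lemma gluing_adjacent_tori:
  assumes ij: "(i, j) \<in> {(T1, T2), (T2, T3)}"
    and "s \<in> {0..1}" "t \<in> {0..1}" "s' \<in> {0..1}" "t' \<in> {0..1}" "s \<in> \<int>" "t' \<in> \<int>" "t - s' \<in> \<int>"
  shows "((i, s, t), (j, s', t')) \<in> gluing_steps\<^sup>*"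
proof -
  have "((i, s, t), (i, 0, t)) \<in> gluing_steps\<^sup>*"
    using assms by (intro gluing_within_square) auto
  also have "((i, 0, t), (j, t, 0)) \<in> gluing_steps\<^sup>*"
    using assms by (auto simp: geodesic_gluings_def intro!: r_into_rtrancl)
  also have "((j, t, 0), (j, s', t')) \<in> gluing_steps\<^sup>*"
    using assms by (intro gluing_within_square) auto
  finally show ?thesis .
qed

text \<open>\<open>T1\<close> and \<open>T3\<close> are not glued to each other, but points with equal coordinates
  in these tori are corners, and a corner of \<open>T2\<close> connects them.\<close>

lemma gluing_coord_complete:
  assumes x: "(i, s, t) \<in> unit_squares" and y: "(j, s', t') \<in> unit_squares"
    and c: "\<And>l. coord i (s, t) l - coord j (s', t') l \<in> \<int>"
  shows "((i, s, t), (j, s', t')) \<in> gluing_steps\<^sup>*"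
proof -
  have u: "s \<in> {0..1}" "t \<in> {0..1}" "s' \<in> {0..1}" "t' \<in> {0..1}" using x y by (auto simp: unit_squares_def)
  have adj: "((i, s, t), (j, s', t')) \<in> gluing_steps\<^sup>*"
    if ij: "(i, j) \<in> {(T1, T2), (T2, T3)}" and "(i, s, t) \<in> unit_squares" "(j, s', t') \<in> unit_squares"
      and c: "\<And>l. coord i (s, t) l - coord j (s', t') l \<in> \<int>" for i j s t s' t'
  proof (rule gluing_adjacent_tori[OF ij])
    show "s \<in> \<int>" "t' \<in> \<int>" "t - s' \<in> \<int>"
      using c[of "first_circle i"] c[of "second_circle j"] c[of "second_circle i"] ij
      by (auto simp: coord_def)
  qed (use that in \<open>auto simp: unit_squares_def\<close>)
  have far: "((T1, s, t), (T3, s', t')) \<in> gluing_steps\<^sup>*"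
    if "(T1, s, t) \<in> unit_squares" "(T3, s', t') \<in> unit_squares"
      and c: "\<And>l. coord T1 (s, t) l - coord T3 (s', t') l \<in> \<int>" for s t s' t'
  proof -
    have Z: "s \<in> \<int>" "t \<in> \<int>" "s' \<in> \<int>" "t' \<in> \<int>"
      using c[of CA] c[of CB] c[of CC] c[of CD] by (auto simp: coord_def)
    have "((T1, s, t), (T2, 0, 0)) \<in> gluing_steps\<^sup>*" "((T2, 0, 0), (T3, s', t')) \<in> gluing_steps\<^sup>*"
      using that Z by (auto intro!: adj simp: coord_def unit_squares_def)
    then show ?thesis by (rule rtrancl_trans)
  qed
  have c': "coord j (s', t') l - coord i (s, t) l \<in> \<int>" for l
    using c[of l] by (metis Ints_minus minus_diff_eq)
  show ?thesis
  proof (cases "i = j")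
    case True
    then show ?thesis
      using gluing_within_square[of s s' t t' i] u c[of "first_circle i"] c[of "second_circle i"] by simp
  next
    case False
    then consider "(i, j) \<in> {(T1, T2), (T2, T3)}" | "(j, i) \<in> {(T1, T2), (T2, T3)}"
      | "i = T1" "j = T3" | "i = T3" "j = T1"
      by (cases i; cases j) auto
    then show ?thesis
    proof cases
      case 1 then show ?thesis using adj x y c by blast
    next
      case 2 then show ?thesis using adj x y c' gluing_steps_sym by (metis symD)
    next
      case 3 then show ?thesis using far x y c by blast
    next
      case 4 then show ?thesis using far x y c' gluing_steps_sym by (metis symD)
    qed
  qed
qed

lemma equiv_Y_rel: "equiv unit_squares Y_rel"
proof (rule equivI)
  show "Y_rel \<subseteq> unit_squares \<times> unit_squares" by (auto simp: Y_rel_eq)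
  show "refl_on unit_squares Y_rel" by (auto simp: refl_on_def Y_rel_eq)
  show "sym Y_rel" using gluing_steps_sym by (auto simp: sym_def Y_rel_eq)
  show "trans Y_rel" by (auto simp: trans_def Y_rel_eq)
qed

lemma Y_rel_iff:
  assumes "x \<in> unit_squares" "y \<in> unit_squares"
  shows "(x, y) \<in> Y_rel \<longleftrightarrow> (\<forall>l. coord (fst x) (snd x) l - coord (fst y) (snd y) l \<in> \<int>)"
proof
  assume "(x, y) \<in> Y_rel"
  then show "\<forall>l. coord (fst x) (snd x) l - coord (fst y) (snd y) l \<in> \<int>"
    using gluing_rtrancl_coord unfolding Y_rel_eq by blast
next
  assume "\<forall>l. coord (fst x) (snd x) l - coord (fst y) (snd y) l \<in> \<int>"
  then show "(x, y) \<in> Y_rel"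
    using gluing_coord_complete[of "fst x" "fst (snd x)" "snd (snd x)" "fst y" "fst (snd y)" "snd (snd y)"] assms
    unfolding Y_rel_eq by simp
qed

text \<open>The universal covering of the torus \<open>i\<close>, followed by the inclusion into \<open>Y\<close>.\<close>

definition flat_map :: "torus \<Rightarrow> real \<times> real \<Rightarrow> square_point set" where
  "flat_map i z = Y_rel `` {(i, frac (fst z), frac (snd z))}"

lemma frac_in_square [simp]: "(i, frac s, frac t) \<in> unit_squares"
  using frac_lt_1[of s] frac_lt_1[of t] by (auto simp: unit_squares_def less_imp_le)

lemma frac_diff_in_Ints_iff: "frac a - frac b \<in> \<int> \<longleftrightarrow> a - b \<in> \<int>"
proof -
  have eq: "a - b = (frac a - frac b) + of_int (\<lfloor>a\<rfloor> - \<lfloor>b\<rfloor>)" by (simp add: frac_def)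
  show ?thesis unfolding eq by (metis Ints_add Ints_diff Ints_of_int add_diff_cancel_right')
qed

lemma coord_frac: "coord i (frac s, frac t) l = frac (coord i (s, t) l)"
  by (simp add: coord_def)

text \<open>From here on, this criterion takes the place of the gluing relation.\<close>

lemma flat_map_eq_iff: "flat_map i z = flat_map j w \<longleftrightarrow> (\<forall>l. coord i z l - coord j w l \<in> \<int>)"
proof -
  have "flat_map i z = flat_map j w \<longleftrightarrow>
      ((i, frac (fst z), frac (snd z)), (j, frac (fst w), frac (snd w))) \<in> Y_rel"
    unfolding flat_map_def by (rule eq_equiv_class_iff[OF equiv_Y_rel]) simp_all
  also have "\<dots> \<longleftrightarrow> (\<forall>l. coord i z l - coord j w l \<in> \<int>)"
    by (simp add: Y_rel_iff coord_frac frac_diff_in_Ints_iff)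
  finally show ?thesis .
qed

lemma flat_map_cong: "(\<And>l. coord i z l - coord j w l \<in> \<int>) \<Longrightarrow> flat_map i z = flat_map j w"
  by (simp add: flat_map_eq_iff)

lemma flat_map_translate:
  assumes "a \<in> \<int>" "b \<in> \<int>"
  shows "flat_map i (u + a, v + b) = flat_map i (u, v)"
  by (rule flat_map_cong) (use assms in \<open>simp add: coord_def\<close>)

lemma class_eq_flat_map:
  assumes "x \<in> unit_squares"
  shows "Y_rel `` {x} = flat_map (fst x) (snd x)"
proof -
  have "coord (fst x) (snd x) l - coord (fst x) (frac (fst (snd x)), frac (snd (snd x))) l \<in> \<int>" for l
    by (simp add: coord_def frac_def)
  then have "(x, (fst x, frac (fst (snd x)), frac (snd (snd x)))) \<in> Y_rel"
    using assms by (simp add: Y_rel_iff)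
  then show ?thesis
    unfolding flat_map_def by (rule equiv_class_eq[OF equiv_Y_rel])
qed

lemma flat_map_in_Y [simp]: "flat_map i z \<in> Y_space"
  unfolding flat_map_def Y_space_def by (intro quotientI) simp

lemma Y_spaceE:
  assumes "A \<in> Y_space"
  obtains i z where "A = flat_map i z"
  using assms unfolding Y_space_def by (auto elim!: quotientE simp: class_eq_flat_map)

lemma mem_Y_space:
  assumes "A \<in> Y_space" "x \<in> unit_squares"
  shows "x \<in> A \<longleftrightarrow> A = flat_map (fst x) (snd x)"
proof -
  obtain y where y: "y \<in> unit_squares" "A = Y_rel `` {y}"
    using assms(1) unfolding Y_space_def by (rule quotientE)
  have "x \<in> A \<longleftrightarrow> A = Y_rel `` {x}"
    unfolding y(2) eq_equiv_class_iff[OF equiv_Y_rel y(1) assms(2)] by simp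
  then show ?thesis using class_eq_flat_map[OF assms(2)] by simp
qed

text \<open>The coordinates in \<open>\<real> / \<int>\<close> as points of the unit circle in the complex plane, to make
  them functions on \<open>Y\<close> with a norm at hand.\<close>

definition circle_coord :: "circle \<Rightarrow> square_point set \<Rightarrow> complex" where
  "circle_coord l A = (let x = (SOME x. A = flat_map (fst x) (snd x)) in cis (2 * pi * coord (fst x) (snd x) l))"

lemma cis_2pi_eq_iff: "cis (2 * pi * a) = cis (2 * pi * b) \<longleftrightarrow> a - b \<in> \<int>"
proof -
  have "cis (2 * pi * a) = cis (2 * pi * b) \<longleftrightarrow> cis (2 * pi * a - 2 * pi * b) = 1"
    by (simp add: cis_divide[symmetric])
  also have "\<dots> \<longleftrightarrow> cos (2 * pi * (a - b)) = 1"
    by (auto simp: complex_eq_iff right_diff_distrib cos_one_sin_zero)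
  also have "\<dots> \<longleftrightarrow> (\<exists>n::int. a - b = n)" unfolding cos_one_2pi_int by auto
  also have "\<dots> \<longleftrightarrow> a - b \<in> \<int>" by (auto simp: Ints_def)
  finally show ?thesis .
qed

lemma norm_cis_diff_le: "norm (cis a - cis b) \<le> \<bar>a - b\<bar>"
proof (rule power2_le_imp_le)
  have "(norm (cis a - cis b))\<^sup>2 = 2 - 2 * cos (a - b)"
    using sin_cos_squared_add[of a] sin_cos_squared_add[of b]
    by (simp add: cmod_power2 cos_diff power2_diff algebra_simps)
  also have "cos (a - b) = 1 - 2 * (sin ((a - b) / 2))\<^sup>2"
  proof -
    have "2 * ((a - b) / 2) = a - b" by simp
    then show ?thesis using cos_double_sin[of "(a - b) / 2"] by metis
  qed
  also have "2 - 2 * (1 - 2 * (sin ((a - b) / 2))\<^sup>2) = 4 * \<bar>sin ((a - b) / 2)\<bar>\<^sup>2" by simp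
  also have "\<dots> \<le> 4 * \<bar>(a - b) / 2\<bar>\<^sup>2"
    using abs_sin_x_le_abs_x[of "(a - b) / 2"] by (intro mult_left_mono power_mono) auto
  also have "\<dots> = \<bar>a - b\<bar>\<^sup>2" by (simp add: power_divide)
  finally show "(norm (cis a - cis b))\<^sup>2 \<le> \<bar>a - b\<bar>\<^sup>2" .
qed simp

lemma circle_coord_flat_map: "circle_coord l (flat_map i z) = cis (2 * pi * coord i z l)"
proof -
  let ?x = "SOME x. flat_map i z = flat_map (fst x) (snd x)"
  have "flat_map i z = flat_map (fst ?x) (snd ?x)"
    by (rule someI[of _ "(i, z)"]) simp
  then have "coord i z l - coord (fst ?x) (snd ?x) l \<in> \<int>" unfolding flat_map_eq_iff by blast
  then have "coord (fst ?x) (snd ?x) l - coord i z l \<in> \<int>"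
    by (subst minus_diff_eq[symmetric]) (rule Ints_minus)
  then show ?thesis unfolding circle_coord_def Let_def cis_2pi_eq_iff .
qed

lemma circle_coord_inject:
  assumes "A \<in> Y_space" "B \<in> Y_space" "\<And>l. circle_coord l A = circle_coord l B"
  shows "A = B"
proof -
  obtain i z j w where A: "A = flat_map i z" and B: "B = flat_map j w" using assms(1,2) by (metis Y_spaceE)
  show ?thesis
    unfolding A B by (rule flat_map_cong) (use assms(3) in \<open>simp add: A B circle_coord_flat_map cis_2pi_eq_iff\<close>)
qed

definition chain_length :: "(square_point \<times> square_point) list \<Rightarrow> real" where
  "chain_length c = (\<Sum>(x, y)\<leftarrow>c. dist (snd x) (snd y))"

abbreviation Y_chains where "Y_chains \<equiv> gluing_chains unit_squares Y_rel"

lemma chain_length_nonneg: "0 \<le> chain_length c"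
  unfolding chain_length_def by (rule sum_list_nonneg) auto

lemma gluing_chains_Cons:
  "(x, y) # c \<in> gluing_chains P R A B \<longleftrightarrow> x \<in> P \<and> y \<in> P \<and> fst x = fst y \<and> x \<in> A \<and>
     (if c = [] then y \<in> B else c \<in> gluing_chains P R (R `` {y}) B)"
proof (cases c)
  case (Cons a c')
  have split: "(\<forall>k. Q k) \<longleftrightarrow> Q 0 \<and> (\<forall>k. Q (Suc k))" for Q :: "nat \<Rightarrow> bool"
    by (metis nat.exhaust)
  have "(\<forall>k. Suc k < length ((x, y) # c) \<longrightarrow> (snd (((x, y) # c) ! k), fst (((x, y) # c) ! Suc k)) \<in> R) \<longleftrightarrow>
      (y, fst a) \<in> R \<and> (\<forall>k. Suc k < length c \<longrightarrow> (snd (c ! k), fst (c ! Suc k)) \<in> R)"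
    unfolding Cons by (subst split) simp
  then show ?thesis unfolding gluing_chains_def using Cons by auto
qed (auto simp: gluing_chains_def)

lemma Y_chain_induct [consumes 2, case_names single step]:
  assumes "A \<in> Y_space" "c \<in> Y_chains A B"
    and single: "\<And>i z w. (i, z) \<in> unit_squares \<Longrightarrow> (i, w) \<in> unit_squares \<Longrightarrow> flat_map i w = B \<Longrightarrow>
        P (flat_map i z) [((i, z), (i, w))]"
    and step: "\<And>i z w c. (i, z) \<in> unit_squares \<Longrightarrow> (i, w) \<in> unit_squares \<Longrightarrow>
        c \<in> Y_chains (flat_map i w) B \<Longrightarrow> P (flat_map i w) c \<Longrightarrow> P (flat_map i z) (((i, z), (i, w)) # c)"
    and B: "B \<in> Y_space"
  shows "P A c"
  using assms(1,2)
proof (induction c arbitrary: A)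
  case Nil
  then show ?case by (simp add: gluing_chains_def)
next
  case (Cons a c)
  obtain x y where a: "a = (x, y)" by (cases a)
  note ch = Cons.prems(2)[unfolded a gluing_chains_Cons]
  define i z w where "i = fst x" and "z = snd x" and "w = snd y"
  have x: "x = (i, z)" and y: "y = (i, w)" using ch by (simp_all add: i_def z_def w_def prod_eq_iff)
  have xy: "(i, z) \<in> unit_squares" "(i, w) \<in> unit_squares" "(i, z) \<in> A"
    using ch unfolding x y by blast+
  have A: "A = flat_map i z" using mem_Y_space[OF Cons.prems(1) xy(1)] xy(3) by simp
  show ?case
  proof (cases "c = []")
    case True
    then have "(i, w) \<in> B" using ch unfolding y by simp
    then have "flat_map i w = B" using mem_Y_space[OF B xy(2)] by simp
    then show ?thesis using single[of i z w] xy unfolding a A x y True by blast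
  next
    case False
    then have "c \<in> Y_chains (Y_rel `` {(i, w)}) B" using ch unfolding y by simp
    then have "c \<in> Y_chains (flat_map i w) B" unfolding class_eq_flat_map[OF xy(2)] by simp
    then show ?thesis using step[of i z w c] Cons.IH[of "flat_map i w"] xy unfolding a A x y by simp
  qed
qed

lemma chain_length_Nil [simp]: "chain_length [] = 0"
  and chain_length_Cons [simp]: "chain_length (((i, z), (j, w)) # c) = dist z w + chain_length c"
  by (simp_all add: chain_length_def)

lemma Y_dist_eq: "Y_dist A B = enn2real (INF c \<in> Y_chains A B. ennreal (chain_length c))"
  by (simp add: Y_dist_def quotient_dist_def chain_length_def)

lemma Y_dist_le: "c \<in> Y_chains A B \<Longrightarrow> Y_dist A B \<le> chain_length c"
  unfolding Y_dist_eq by (intro enn2real_leI chain_length_nonneg INF_lower)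

lemma Y_chains_single:
  assumes "(i, z) \<in> unit_squares" "(i, w) \<in> unit_squares"
  shows "[((i, z), (i, w))] \<in> Y_chains (flat_map i z) (flat_map i w)"
  using assms mem_Y_space[of "flat_map i z" "(i, z)"] mem_Y_space[of "flat_map i w" "(i, w)"]
  by (simp add: gluing_chains_Cons)

lemma Y_chains_append:
  assumes "A \<in> Y_space" "c \<in> Y_chains A B" "B \<in> Y_space" "c' \<in> Y_chains B C"
  shows "c @ c' \<in> Y_chains A C"
  using assms(1,2)
proof (induction A c rule: Y_chain_induct)
  case (single i z w)
  have ne: "c' \<noteq> []" using assms(4) by (auto simp: gluing_chains_def)
  have "(i, z) \<in> flat_map i z" using mem_Y_space[of "flat_map i z" "(i, z)"] single by simp
  then show ?case
    using single ne assms(4) class_eq_flat_map[OF single(2)] by (simp add: gluing_chains_Cons)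
next
  case (step i z w c)
  have ne: "c \<noteq> []" using step by (auto simp: gluing_chains_def)
  have "(i, z) \<in> flat_map i z" using mem_Y_space[of "flat_map i z" "(i, z)"] step by simp
  then show ?case
    using step ne class_eq_flat_map[OF step(2)] by (simp add: gluing_chains_Cons)
qed (rule assms)

lemma flat_map_unit_square:
  obtains w where "(i, w) \<in> unit_squares" "flat_map i w = flat_map i z"
proof (rule that[of "(frac (fst z), frac (snd z))"])
  show "flat_map i (frac (fst z), frac (snd z)) = flat_map i z"
    by (simp add: flat_map_def)
qed simp

lemma Y_chains_nonempty:
  assumes "A \<in> Y_space" "B \<in> Y_space"
  shows "Y_chains A B \<noteq> {}"
proof -
  obtain i z where A: "(i, z) \<in> unit_squares" "A = flat_map i z"
    using Y_spaceE[OF assms(1)] flat_map_unit_square by metis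
  obtain j w where B: "(j, w) \<in> unit_squares" "B = flat_map j w"
    using Y_spaceE[OF assms(2)] flat_map_unit_square by metis
  \<comment> \<open>All squares share the vertex of \<open>Y\<close>, through which the chain passes.\<close>
  have 0: "(i, 0, 0) \<in> unit_squares" "(j, 0, 0) \<in> unit_squares" by (auto simp: unit_squares_def)
  have "flat_map i (0, 0) = flat_map j (0, 0)" by (rule flat_map_cong) (simp add: coord_def)
  then have "[((i, z), (i, 0, 0))] @ [((j, 0, 0), (j, w))] \<in> Y_chains A B"
    using Y_chains_single[OF A(1) 0(1)] Y_chains_single[OF 0(2) B(1)] assms A B
    by (intro Y_chains_append[where B = "flat_map i (0, 0)"]) simp_all
  then show ?thesis by blast
qed

lemma Y_dist_less:
  assumes "A \<in> Y_space" "B \<in> Y_space" "Y_dist A B < r"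
  obtains c where "c \<in> Y_chains A B" "chain_length c < r"
proof -
  obtain c where c: "c \<in> Y_chains A B" "ennreal (chain_length c) < \<infinity>"
    using Y_chains_nonempty[OF assms(1,2)] by auto
  show ?thesis
    by (rule enn2real_INF_less[OF c assms(3)[unfolded Y_dist_eq]])
      (use that chain_length_nonneg in \<open>simp add: ennreal_less_iff\<close>)
qed

text \<open>Together with the injectivity of the coordinates, this lower bound for the distance
  shows that it separates the points of \<open>Y\<close>.\<close>

lemma circle_coord_Lipschitz:
  assumes "A \<in> Y_space" "B \<in> Y_space"
  shows "norm (circle_coord l A - circle_coord l B) \<le> 2 * pi * Y_dist A B"
proof -
  have flat: "norm (circle_coord l (flat_map i z) - circle_coord l (flat_map i w)) \<le> 2 * pi * dist z w" for i z w
  proof -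
    have "norm (circle_coord l (flat_map i z) - circle_coord l (flat_map i w)) \<le>
        \<bar>2 * pi * coord i z l - 2 * pi * coord i w l\<bar>"
      unfolding circle_coord_flat_map by (rule norm_cis_diff_le)
    also have "\<dots> = 2 * pi * \<bar>coord i z l - coord i w l\<bar>"
      by (simp add: abs_mult flip: right_diff_distrib)
    also have "\<bar>coord i z l - coord i w l\<bar> \<le> dist z w"
      using dist_fst_le[of z w] dist_snd_le[of z w] by (simp add: coord_def dist_real_def)
    finally show ?thesis by simp
  qed
  have chain: "norm (circle_coord l A - circle_coord l B) \<le> 2 * pi * chain_length c"
    if "c \<in> Y_chains A B" for c
    using assms(1) that
  proof (induction A c rule: Y_chain_induct)
    case (single i z w)
    then show ?case using flat[of i z w] by simp
  next
    case (step i z w c)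
    show ?case
      using norm_triangle_ineq[of "circle_coord l (flat_map i z) - circle_coord l (flat_map i w)"
          "circle_coord l (flat_map i w) - circle_coord l B"] flat[of i z w] step
      by (simp add: distrib_left)
  qed (rule assms)
  have "norm (circle_coord l A - circle_coord l B) / (2 * pi) \<le> Y_dist A B"
  proof (rule dense_ge)
    fix r assume "Y_dist A B < r"
    then obtain c where c: "c \<in> Y_chains A B" "chain_length c < r" using Y_dist_less assms by blast
    then have "norm (circle_coord l A - circle_coord l B) \<le> 2 * pi * r"
      using chain[OF c(1)] by (intro order_trans[OF chain[OF c(1)]]) simp
    then show "norm (circle_coord l A - circle_coord l B) / (2 * pi) \<le> r" by (simp add: field_simps)
  qed
  then show ?thesis by (simp add: field_simps)
qed

lemma Y_chains_reverse:
  assumes "c \<in> Y_chains A B"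
  shows "rev (map prod.swap c) \<in> Y_chains B A" "chain_length (rev (map prod.swap c)) = chain_length c"
proof -
  let ?c = "rev (map prod.swap c)"
  have c: "c \<noteq> []" "\<And>a. a \<in> set c \<Longrightarrow> fst a \<in> unit_squares \<and> snd a \<in> unit_squares \<and> fst (fst a) = fst (snd a)"
    "fst (hd c) \<in> A" "snd (last c) \<in> B"
    and rel: "\<And>k. Suc k < length c \<Longrightarrow> (snd (c ! k), fst (c ! Suc k)) \<in> Y_rel"
    using assms by (auto simp: gluing_chains_def)
  have "(snd (?c ! k), fst (?c ! Suc k)) \<in> Y_rel" if "Suc k < length ?c" for k
  proof -
    let ?m = "length c - Suc (Suc k)"
    have m: "Suc ?m < length c" "Suc ?m = length c - Suc k" using that by auto
    have "?c ! k = prod.swap (c ! Suc ?m)" "?c ! Suc k = prod.swap (c ! ?m)"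
      using that m by (simp_all add: rev_nth)
    moreover have "sym Y_rel" using equiv_Y_rel by (simp add: equiv_def)
    ultimately show ?thesis using symD[OF _ rel[OF m(1)]] by simp
  qed
  moreover have "fst (hd ?c) \<in> B" "snd (last ?c) \<in> A"
    using c by (simp_all add: hd_rev last_rev last_map hd_map)
  moreover have "\<forall>(x, y)\<in>set ?c. x \<in> unit_squares \<and> y \<in> unit_squares \<and> fst x = fst y"
  proof (unfold case_prod_unfold, intro ballI)
    fix a assume "a \<in> set ?c"
    then have "prod.swap a \<in> set c" by auto
    from c(2)[OF this] show "fst a \<in> unit_squares \<and> snd a \<in> unit_squares \<and> fst (fst a) = fst (snd a)"
      by simp
  qed
  ultimately show "?c \<in> Y_chains B A"
    using c(1) unfolding gluing_chains_def by simp
  show "chain_length ?c = chain_length c"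
    unfolding chain_length_def by (simp add: rev_map[symmetric] sum_list_rev o_def case_prod_unfold dist_commute)
qed

lemma Y_dist_commute: "Y_dist A B = Y_dist B A"
proof -
  have *: "(INF c \<in> Y_chains A B. ennreal (chain_length c)) \<le> (INF c \<in> Y_chains B A. ennreal (chain_length c))" for A B
  proof (rule INF_greatest)
    fix c assume c: "c \<in> Y_chains B A"
    show "(INF c \<in> Y_chains A B. ennreal (chain_length c)) \<le> ennreal (chain_length c)"
      using Y_chains_reverse[OF c] by (intro INF_lower2) auto
  qed
  show ?thesis unfolding Y_dist_eq by (intro arg_cong[where f = enn2real] antisym *)
qed

lemma chain_length_append [simp]: "chain_length (c @ c') = chain_length c + chain_length c'"
  by (simp add: chain_length_def)

lemma Y_dist_flat_le:
  assumes "(i, z) \<in> unit_squares" "(i, w) \<in> unit_squares"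
  shows "Y_dist (flat_map i z) (flat_map i w) \<le> dist z w"
  using Y_dist_le[OF Y_chains_single[OF assms]] by simp

lemma Y_dist_refl: "A \<in> Y_space \<Longrightarrow> Y_dist A A = 0"
  using Y_dist_flat_le flat_map_unit_square Y_spaceE
  by (metis Y_dist_eq dist_self enn2real_nonneg order_antisym)

lemma Y_dist_triangle:
  assumes "A \<in> Y_space" "B \<in> Y_space" "C \<in> Y_space"
  shows "Y_dist A C \<le> Y_dist A B + Y_dist B C"
proof (rule field_le_epsilon)
  fix e :: real assume "0 < e"
  obtain c where c: "c \<in> Y_chains A B" "chain_length c < Y_dist A B + e/2"
    using Y_dist_less[OF assms(1,2), of "Y_dist A B + e/2"] \<open>0 < e\<close> by auto
  obtain c' where c': "c' \<in> Y_chains B C" "chain_length c' < Y_dist B C + e/2"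
    using Y_dist_less[OF assms(2,3), of "Y_dist B C + e/2"] \<open>0 < e\<close> by auto
  show "Y_dist A C \<le> Y_dist A B + Y_dist B C + e"
    using Y_dist_le[OF Y_chains_append[OF assms(1) c(1) assms(2) c'(1)]] c(2) c'(2) by simp
qed

interpretation Y: Metric_space Y_space Y_dist
proof
  show "0 \<le> Y_dist A B" for A B by (simp add: Y_dist_eq)
  show "Y_dist A B = Y_dist B A" for A B by (rule Y_dist_commute)
  show "Y_dist A C \<le> Y_dist A B + Y_dist B C" if "A \<in> Y_space" "B \<in> Y_space" "C \<in> Y_space" for A B C
    using that by (rule Y_dist_triangle)
  show "Y_dist A B = 0 \<longleftrightarrow> A = B" if AB: "A \<in> Y_space" "B \<in> Y_space" for A B
  proof
    assume "Y_dist A B = 0"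
    then have "circle_coord l A = circle_coord l B" for l
      using circle_coord_Lipschitz[OF AB, of l] by simp
    then show "A = B" using circle_coord_inject AB by blast
  qed (use Y_dist_refl AB in simp)
qed

lemma Y_topology_eq: "Y_topology = Y.mtopology"
  by (simp add: Y_topology_def)

lemma topspace_Y [simp]: "topspace Y_topology = Y_space"
  by (simp add: Y_topology_eq)

lemma flat_map_unit_cell:
  assumes m: "m \<in> \<int>" "n \<in> \<int>" and z: "fst z \<in> {m..m+1}" "snd z \<in> {n..n+1}" and w: "fst w \<in> {m..m+1}" "snd w \<in> {n..n+1}"
  shows "Y_dist (flat_map i z) (flat_map i w) \<le> dist z w"
proof -
  have *: "flat_map i (fst x - m, snd x - n) = flat_map i x" for x
    using flat_map_translate[of "-m" "-n" i "fst x" "snd x"] m by simp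
  have "Y_dist (flat_map i (fst z - m, snd z - n)) (flat_map i (fst w - m, snd w - n)) \<le>
      dist (fst z - m, snd z - n) (fst w - m, snd w - n)"
    using z w by (intro Y_dist_flat_le) (auto simp: unit_squares_def)
  also have "\<dots> = dist z w" by (simp add: dist_prod_def dist_real_def)
  finally show ?thesis by (simp add: *)
qed

text \<open>An interval of length less than one contains at most one integer in its interior, so it
  meets at most two unit cells.\<close>

lemma Lipschitz_across_integer:
  fixes f :: "real \<Rightarrow> square_point set"
  assumes f: "\<And>u. f u \<in> Y_space"
    and cell: "\<And>m a b. m \<in> \<int> \<Longrightarrow> a \<in> {m..m+1} \<Longrightarrow> b \<in> {m..m+1} \<Longrightarrow> Y_dist (f a) (f b) \<le> \<bar>a - b\<bar>"
    and uv: "\<bar>u - v\<bar> < 1"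
  shows "Y_dist (f u) (f v) \<le> \<bar>u - v\<bar>"
proof -
  have *: "Y_dist (f u) (f v) \<le> \<bar>u - v\<bar>" if uv: "u \<le> v" "v < u + 1" for u v
  proof -
    let ?m = "of_int \<lfloor>u\<rfloor> :: real"
    have m: "?m \<le> u" "u \<le> ?m + 1" "?m \<le> v" "v \<le> ?m + 2" using uv floor_correct[of u] by linarith+
    show ?thesis
    proof (cases "v \<le> ?m + 1")
      case True
      then show ?thesis using m by (intro cell[of ?m]) auto
    next
      case False
      have "Y_dist (f u) (f (?m + 1)) \<le> \<bar>u - (?m + 1)\<bar>"
        using m by (intro cell[of ?m]) auto
      moreover have "Y_dist (f (?m + 1)) (f v) \<le> \<bar>(?m + 1) - v\<bar>"
        using False m by (intro cell[of "?m + 1"]) auto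
      ultimately show ?thesis using Y_dist_triangle[of "f u" "f (?m + 1)" "f v"] f m False by auto
    qed
  qed
  show ?thesis using *[of u v] *[of v u] uv Y_dist_commute[of "f u" "f v"] by (cases "u \<le> v") auto
qed

text \<open>The constant \<open>2\<close> comes from moving parallel to the two axes, one after the other; this
  suffices for continuity. The exact estimate \<open>Y_dist_flat_le\<close> within a square gives the lengths of
  paths.\<close>

lemma flat_map_Lipschitz:
  assumes "dist z w < 1"
  shows "Y_dist (flat_map i z) (flat_map i w) \<le> 2 * dist z w"
proof -
  have d: "\<bar>fst z - fst w\<bar> \<le> dist z w" "\<bar>snd z - snd w\<bar> \<le> dist z w"
    using dist_fst_le[of z w] dist_snd_le[of z w] by (simp_all add: dist_real_def)
  have cell: "x \<in> {of_int \<lfloor>x\<rfloor>..of_int \<lfloor>x\<rfloor> + 1}" for x :: real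
    using floor_correct[of x] by auto
  have "Y_dist (flat_map i (fst z, snd z)) (flat_map i (fst w, snd z)) \<le> \<bar>fst z - fst w\<bar>"
  proof (rule Lipschitz_across_integer)
    show "Y_dist (flat_map i (a, snd z)) (flat_map i (b, snd z)) \<le> \<bar>a - b\<bar>"
      if "m \<in> \<int>" "a \<in> {m..m+1}" "b \<in> {m..m+1}" for m a b
      using flat_map_unit_cell[of m "of_int \<lfloor>snd z\<rfloor>" "(a, snd z)" "(b, snd z)" i] that cell[of "snd z"]
      by (simp add: dist_prod_def dist_real_def)
  qed (use d assms in auto)
  moreover have "Y_dist (flat_map i (fst w, snd z)) (flat_map i (fst w, snd w)) \<le> \<bar>snd z - snd w\<bar>"
  proof (rule Lipschitz_across_integer)
    show "Y_dist (flat_map i (fst w, a)) (flat_map i (fst w, b)) \<le> \<bar>a - b\<bar>"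
      if "m \<in> \<int>" "a \<in> {m..m+1}" "b \<in> {m..m+1}" for m a b
      using flat_map_unit_cell[of "of_int \<lfloor>fst w\<rfloor>" m "(fst w, a)" "(fst w, b)" i] that cell[of "fst w"]
      by (simp add: dist_prod_def dist_real_def)
  qed (use d assms in auto)
  ultimately show ?thesis
    using Y_dist_triangle[of "flat_map i (fst z, snd z)" "flat_map i (fst w, snd z)" "flat_map i (fst w, snd w)"] d
    by simp
qed

lemma continuous_map_into_metric:
  fixes f :: "'z::metric_space \<Rightarrow> 'b"
  assumes M: "Metric_space M d" and f: "\<And>z. f z \<in> M"
    and L: "\<And>z w. dist z w < 1 \<Longrightarrow> d (f z) (f w) \<le> L * dist z w"
  shows "continuous_map euclidean (Metric_space.mtopology M d) f"
proof -
  interpret Metric_space M d by (rule M)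
  show ?thesis
    unfolding continuous_map_to_metric
  proof (intro ballI allI impI)
    fix z and e :: real assume e: "0 < e"
    define r where "r = min 1 (e / (\<bar>L\<bar> + 1))"
    have r: "r > 0" using e by (auto simp: r_def)
    have "f w \<in> mball (f z) e" if "w \<in> ball z r" for w
    proof -
      have zw: "dist z w < 1" "dist z w < e / (\<bar>L\<bar> + 1)" using that by (auto simp: r_def)
      have "d (f z) (f w) \<le> L * dist z w" by (rule L[OF zw(1)])
      also have "\<dots> \<le> (\<bar>L\<bar> + 1) * dist z w" by (intro mult_right_mono) auto
      also have "\<dots> < e" using zw(2) by (simp add: field_simps)
      finally show ?thesis using f by simp
    qed
    then show "\<exists>U. openin euclidean U \<and> z \<in> U \<and> (\<forall>w\<in>U. f w \<in> mball (f z) e)"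
      using r by (intro exI[of _ "ball z r"]) auto
  qed
qed

lemma continuous_flat_map: "continuous_map euclidean Y_topology (flat_map i)"
  unfolding Y_topology_eq
  by (rule continuous_map_into_metric[where L = 2]) (use Y.Metric_space_axioms flat_map_Lipschitz in auto)

lemma compactin_UN_torus:
  assumes "\<And>i. compactin T (S i)"
  shows "compactin T (\<Union>i::torus. S i)"
proof -
  have UNIV: "(UNIV :: torus set) = {T1, T2, T3}" using torus.exhaust by auto
  have "(\<Union>i. S i) = S T1 \<union> (S T2 \<union> S T3)"
    unfolding UNIV by (simp only: UN_insert UN_empty Un_empty_right)
  then show ?thesis using assms by (simp add: compactin_Un)
qed

lemma compact_Y: "compact_space Y_topology"
proof -
  have "compactin Y_topology (\<Union>i. flat_map i ` ({0..1} \<times> {0..1}))"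
    by (intro compactin_UN_torus image_compactin[OF _ continuous_flat_map]) (auto simp: compact_Times)
  moreover have "(\<Union>i. flat_map i ` ({0..1} \<times> {0..1})) = Y_space"
  proof (intro equalityI subsetI)
    fix A assume "A \<in> Y_space"
    then obtain i z where A: "A = flat_map i z" by (rule Y_spaceE)
    obtain w where "(i, w) \<in> unit_squares" "flat_map i w = flat_map i z" by (rule flat_map_unit_square)
    then show "A \<in> (\<Union>i. flat_map i ` ({0..1} \<times> {0..1}))"
      unfolding A unit_squares_def by (metis (no_types, lifting) SigmaD2 UN_iff UNIV_I image_eqI)
  qed auto
  ultimately show ?thesis by (simp add: compact_space_def)
qed

subsection \<open>Reflections\<close>

definition signed :: "bool \<Rightarrow> real \<Rightarrow> real" where
  "signed b u = (if b then - u else u)"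

definition flip_coords :: "(circle \<Rightarrow> bool) \<Rightarrow> torus \<Rightarrow> real \<times> real \<Rightarrow> real \<times> real" where
  "flip_coords \<sigma> i z = (signed (\<sigma> (first_circle i)) (fst z), signed (\<sigma> (second_circle i)) (snd z))"

text \<open>The isometry that reverses the loops \<open>l\<close> with \<open>\<sigma> l\<close>.\<close>

definition reflect :: "(circle \<Rightarrow> bool) \<Rightarrow> square_point set \<Rightarrow> square_point set" where
  "reflect \<sigma> A = (let x = (SOME x. A = flat_map (fst x) (snd x)) in flat_map (fst x) (flip_coords \<sigma> (fst x) (snd x)))"

lemma coord_flip: "coord i (flip_coords \<sigma> i z) l = signed (\<sigma> l) (coord i z l)"
  by (simp add: coord_def flip_coords_def signed_def)

lemma reflect_flat_map [simp]: "reflect \<sigma> (flat_map i z) = flat_map i (flip_coords \<sigma> i z)"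
proof -
  define x where "x = (SOME x. flat_map i z = flat_map (fst x) (snd x))"
  have "flat_map i z = flat_map (fst x) (snd x)"
    unfolding x_def by (rule someI[of _ "(i, z)"]) simp
  then have c: "coord i z l - coord (fst x) (snd x) l \<in> \<int>" for l unfolding flat_map_eq_iff by blast
  have "signed b a - signed b a' \<in> \<int>" if "a' - a \<in> \<int>" for a a' b
    using that Ints_minus[OF that] by (cases b) (simp_all add: signed_def)
  then have "flat_map (fst x) (flip_coords \<sigma> (fst x) (snd x)) = flat_map i (flip_coords \<sigma> i z)"
    unfolding flat_map_eq_iff coord_flip using c by (intro allI) simp
  then show ?thesis unfolding reflect_def Let_def x_def .
qed

lemma reflect_in_Y [simp]: "A \<in> Y_space \<Longrightarrow> reflect \<sigma> A \<in> Y_space"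
  by (elim Y_spaceE) simp

lemma reflect_reflect: "A \<in> Y_space \<Longrightarrow> reflect \<sigma> (reflect \<tau> A) = reflect (\<lambda>l. \<sigma> l \<noteq> \<tau> l) A"
  by (elim Y_spaceE) (simp add: flip_coords_def signed_def)

lemma reflect_none: "A \<in> Y_space \<Longrightarrow> reflect (\<lambda>l. False) A = A"
  by (elim Y_spaceE) (simp add: flip_coords_def signed_def)

text \<open>On a unit square, reversing a loop is the reflection \<open>s \<mapsto> 1 - s\<close> of a coordinate, so
  chains are taken to chains.\<close>

lemma reflect_chain:
  assumes "A \<in> Y_space" "c \<in> Y_chains A B" "B \<in> Y_space"
  shows "\<exists>c'. c' \<in> Y_chains (reflect \<sigma> A) (reflect \<sigma> B) \<and> chain_length c' = chain_length c"
  using assms(1,2)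
proof (induction A c rule: Y_chain_induct)
  define m where "m b s = (if b then 1 - s else s)" for b and s :: real
  \<comment> \<open>The isometry in the coordinates of the unit square.\<close>
  define h where "h i z = (m (\<sigma> (first_circle i)) (fst z), m (\<sigma> (second_circle i)) (snd z))" for i z
  have h: "(i, h i z) \<in> unit_squares" if "(i, z) \<in> unit_squares" for i z
    using that by (cases z) (auto simp: unit_squares_def h_def m_def)
  have dist: "dist (h i z) (h i w) = dist z w" for i z w
    by (simp add: dist_prod_def h_def m_def dist_real_def power2_commute)
  have fl: "flat_map i (h i z) = flat_map i (flip_coords \<sigma> i z)" for i z
    by (rule flat_map_cong) (simp add: coord_def flip_coords_def h_def m_def signed_def)
  {
    case (single i z w)
    show ?case
      using Y_chains_single[OF h h, of i z w] single reflect_flat_map[of \<sigma> i w]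
      by (intro exI[of _ "[((i, h i z), (i, h i w))]"]) (auto simp: fl dist)
  next
    case (step i z w c)
    then obtain c' where c': "c' \<in> Y_chains (reflect \<sigma> (flat_map i w)) (reflect \<sigma> B)" "chain_length c' = chain_length c"
      by blast
    have "[((i, h i z), (i, h i w))] @ c' \<in> Y_chains (flat_map i (h i z)) (reflect \<sigma> B)"
      using Y_chains_single[OF h h, of i z w] step c'
      by (intro Y_chains_append[where B = "flat_map i (h i w)"]) (auto simp: fl)
    then show ?case
      using c' by (intro exI[of _ "[((i, h i z), (i, h i w))] @ c'"]) (simp add: fl dist)
  }
qed (rule assms)

lemma reflect_isometry:
  assumes A: "A \<in> Y_space" and B: "B \<in> Y_space"
  shows "Y_dist (reflect \<sigma> A) (reflect \<sigma> B) = Y_dist A B"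
proof -
  have *: "Y_dist (reflect \<sigma> A) (reflect \<sigma> B) \<le> Y_dist A B" if A: "A \<in> Y_space" and B: "B \<in> Y_space" for A B
  proof (rule dense_ge)
    fix r assume "Y_dist A B < r"
    then obtain c where c: "c \<in> Y_chains A B" "chain_length c < r" by (rule Y_dist_less[OF A B])
    then show "Y_dist (reflect \<sigma> A) (reflect \<sigma> B) \<le> r"
      using reflect_chain[OF A c(1) B, of \<sigma>] Y_dist_le by fastforce
  qed
  have inv: "reflect \<sigma> (reflect \<sigma> A) = A" if "A \<in> Y_space" for A
    using reflect_reflect[OF that, of \<sigma> \<sigma>] reflect_none[OF that] by simp
  show ?thesis using *[OF A B] *[OF reflect_in_Y[OF A] reflect_in_Y[OF B], of ] inv A B by (metis antisym)
qed

lemma continuous_reflect: "continuous_map Y_topology Y_topology (reflect \<sigma>)"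
  unfolding Y_topology_eq
  by (rule Lipschitz_continuous_imp_continuous_map[of "metric (Y_space, Y_dist)" "metric (Y_space, Y_dist)", simplified])
    (auto simp: Lipschitz_continuous_map_def reflect_isometry intro!: exI[of _ 1])

section \<open>The universal cover as a metric space\<close>

locale croke_kleiner =
  fixes X :: "'x topology" and p :: "'x \<Rightarrow> square_point set"
  assumes universal: "universal_cover X Y_topology p"
begin

lemma covering: "covering_map X Y_topology p" and simply_connected: "simply_connected_space X"
  using universal by (auto simp: universal_cover_def)

lemma connected_X: "connected_space X"
  using simply_connected path_connected_imp_connected_space by (auto simp: simply_connected_space_def)

lemma p_in_Y [simp]: "x \<in> topspace X \<Longrightarrow> p x \<in> Y_space"
  using covering_map_surj[OF covering] by auto

lemma continuous_p: "continuous_map X Y_topology p"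
  using covering by (rule covering_map_continuous)

definition lifts :: "('z::euclidean_space \<Rightarrow> square_point set) \<Rightarrow> ('z \<Rightarrow> 'x) \<Rightarrow> bool" where
  "lifts f F \<longleftrightarrow> continuous_map euclidean X F \<and> (\<forall>z. p (F z) = f z)"

lemma lifts_exist:
  assumes "continuous_map euclidean Y_topology f" "x \<in> topspace X" "p x = f z"
  obtains F where "lifts f F" "F z = x"
proof (rule lifting_criterion[OF covering _ euclidean_space_locally_path_connected assms(1) _ assms(2,3)])
  show "simply_connected_space (euclidean :: 'a topology)"
    using euclidean_convex_simply_connected[of "UNIV :: 'a set"] by simp
  fix F assume "continuous_map euclidean X F" "\<And>z. z \<in> topspace euclidean \<Longrightarrow> p (F z) = f z" "F z = x"
  then show ?thesis by (intro that[of F]) (simp_all add: lifts_def)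
qed simp

lemma lifts_unique:
  fixes F G :: "'z::euclidean_space \<Rightarrow> 'x"
  assumes F: "lifts f F" and G: "lifts f G" and z: "F z = G z"
  shows "F = G"
proof
  fix w
  have "connected_space (euclidean :: 'z topology)"
    using connected_UNIV by (simp add: connectedin_def flip: connectedin_iff_connected)
  then show "F w = G w"
    by (rule lift_unique[OF covering, of _ F G z]) (use F G z in \<open>auto simp: lifts_def\<close>)
qed

lemma lifts_in_X [simp]: "lifts f F \<Longrightarrow> F z \<in> topspace X"
  by (auto simp: lifts_def continuous_map_def)

lemma lifts_p: "lifts f F \<Longrightarrow> p (F z) = f z"
  by (simp add: lifts_def)

text \<open>The lifts of \<^const>\<open>flat_map\<close> are the flats of \<open>X\<close>.\<close>

definition flat_step :: "'x \<Rightarrow> 'x \<Rightarrow> bool" where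
  "flat_step x y \<longleftrightarrow> (\<exists>i F z w. lifts (flat_map i) F \<and> F z = x \<and> F w = y)"

abbreviation "flat_linked \<equiv> flat_step\<^sup>*\<^sup>*"

lemma flat_linked_sym: "flat_linked x y \<Longrightarrow> flat_linked y x"
proof -
  have "symp flat_step" unfolding symp_def flat_step_def by blast
  then show "flat_linked x y \<Longrightarrow> flat_linked y x" by (metis symp_rtranclp sympD)
qed

text \<open>That the path runs through flats is recorded for the proof of transitivity on vertices.\<close>

definition short_path :: "'x \<Rightarrow> 'x \<Rightarrow> real \<Rightarrow> (real \<Rightarrow> 'x) \<Rightarrow> bool" where
  "short_path x y r g \<longleftrightarrow> pathin X g \<and> g 0 = x \<and> g 1 = y \<and>
     curve_length Y_dist (p \<circ> g) \<le> ennreal r \<and> flat_linked x y"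

lemma path_p_in_Y: "pathin X g \<Longrightarrow> (p \<circ> g) ` {0..1} \<subseteq> Y_space"
  using p_in_Y by (fastforce simp: pathin_def continuous_map_def simp del: p_in_Y)

lemma short_path_join:
  assumes "short_path x y r g" "short_path y z s h" "0 \<le> r" "0 \<le> s"
  shows "short_path x z (r + s) (join_paths g h)"
proof -
  have gh: "pathin X g" "pathin X h" "g 1 = h 0" using assms by (auto simp: short_path_def)
  have "p \<circ> join_paths g h = join_paths (p \<circ> g) (p \<circ> h)" by (rule ext) (simp add: join_paths_def)
  then have "curve_length Y_dist (p \<circ> join_paths g h) \<le> curve_length Y_dist (p \<circ> g) + curve_length Y_dist (p \<circ> h)"
    using curve_length_join[OF Y_dist_triangle Y.nonneg path_p_in_Y[OF gh(1)] path_p_in_Y[OF gh(2)]] gh(3)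
    by simp
  also have "\<dots> \<le> ennreal r + ennreal s" using assms by (intro add_mono) (auto simp: short_path_def)
  also have "\<dots> = ennreal (r + s)" using assms by simp
  finally have "curve_length Y_dist (p \<circ> join_paths g h) \<le> ennreal (r + s)" .
  moreover have "flat_linked x z" using assms rtranclp_trans unfolding short_path_def by metis
  ultimately show ?thesis using assms pathin_join[OF gh] unfolding short_path_def by simp
qed

lemma short_path_reverse:
  assumes "short_path x y r g"
  shows "short_path y x r (\<lambda>t. g (1 - t))"
proof -
  have "curve_length Y_dist (p \<circ> (\<lambda>t. g (1 - t))) = curve_length Y_dist (p \<circ> g)"
    using curve_length_reverse[of Y_dist "p \<circ> g"] Y_dist_commute by (simp add: o_def)
  then show ?thesis using assms pathin_reverse[of X g] flat_linked_sym unfolding short_path_def by simp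
qed

lemma flat_segment:
  assumes F: "lifts (flat_map i) F" and "0 \<le> c"
    and L: "\<And>s t. 0 \<le> s \<Longrightarrow> s \<le> t \<Longrightarrow> t \<le> 1 \<Longrightarrow>
      Y_dist (flat_map i ((1 - s) *\<^sub>R z + s *\<^sub>R w)) (flat_map i ((1 - t) *\<^sub>R z + t *\<^sub>R w)) \<le> c * (dist z w * (t - s))"
  shows "pathin X (\<lambda>t. F ((1 - t) *\<^sub>R z + t *\<^sub>R w))"
    "curve_length Y_dist (p \<circ> (\<lambda>t. F ((1 - t) *\<^sub>R z + t *\<^sub>R w))) \<le> ennreal (c * dist z w)"
proof -
  let ?\<gamma> = "\<lambda>t. (1 - t) *\<^sub>R z + t *\<^sub>R w"
  have "continuous_map euclidean X F" using F by (simp add: lifts_def)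
  then show "pathin X (\<lambda>t. F (?\<gamma> t))"
    unfolding pathin_def
    by (intro continuous_map_compose[of _ euclidean ?\<gamma> X F, unfolded o_def]) (auto intro!: continuous_intros)
  have "p \<circ> (\<lambda>t. F (?\<gamma> t)) = (\<lambda>t. flat_map i (?\<gamma> t))" using F by (auto simp: lifts_p)
  moreover have "curve_length Y_dist (\<lambda>t. flat_map i (?\<gamma> t)) \<le> ennreal (c * dist z w)"
    by (rule curve_length_Lipschitz) (use L \<open>0 \<le> c\<close> in \<open>auto simp: mult.assoc\<close>)
  ultimately show "curve_length Y_dist (p \<circ> (\<lambda>t. F (?\<gamma> t))) \<le> ennreal (c * dist z w)" by simp
qed

lemma dist_on_segment:
  fixes z w :: "'a::real_normed_vector"
  assumes "s \<le> t"
  shows "dist ((1 - s) *\<^sub>R z + s *\<^sub>R w) ((1 - t) *\<^sub>R z + t *\<^sub>R w) = dist z w * (t - s)"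
proof -
  have "((1 - s) *\<^sub>R z + s *\<^sub>R w) - ((1 - t) *\<^sub>R z + t *\<^sub>R w) = (t - s) *\<^sub>R (z - w)" by (simp add: algebra_simps)
  then show ?thesis using assms by (simp add: dist_norm mult.commute)
qed

lemma short_path_segment:
  assumes F: "lifts (flat_map i) F" and zw: "(i, z) \<in> unit_squares" "(i, w) \<in> unit_squares"
  shows "short_path (F z) (F w) (dist z w) (\<lambda>t. F ((1 - t) *\<^sub>R z + t *\<^sub>R w))"
proof -
  let ?\<gamma> = "\<lambda>t. (1 - t) *\<^sub>R z + t *\<^sub>R w"
  have conv: "convex ({0..1::real} \<times> {0..1::real})" by (intro convex_Times) auto
  have sq: "(i, ?\<gamma> t) \<in> unit_squares" if "0 \<le> t" "t \<le> 1" for t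
    using convexD_alt[OF conv _ _ that, of z w] zw by (simp add: unit_squares_def)
  have "Y_dist (flat_map i (?\<gamma> s)) (flat_map i (?\<gamma> t)) \<le> 1 * (dist z w * (t - s))"
    if "0 \<le> s" "s \<le> t" "t \<le> 1" for s t
    using Y_dist_flat_le[OF sq[of s] sq[of t]] dist_on_segment[OF that(2), of z w] that by simp
  note seg = flat_segment[OF F _ this]
  have "flat_step (F z) (F w)" using F unfolding flat_step_def by blast
  then show ?thesis unfolding short_path_def using seg by auto
qed

lemma chain_lift:
  assumes "A \<in> Y_space" "c \<in> Y_chains A B" "B \<in> Y_space"
  shows "\<forall>x \<in> topspace X. p x = A \<longrightarrow> (\<exists>y g. p y = B \<and> short_path x y (chain_length c) g)"
  using assms(1,2)
proof (induction A c rule: Y_chain_induct)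
  case (single i z w)
  show ?case
  proof (intro ballI impI)
    fix x assume "x \<in> topspace X" "p x = flat_map i z"
    then obtain F where F: "lifts (flat_map i) F" "F z = x" by (rule lifts_exist[OF continuous_flat_map])
    show "\<exists>y g. p y = B \<and> short_path x y (chain_length [((i, z), (i, w))]) g"
      using short_path_segment[OF F(1) single(1,2)] F lifts_p[OF F(1), of w] single(3)
      by (intro exI[of _ "F w"]) auto
  qed
next
  case (step i z w c)
  show ?case
  proof (intro ballI impI)
    fix x assume "x \<in> topspace X" "p x = flat_map i z"
    then obtain F where F: "lifts (flat_map i) F" "F z = x" by (rule lifts_exist[OF continuous_flat_map])
    have "F w \<in> topspace X" "p (F w) = flat_map i w" using F(1) by (auto simp: lifts_p)
    then obtain y g where y: "p y = B" "short_path (F w) y (chain_length c) g" using step(4) by blast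
    show "\<exists>y g. p y = B \<and> short_path x y (chain_length (((i, z), (i, w)) # c)) g"
      using short_path_join[OF short_path_segment[OF F(1) step(1,2)] y(2)] y(1) F(2) chain_length_nonneg
      by (intro exI[of _ y]) auto
  qed
qed (rule assms)

lemma short_path_near:
  assumes "short_path x y s g" "0 \<le> s" "s < r" "t \<in> {0..1}"
  shows "p (g t) \<in> Y.mball (p x) r"
proof -
  have g: "pathin X g" "g 0 = x" "curve_length Y_dist (p \<circ> g) \<le> ennreal s"
    using assms(1) by (auto simp: short_path_def)
  have "g t \<in> topspace X" "g 0 \<in> topspace X"
    using g(1) assms(4) by (auto simp: pathin_def continuous_map_def)
  moreover have "ennreal (Y_dist (p x) (p (g t))) \<le> ennreal s"
    using dist_le_curve_length[of 0 t Y_dist "p \<circ> g"] g assms(4) by auto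
  then have "Y_dist (p x) (p (g t)) < r" using assms(2,3) by (simp add: ennreal_le_iff)
  ultimately show ?thesis using g(2) by simp
qed

text \<open>Points of a ball in \<open>Y\<close> are joined to its centre by chains that are shorter than the
  radius. The lifts of these chains stay over the ball, hence in a sheet over it, so they reach all
  points of the sheet that lie over the ball.\<close>

lemma short_path_neighbourhood:
  assumes O': "openin X O'" and x: "x \<in> O'"
  obtains N where "openin X N" "x \<in> N" "N \<subseteq> O'" "path_connectedin X N"
    "\<And>z. z \<in> N \<Longrightarrow> \<exists>r g. 0 \<le> r \<and> short_path x z r g"
proof -
  have xX: "x \<in> topspace X" using openin_subset[OF O'] x by blast
  then obtain U \<V> where U: "evenly_covered X Y_topology p U \<V>" "p x \<in> U"
    using covering_map_evenly_covered[OF covering, of "p x"] by auto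
  obtain V where V: "V \<in> \<V>" "x \<in> V" "openin X V" "V \<subseteq> topspace X" "p ` V = U" "inj_on p V"
    "homeomorphic_map (subtopology X V) (subtopology Y_topology U) p"
    by (rule evenly_covered_sheet[OF U(1) xX U(2)])
  have oU: "openin Y_topology U" using U(1) by (simp add: evenly_covered_def)
  \<comment> \<open>The part of the sheet in \<open>O'\<close>; its image is open, so it contains a ball.\<close>
  define W where "W = O' \<inter> V"
  have "openin (subtopology X V) W" using O' V(3) unfolding W_def by (auto simp: openin_open_subtopology)
  then have "openin (subtopology Y_topology U) (p ` W)"
    using homeomorphic_imp_open_map[OF V(7)] unfolding open_map_def by blast
  then have "openin Y_topology (p ` W)" using oU by (simp add: openin_open_subtopology)
  moreover have "x \<in> W" using x V(2) by (simp add: W_def)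
  ultimately obtain r where r: "r > 0" "Y.mball (p x) r \<subseteq> p ` W"
    unfolding Y_topology_eq Y.openin_mtopology by blast
  define N where "N = W \<inter> {z \<in> topspace X. p z \<in> Y.mball (p x) r}"
  have "openin X {z \<in> topspace X. p z \<in> Y.mball (p x) r}"
    by (rule openin_continuous_map_preimage[OF continuous_p]) (simp add: Y_topology_eq)
  then have oN: "openin X N" unfolding N_def W_def using O' V(3) by (intro openin_Int)
  have paths: "\<exists>s g. 0 \<le> s \<and> short_path x z s g \<and> g ` {0..1} \<subseteq> N" if z: "z \<in> N" for z
  proof -
    have zX: "z \<in> V" "z \<in> topspace X" "p z \<in> Y.mball (p x) r" using z by (auto simp: N_def W_def)
    then have "Y_dist (p x) (p z) < r" by simp
    then obtain c where c: "c \<in> Y_chains (p x) (p z)" "chain_length c < r"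
      using Y_dist_less[OF p_in_Y[OF xX] p_in_Y[OF zX(2)]] by blast
    obtain y g where y: "p y = p z" "short_path x y (chain_length c) g"
      using chain_lift[OF p_in_Y[OF xX] c(1) p_in_Y[OF zX(2)]] xX by blast
    have g: "pathin X g" "g 0 = x" "g 1 = y" using y(2) by (auto simp: short_path_def)
    have ball: "p (g t) \<in> Y.mball (p x) r" if "t \<in> {0..1}" for t
      using short_path_near[OF y(2) chain_length_nonneg c(2) that] .
    have WU: "p ` W \<subseteq> U" using V(5) by (auto simp: W_def)
    have gV: "g t \<in> V" if "t \<in> {0..1}" for t
      by (rule path_stays_in_sheet[OF U(1) V(1) g(1) _ _ that]) (use ball r(2) WU g(2) V(2) in blast)+
    have gN: "g t \<in> N" if t: "t \<in> {0..1}" for t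
    proof -
      obtain w where w: "w \<in> W" "p (g t) = p w" using ball[OF t] r(2) by blast
      then have "g t = w" using V(6) gV[OF t] by (auto simp: W_def dest: inj_onD)
      then show ?thesis using w(1) ball[OF t] gV[OF t] V(4) by (auto simp: N_def)
    qed
    have "y \<in> V" using gV[of 1] g(3) by simp
    then have "y = z" using V(6) zX(1) y(1) by (auto dest: inj_onD)
    then show ?thesis using y(2) gN chain_length_nonneg by blast
  qed
  have "path_connectedin X N"
    unfolding path_connectedin_def path_connected_space_def
  proof (intro conjI ballI)
    show "N \<subseteq> topspace X" using openin_subset[OF oN] .
    fix y z assume "y \<in> topspace (subtopology X N)" "z \<in> topspace (subtopology X N)"
    then have yz: "y \<in> N" "z \<in> N" by auto
    obtain r g where g: "short_path x y r g" "g ` {0..1} \<subseteq> N" using paths[OF yz(1)] by blast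
    obtain s h where h: "short_path x z s h" "h ` {0..1} \<subseteq> N" using paths[OF yz(2)] by blast
    have g': "pathin (subtopology X N) g" "g 0 = x" "g 1 = y"
      and h': "pathin (subtopology X N) h" "h 0 = x" "h 1 = z"
      using g h unfolding short_path_def pathin_subtopology by blast+
    show "\<exists>g. pathin (subtopology X N) g \<and> g 0 = y \<and> g 1 = z"
      using pathin_join[OF pathin_reverse[OF g'(1)] h'(1)] g' h'
      by (intro exI[of _ "join_paths (\<lambda>t. g (1 - t)) h"]) simp
  qed
  moreover have "x \<in> N" using \<open>x \<in> W\<close> xX r(1) by (simp add: N_def)
  moreover have "N \<subseteq> O'" by (auto simp: N_def W_def)
  ultimately show ?thesis using that[of N] oN paths by blast
qed

lemma locally_path_connected_X: "locally_path_connected_space X"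
  unfolding locally_path_connected_space using short_path_neighbourhood by metis

lemma short_path_exists:
  assumes "x \<in> topspace X" "y \<in> topspace X"
  shows "\<exists>r g. 0 \<le> r \<and> short_path x y r g"
proof (rule connected_space_local_relation[OF connected_X _ _ _ assms])
  show "\<exists>N. openin X N \<and> x \<in> N \<and> (\<forall>z\<in>N. \<exists>r g. 0 \<le> r \<and> short_path x z r g)" if x: "x \<in> topspace X" for x
    using short_path_neighbourhood[OF openin_topspace x] by metis
  show "\<exists>r g. 0 \<le> r \<and> short_path y x r g" if "\<exists>r g. 0 \<le> r \<and> short_path x y r g" for x y
    using that short_path_reverse by metis
  show "\<exists>r g. 0 \<le> r \<and> short_path x z r g"
    if "\<exists>r g. 0 \<le> r \<and> short_path x y r g" "\<exists>r g. 0 \<le> r \<and> short_path y z r g" for x y z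
    using that short_path_join add_nonneg_nonneg by metis
qed

lemma flat_linked_X: "x \<in> topspace X \<Longrightarrow> y \<in> topspace X \<Longrightarrow> flat_linked x y"
  using short_path_exists unfolding short_path_def by blast

sublocale length_cover Y_space Y_dist X p
proof
  show "covering_map X Y.mtopology p" using covering by (simp add: Y_topology_eq)
  fix x y assume "x \<in> topspace X" "y \<in> topspace X"
  then obtain r g where g: "short_path x y r g" using short_path_exists by blast
  then have "curve_length Y_dist (p \<circ> g) \<le> ennreal r" by (simp add: short_path_def)
  then have "curve_length Y_dist (p \<circ> g) < \<infinity>" by (rule le_less_trans) simp
  then show "\<exists>g. pathin X g \<and> g 0 = x \<and> g 1 = y \<and> curve_length Y_dist (p \<circ> g) < \<infinity>"
    using g unfolding short_path_def by blast
qed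


text \<open>The number \<open>r\<close> is a Lebesgue number of the covering of the compact space \<open>Y\<close> by evenly
  covered sets.\<close>

lemma fibres_uniformly_separated:
  obtains r where "r > 0" "\<And>x y. x \<in> topspace X \<Longrightarrow> y \<in> topspace X \<Longrightarrow> p x = p y \<Longrightarrow> D x y < r \<Longrightarrow> x = y"
proof -
  let ?C = "{U. \<exists>\<V>. evenly_covered X Y_topology p U \<V>}"
  have "\<exists>r>0. \<forall>A\<in>Y_space. \<exists>U\<in>?C. Y.mball A r \<subseteq> U"
  proof (rule Y.lebesgue_number)
    show "compactin Y.mtopology Y_space"
      using compact_Y by (simp add: compact_space_def Y_topology_eq)
    show "Y_space \<subseteq> \<Union>?C"
    proof
      fix A assume "A \<in> Y_space"
      then have "A \<in> topspace Y_topology" by simp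
      then obtain U \<V> where "evenly_covered X Y_topology p U \<V>" "A \<in> U"
        by (rule covering_map_evenly_covered[OF covering])
      then show "A \<in> \<Union>?C" by blast
    qed
    show "openin Y.mtopology U" if "U \<in> ?C" for U
      using that by (auto simp: evenly_covered_def Y_topology_eq)
  qed
  then obtain r where r: "r > 0" "\<forall>A\<in>Y_space. \<exists>U\<in>?C. Y.mball A r \<subseteq> U" by blast
  show ?thesis
  proof (rule that[OF r(1)])
    fix x y assume x: "x \<in> topspace X" and y: "y \<in> topspace X" and xy: "p x = p y" "D x y < r"
    obtain U \<V> where "evenly_covered X Y_topology p U \<V>" "Y.mball (p x) r \<subseteq> U"
      using r(2) p_in_Y[OF x] by blast
    then show "x = y" using fibre_separated[of U \<V> x r y] x y xy by (simp add: Y_topology_eq)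
  qed
qed

end

section \<open>Circles, vertices and lifts of reflections\<close>

definition circle_map :: "circle \<Rightarrow> real \<Rightarrow> square_point set" where
  "circle_map l u = (if l = CA then flat_map T1 (u, 0) else if l = CB then flat_map T2 (u, 0)
     else if l = CC then flat_map T3 (u, 0) else flat_map T3 (0, u))"

lemma circle_map_flat_ex: "\<exists>i z. circle_map l u = flat_map i z \<and> (\<forall>m. coord i z m = (if m = l then u else 0))"
proof (cases l)
  case CA then show ?thesis by (intro exI[of _ T1] exI[of _ "(u, 0)"]) (auto simp: circle_map_def coord_def)
next
  case CB then show ?thesis by (intro exI[of _ T2] exI[of _ "(u, 0)"]) (auto simp: circle_map_def coord_def)
next
  case CC then show ?thesis by (intro exI[of _ T3] exI[of _ "(u, 0)"]) (auto simp: circle_map_def coord_def)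
next
  case CD then show ?thesis by (intro exI[of _ T3] exI[of _ "(0, u)"]) (auto simp: circle_map_def coord_def)
qed

lemma circle_mapE:
  obtains i z where "circle_map l u = flat_map i z" "\<And>m. coord i z m = (if m = l then u else 0)"
  using circle_map_flat_ex by metis

lemma flat_map_eq_circle_map_iff:
  "flat_map i z = circle_map l u \<longleftrightarrow> (\<forall>m. coord i z m - (if m = l then u else 0) \<in> \<int>)"
  by (rule circle_mapE[of l u]) (simp add: flat_map_eq_iff)

lemma circle_map_in_Y [simp]: "circle_map l u \<in> Y_space"
  by (simp add: circle_map_def)

lemma flat_map_first: "n \<in> \<int> \<Longrightarrow> flat_map i (u, n) = circle_map (first_circle i) u"
  and flat_map_second: "n \<in> \<int> \<Longrightarrow> flat_map i (n, u) = circle_map (second_circle i) u"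
  unfolding flat_map_eq_circle_map_iff by (auto simp: coord_def)

lemma circle_map_translate:
  assumes "n \<in> \<int>"
  shows "circle_map l (u + n) = circle_map l u"
proof -
  obtain i z where *: "circle_map l (u + n) = flat_map i z" "\<And>m. coord i z m = (if m = l then u + n else 0)"
    using circle_mapE by metis
  show ?thesis unfolding *(1) flat_map_eq_circle_map_iff using assms by (simp add: *(2))
qed

lemma circle_map_0: "circle_map l 0 = circle_map m 0"
proof -
  obtain i z where *: "circle_map l 0 = flat_map i z" "\<And>k. coord i z k = (if k = l then 0 else 0)"
    using circle_mapE by metis
  show ?thesis unfolding *(1) flat_map_eq_circle_map_iff by (simp add: *(2))
qed

lemma circle_coord_circle_map: "circle_coord m (circle_map l u) = cis (2 * pi * (if m = l then u else 0))"
  by (rule circle_mapE[of l u]) (simp add: circle_coord_flat_map)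

lemma reflect_circle_map: "reflect \<sigma> (circle_map l u) = circle_map l (signed (\<sigma> l) u)"
proof -
  obtain i z where *: "circle_map l u = flat_map i z" "\<And>k. coord i z k = (if k = l then u else 0)"
    using circle_mapE by metis
  show ?thesis
    unfolding *(1) reflect_flat_map flat_map_eq_circle_map_iff coord_flip by (simp add: *(2) signed_def)
qed

lemma continuous_circle_map: "continuous_map euclidean Y_topology (circle_map l)"
proof -
  have "continuous_map euclidean Y_topology (\<lambda>u. flat_map i (u, 0))" 
    "continuous_map euclidean Y_topology (\<lambda>u. flat_map i (0, u))" for i
    using continuous_map_compose[OF _ continuous_flat_map[of i], of euclidean "\<lambda>u. (u, 0)"]
      continuous_map_compose[OF _ continuous_flat_map[of i], of euclidean "\<lambda>u. (0, u)"]
    by (auto simp: o_def continuous_on_Pair_const)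
  then show ?thesis by (cases l) (simp_all add: circle_map_def[abs_def])
qed

definition origin :: "square_point set" where
  "origin = circle_map CA 0"

lemma circle_map_Ints: "n \<in> \<int> \<Longrightarrow> circle_map l n = origin"
  using circle_map_translate[of n l 0] circle_map_0[of l CA] by (simp add: origin_def)

lemma flat_map_eq_origin_iff: "flat_map i (u, v) = origin \<longleftrightarrow> u \<in> \<int> \<and> v \<in> \<int>"
proof
  assume "flat_map i (u, v) = origin"
  then have "\<forall>m. coord i (u, v) m \<in> \<int>" unfolding origin_def flat_map_eq_circle_map_iff by simp
  from this[rule_format, of "first_circle i"] this[rule_format, of "second_circle i"]
  show "u \<in> \<int> \<and> v \<in> \<int>" by simp
qed (simp add: flat_map_first circle_map_Ints)

lemma origin_in_Y [simp]: "origin \<in> Y_space"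
  by (simp add: origin_def)

lemma reflect_origin [simp]: "reflect \<sigma> origin = origin"
  unfolding origin_def reflect_circle_map by (simp add: signed_def)

lemma signed_signed [simp]: "signed b (signed b u) = u"
  and signed_0 [simp]: "signed b 0 = 0"
  by (simp_all add: signed_def)

lemma continuous_on_signed: "continuous_on S f \<Longrightarrow> continuous_on S (\<lambda>x. signed b (f x))"
  by (cases b) (auto simp: signed_def intro: continuous_on_minus)

lemma continuous_on_translate:
  fixes n :: "'a::real_normed_vector"
  shows "continuous_on S (\<lambda>u. u + n)" "continuous_on S ((+) n)"
  by (rule continuous_on_add continuous_on_const continuous_on_id)+

lemma flip_flip [simp]: "flip_coords \<sigma> i (flip_coords \<sigma> i z) = z"
  by (simp add: flip_coords_def)

context croke_kleiner
begin

text \<open>The vertices of \<open>X\<close> are the points over the vertex of \<open>Y\<close>, and \<open>line x l\<close> is the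
  line through the vertex \<open>x\<close> that covers the loop \<open>l\<close>, with vertices at the integers.\<close>

definition line :: "'x \<Rightarrow> circle \<Rightarrow> real \<Rightarrow> 'x" where
  "line x l = (SOME L. lifts (circle_map l) L \<and> L 0 = x)"

definition vertices :: "'x set" where
  "vertices = {x \<in> topspace X. p x = origin}"

lemma line:
  assumes "x \<in> vertices"
  shows "lifts (circle_map l) (line x l)" "line x l 0 = x"
proof -
  have "x \<in> topspace X" "p x = circle_map l 0"
    using assms circle_map_Ints[of 0 l] by (auto simp: vertices_def)
  then obtain L where "lifts (circle_map l) L" "L 0 = x" by (rule lifts_exist[OF continuous_circle_map])
  then have "lifts (circle_map l) (line x l) \<and> line x l 0 = x"
    unfolding line_def by (intro someI_ex[of "\<lambda>L. lifts (circle_map l) L \<and> L 0 = x"]) blast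
  then show "lifts (circle_map l) (line x l)" "line x l 0 = x" by auto
qed

lemma line_eq:
  assumes "lifts (circle_map l) L" "n \<in> \<int>"
  shows "line (L n) l u = L (n + u)"
proof -
  have v: "L n \<in> vertices"
    using assms lifts_p[OF assms(1), of n] circle_map_Ints by (simp add: vertices_def)
  have "lifts (circle_map l) (\<lambda>u. L (n + u))"
    unfolding lifts_def
  proof (intro conjI allI)
    show "continuous_map euclidean X (\<lambda>u. L (n + u))"
      using assms(1) continuous_map_compose[of euclidean euclidean "\<lambda>u. n + u" X L]
      by (simp add: lifts_def o_def continuous_on_translate)
    show "p (L (n + u)) = circle_map l u" for u
      using lifts_p[OF assms(1)] circle_map_translate[OF assms(2), of l u] by (simp add: add.commute)
  qed
  from lifts_unique[OF line(1)[OF v] this, of 0] show ?thesis using line(2)[OF v] by simp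
qed

lemma line_Ints_vertex:
  assumes "lifts (circle_map l) L" "n \<in> \<int>"
  shows "L n \<in> vertices"
  using assms lifts_p[OF assms(1), of n] circle_map_Ints by (simp add: vertices_def)

lemma flat_line_first:
  assumes F: "lifts (flat_map i) F" and n: "n \<in> \<int>"
  shows "lifts (circle_map (first_circle i)) (\<lambda>u. F (u, n))"
  using F lifts_p[OF F] n continuous_map_compose[of euclidean euclidean "\<lambda>u. (u, n)" X F]
  by (simp add: lifts_def o_def flat_map_first continuous_on_Pair_const)

lemma flat_line_second:
  assumes F: "lifts (flat_map i) F" and n: "n \<in> \<int>"
  shows "lifts (circle_map (second_circle i)) (\<lambda>u. F (n, u))"
  using F lifts_p[OF F] n continuous_map_compose[of euclidean euclidean "\<lambda>u. (n, u)" X F]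
  by (simp add: lifts_def o_def flat_map_second continuous_on_Pair_const)

lemma flat_translate:
  assumes F: "lifts (flat_map i) F" and n: "fst n \<in> \<int>" "snd n \<in> \<int>"
  shows "lifts (flat_map i) (\<lambda>z. F (z + n))"
  unfolding lifts_def
proof (intro conjI allI)
  show "continuous_map euclidean X (\<lambda>z. F (z + n))"
    using F continuous_map_compose[of euclidean euclidean "\<lambda>z. z + n" X F]
    by (simp add: lifts_def o_def continuous_on_translate)
  show "p (F (z + n)) = flat_map i z" for z
    using lifts_p[OF F] flat_map_translate[OF n, of i "fst z" "snd z"] by (simp add: plus_prod_def)
qed

definition covers :: "(circle \<Rightarrow> bool) \<Rightarrow> ('x \<Rightarrow> 'x) \<Rightarrow> bool" where
  "covers \<sigma> f \<longleftrightarrow> continuous_map X X f \<and> (\<forall>x \<in> topspace X. p (f x) = reflect \<sigma> (p x))"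

lemma covers_in_X: "covers \<sigma> f \<Longrightarrow> x \<in> topspace X \<Longrightarrow> f x \<in> topspace X"
  by (auto simp: covers_def continuous_map_def)

lemma covers_p: "covers \<sigma> f \<Longrightarrow> x \<in> topspace X \<Longrightarrow> p (f x) = reflect \<sigma> (p x)"
  by (simp add: covers_def)

lemma covers_exist:
  assumes "x \<in> topspace X" "y \<in> topspace X" "p y = reflect \<sigma> (p x)"
  obtains f where "covers \<sigma> f" "f x = y"
proof -
  have c: "continuous_map X Y_topology (reflect \<sigma> \<circ> p)"
    by (rule continuous_map_compose[OF continuous_p continuous_reflect])
  have e: "p y = (reflect \<sigma> \<circ> p) x" using assms(3) by simp
  show ?thesis
  proof (rule lifting_criterion[OF covering simply_connected locally_path_connected_X c assms(1,2) e])
    fix f assume "continuous_map X X f" "\<And>z. z \<in> topspace X \<Longrightarrow> p (f z) = (reflect \<sigma> \<circ> p) z" "f x = y"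
    then show ?thesis by (intro that[of f]) (simp_all add: covers_def)
  qed
qed

lemma covers_unique:
  assumes f: "covers \<sigma> f" and g: "covers \<sigma> g" and x: "x \<in> topspace X" "f x = g x" and y: "y \<in> topspace X"
  shows "f y = g y"
  by (rule lift_unique[OF covering connected_X, of f g x y]) (use f g x y in \<open>simp_all add: covers_def\<close>)

lemma covers_compose:
  assumes f: "covers \<sigma> f" and g: "covers \<tau> g"
  shows "covers (\<lambda>l. \<sigma> l \<noteq> \<tau> l) (f \<circ> g)"
  unfolding covers_def
proof (intro conjI ballI)
  show "continuous_map X X (f \<circ> g)"
    using f g by (auto simp: covers_def intro: continuous_map_compose)
  show "p ((f \<circ> g) x) = reflect (\<lambda>l. \<sigma> l \<noteq> \<tau> l) (p x)" if "x \<in> topspace X" for x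
    using that covers_p[OF f covers_in_X[OF g that]] covers_p[OF g that] reflect_reflect by simp
qed

lemma covers_id: "covers (\<lambda>l. False) (\<lambda>x. x)"
  by (simp add: covers_def reflect_none)

lemma covers_restrict: "covers \<sigma> f \<Longrightarrow> covers \<sigma> (restrict f (topspace X))"
  unfolding covers_def by (auto intro: continuous_map_eq)

lemma covers_vertices: "covers \<sigma> f \<Longrightarrow> x \<in> vertices \<Longrightarrow> f x \<in> vertices"
  using covers_p covers_in_X by (simp add: vertices_def)

lemma covers_line:
  assumes f: "covers \<sigma> f" and x: "x \<in> vertices"
  shows "f (line x l u) = line (f x) l (signed (\<sigma> l) u)"
proof -
  let ?L = "\<lambda>u. f (line x l (signed (\<sigma> l) u))"
  have "continuous_map euclidean X (line x l)" using line(1)[OF x] by (simp add: lifts_def)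
  then have "continuous_map euclidean X (f \<circ> (line x l \<circ> signed (\<sigma> l)))"
    using f by (intro continuous_map_compose[of _ X] continuous_map_compose[of _ euclidean])
      (simp_all add: covers_def continuous_on_signed)
  then have "lifts (circle_map l) ?L"
    using covers_p[OF f] lifts_p[OF line(1)[OF x]] lifts_in_X[OF line(1)[OF x]]
    by (simp add: lifts_def o_def reflect_circle_map)
  from lifts_unique[OF line(1)[OF covers_vertices[OF f x]] this, of 0]
  have "line (f x) l = ?L" using line(2)[OF x] line(2)[OF covers_vertices[OF f x]] by simp
  then have "line (f x) l (signed (\<sigma> l) u) = ?L (signed (\<sigma> l) u)" by simp
  then show ?thesis by simp
qed

lemma covers_flat:
  assumes f: "covers \<sigma> f" and F: "lifts (flat_map i) F"
  shows "lifts (flat_map i) (\<lambda>z. f (F (flip_coords \<sigma> i z)))"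
proof -
  have "continuous_map euclidean X F" using F by (simp add: lifts_def)
  moreover have "continuous_on UNIV (flip_coords \<sigma> i)"
    unfolding flip_coords_def[abs_def]
    by (intro continuous_on_Pair continuous_on_signed continuous_on_fst continuous_on_snd continuous_on_id)
  ultimately have "continuous_map euclidean X (f \<circ> (F \<circ> flip_coords \<sigma> i))"
    using f by (intro continuous_map_compose[of _ X] continuous_map_compose[of _ euclidean])
      (auto simp: covers_def)
  then show ?thesis
    using covers_p[OF f] lifts_p[OF F] lifts_in_X[OF F] by (simp add: lifts_def o_def)
qed

lemma covers_path_length:
  assumes f: "covers \<sigma> f" and g: "pathin X g"
  shows "curve_length Y_dist (p \<circ> (\<lambda>t. f (g t))) = curve_length Y_dist (p \<circ> g)"
proof -
  have "Y_dist (p (f (g s))) (p (f (g t))) = Y_dist (p (g s)) (p (g t))" if "s \<in> {0..1}" "t \<in> {0..1}" for s t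
    using covers_p[OF f path_in_X[OF g that(1)]] covers_p[OF f path_in_X[OF g that(2)]]
      reflect_isometry p_in_Y path_in_X[OF g] that by simp
  then have *: "variation Y_dist (p \<circ> (\<lambda>t. f (g t))) ts = variation Y_dist (p \<circ> g) ts" if "set ts \<subseteq> {0..1}" for ts
    using that by (induction ts rule: induct_list012) auto
  show ?thesis unfolding curve_length_variation by (rule SUP_cong) (use * in auto)
qed

lemma covers_isometry:
  assumes f: "covers \<sigma> f" and g: "covers \<tau> g" and gf: "\<And>x. x \<in> topspace X \<Longrightarrow> g (f x) = x"
    and x: "x \<in> topspace X" and y: "y \<in> topspace X"
  shows "D (f x) (f y) = D x y"
proof -
  have le: "D (f x) (f y) \<le> D x y" if f: "covers \<sigma> f" and x: "x \<in> topspace X" and y: "y \<in> topspace X" for f \<sigma> x y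
  proof (rule dense_ge)
    fix r assume r: "D x y < r"
    obtain h where h: "pathin X h" "h 0 = x" "h 1 = y" "curve_length Y_dist (p \<circ> h) < ennreal r"
      using D_less[OF x y r] by blast
    have "continuous_map X X f" using f by (simp add: covers_def)
    then show "D (f x) (f y) \<le> r"
      using h covers_path_length[OF f h(1)] pathin_compose[OF h(1)] r D_nonneg[of x y]
      by (intro D_le[of "\<lambda>t. f (h t)"]) auto
  qed
  have "D x y \<le> D (f x) (f y)"
    using le[OF g covers_in_X[OF f x] covers_in_X[OF f y]] gf x y by simp
  then show ?thesis using le[OF f x y] by simp
qed

end

section \<open>The right-angled Coxeter group\<close>

text \<open>These functions identify \<open>\<Gamma>\<close> with the link of the vertex of \<open>Y\<close>. Which of two opposite
  vertices of \<open>\<Gamma>\<close> is the forward direction of the loop is an arbitrary choice.\<close>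

fun circle_of :: "vertex \<Rightarrow> circle" where
  "circle_of v2 = CA" | "circle_of v4 = CA" | "circle_of v1 = CB" | "circle_of v3 = CB"
| "circle_of w2 = CC" | "circle_of w4 = CC" | "circle_of w1 = CD" | "circle_of w3 = CD"

fun forward :: "vertex \<Rightarrow> bool" where
  "forward v2 = True" | "forward v4 = False" | "forward v1 = True" | "forward v3 = False"
| "forward w2 = True" | "forward w4 = False" | "forward w1 = True" | "forward w3 = False"

fun vertex_of :: "circle \<Rightarrow> bool \<Rightarrow> vertex" where
  "vertex_of CA b = (if b then v2 else v4)" | "vertex_of CB b = (if b then v1 else v3)"
| "vertex_of CC b = (if b then w2 else w4)" | "vertex_of CD b = (if b then w1 else w3)"

lemma vertex_of_circle_of [simp]: "vertex_of (circle_of v) (forward v) = v"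
  by (cases v) auto

lemma circle_of_vertex_of [simp]: "circle_of (vertex_of l b) = l" "forward (vertex_of l b) = b"
  by (cases l; cases b; simp)+

definition in_torus :: "torus \<Rightarrow> circle \<Rightarrow> circle \<Rightarrow> bool" where
  "in_torus i l m \<longleftrightarrow> l = first_circle i \<and> m = second_circle i \<or> l = second_circle i \<and> m = first_circle i"

lemma Gamma_edge_torus:
  assumes "{v, w} \<in> Gamma_edges"
  obtains i where "in_torus i (circle_of v) (circle_of w)"
proof -
  have "in_torus T1 (circle_of v) (circle_of w) \<or> in_torus T2 (circle_of v) (circle_of w) \<or>
      in_torus T3 (circle_of v) (circle_of w)"
    using assms by (cases v; cases w; simp add: Gamma_edges_def doubleton_eq_iff in_torus_def)
  then show ?thesis using that by blast
qed

lemma torus_Gamma_edge: "in_torus i l m \<Longrightarrow> {vertex_of l b, vertex_of m c} \<in> Gamma_edges"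
  unfolding in_torus_def
  by (elim disjE conjE; cases i; cases b; cases c; simp add: Gamma_edges_def doubleton_eq_iff)

abbreviation coxeter_relators :: "vertex word set" where
  "coxeter_relators \<equiv> {[(v, True), (v, True)] | v. v \<in> UNIV} \<union>
     {[(v, True), (w, True), (v, False), (w, False)] | v w. v \<in> UNIV \<and> w \<in> UNIV \<and> {v, w} \<in> Gamma_edges}"

abbreviation "W \<equiv> right_angled_coxeter_group UNIV Gamma_edges"

lemma W_eq: "W = presented_group UNIV coxeter_relators"
  by (simp add: right_angled_coxeter_group_def)

definition W_class :: "vertex word \<Rightarrow> vertex word set" where
  "W_class u = word_class UNIV coxeter_relators u"

lemma words_UNIV [simp]: "u \<in> words UNIV"
  by (simp add: words_def)

lemma group_W: "group W"
  unfolding W_eq by (rule group_presented_group)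

lemma W_class_carrier [simp]: "W_class u \<in> carrier W"
  unfolding W_eq W_class_def by simp

lemma W_class_mult: "W_class u \<otimes>\<^bsub>W\<^esub> W_class v = W_class (u @ v)"
  unfolding W_eq W_class_def by (rule word_class_mult) simp_all

lemma W_class_one: "\<one>\<^bsub>W\<^esub> = W_class []"
  unfolding W_eq W_class_def by (rule word_class_one)

lemma W_carrierE: "g \<in> carrier W \<Longrightarrow> (\<And>u. g = W_class u \<Longrightarrow> thesis) \<Longrightarrow> thesis"
  unfolding W_eq W_class_def by (elim presented_group_carrierE) blast

lemma W_class_relator:
  assumes "r \<in> coxeter_relators"
  shows "W_class (u @ r @ v) = W_class (u @ v)"
  unfolding W_class_def
  by (intro word_class_reduce elementary_reduction.relator) (use assms in auto)

lemma W_class_letter: "W_class [(s, b)] = W_class [(s, True)]"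
proof (cases b)
  case False
  have "W_class ([(s, False)] @ [(s, True), (s, True)] @ []) = W_class ([(s, False)] @ [])"
    by (rule W_class_relator) blast
  moreover have "elementary_reduction UNIV coxeter_relators ([] @ [(s, False), (s, \<not> False)] @ [(s, True)]) ([] @ [(s, True)])"
    by (intro elementary_reduction.cancel) simp_all
  then have "W_class ([] @ [(s, False), (s, \<not> False)] @ [(s, True)]) = W_class ([] @ [(s, True)])"
    unfolding W_class_def by (rule word_class_reduce) simp_all
  ultimately show ?thesis using False by simp
qed simp

definition W_gen :: "circle \<Rightarrow> bool \<Rightarrow> vertex word set" where
  "W_gen l b = W_class [(vertex_of l b, True)]"

lemma W_gen_carrier [simp]: "W_gen l b \<in> carrier W"
  by (simp add: W_gen_def)

lemma W_gen_square: "W_gen l b \<otimes>\<^bsub>W\<^esub> W_gen l b = \<one>\<^bsub>W\<^esub>"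
proof -
  have "W_class ([] @ [(vertex_of l b, True), (vertex_of l b, True)] @ []) = W_class ([] @ [])"
    by (rule W_class_relator) blast
  then show ?thesis by (simp add: W_gen_def W_class_mult W_class_one)
qed

lemma (in group) involutions_commute:
  assumes "v \<in> carrier G" "w \<in> carrier G" "v \<otimes> v = \<one>" "w \<otimes> w = \<one>" "(v \<otimes> w) \<otimes> (v \<otimes> w) = \<one>"
  shows "v \<otimes> w = w \<otimes> v"
proof -
  have "inv v = v" "inv w = w" "inv (v \<otimes> w) = v \<otimes> w"
    using assms inv_equality by auto
  then show ?thesis using inv_mult_group[OF assms(1,2)] by simp
qed

text \<open>A commutator relation between elements of order two says that their product has
  order two.\<close>

lemma W_gen_commute:
  assumes "in_torus i l m"
  shows "W_gen l b \<otimes>\<^bsub>W\<^esub> W_gen m c = W_gen m c \<otimes>\<^bsub>W\<^esub> W_gen l b"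
proof (rule group.involutions_commute[OF group_W])
  let ?v = "vertex_of l b" and ?w = "vertex_of m c"
  have "W_class ([] @ [(?v, True), (?w, True), (?v, False), (?w, False)] @ []) = W_class ([] @ [])"
    using torus_Gamma_edge[OF assms] by (intro W_class_relator) blast
  then have "W_class [(?v, True), (?w, True), (?v, False), (?w, False)] = \<one>\<^bsub>W\<^esub>"
    by (simp add: W_class_one)
  moreover have "W_class [(?v, True), (?w, True), (?v, False), (?w, False)] =
      (W_gen l b \<otimes>\<^bsub>W\<^esub> W_gen m c) \<otimes>\<^bsub>W\<^esub> (W_class [(?v, False)] \<otimes>\<^bsub>W\<^esub> W_class [(?w, False)])"
    by (simp add: W_gen_def W_class_mult)
  ultimately show "(W_gen l b \<otimes>\<^bsub>W\<^esub> W_gen m c) \<otimes>\<^bsub>W\<^esub> (W_gen l b \<otimes>\<^bsub>W\<^esub> W_gen m c) = \<one>\<^bsub>W\<^esub>"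
    by (simp add: W_class_letter[of _ False] W_gen_def)
qed (simp_all add: W_gen_square)

section \<open>The holonomy cocycle\<close>

text \<open>The covering that is built here is to have the element \<open>(g, \<sigma>)\<close> of the fibre over the vertex
  \<open>g x\<^sub>0\<close>, where \<open>\<sigma>\<close> is the set of loops that \<open>g\<close> reverses. The edge that leaves \<open>g x\<^sub>0\<close> along \<open>l\<close> in the
  direction \<open>up\<close> is the image under \<open>g\<close> of the edge that leaves \<open>x\<^sub>0\<close> in the direction
  \<open>up \<noteq> \<sigma> l\<close>. If \<open>s\<close> is the generator belonging to the latter, then the other end of the former is
  \<open>g s x\<^sub>0\<close>. This is the value of \<open>cross\<close>, which is applied when the midpoint of an edge is passed.\<close>

text \<open>The change of fibre is put at the midpoints of the edges because the points whose
  coordinate \<open>l\<close> is \<open>1/2\<close> stay away from the vertex. Two changes can only meet inside a square, where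
  the generators commute.\<close>

abbreviation fibre :: "(vertex word set \<times> (circle \<Rightarrow> bool)) set" where
  "fibre \<equiv> carrier W \<times> UNIV"

definition cross :: "circle \<Rightarrow> bool \<Rightarrow> vertex word set \<times> (circle \<Rightarrow> bool) \<Rightarrow> vertex word set \<times> (circle \<Rightarrow> bool)" where
  "cross l up = (\<lambda>(w, \<sigma>). (w \<otimes>\<^bsub>W\<^esub> W_gen l (up \<noteq> \<sigma> l), \<sigma>(l := \<not> \<sigma> l)))"

lemma cross_fibre: "f \<in> fibre \<Longrightarrow> cross l up f \<in> fibre"
  by (auto simp: cross_def intro: monoid.m_closed[OF group.is_monoid[OF group_W]])

lemma cross_back: "f \<in> fibre \<Longrightarrow> cross l (\<not> up) (cross l up f) = f"
  by (auto simp: cross_def W_gen_square monoid.m_assoc[OF group.is_monoid[OF group_W]]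
      monoid.r_one[OF group.is_monoid[OF group_W]])

lemma cross_commute:
  assumes "in_torus i l m" "f \<in> fibre"
  shows "cross l a (cross m b f) = cross m b (cross l a f)"
proof -
  have "l \<noteq> m" using assms(1) by (auto simp: in_torus_def)
  then show ?thesis
    using assms(2) W_gen_commute[OF assms(1)]
    by (auto simp: cross_def fun_upd_twist monoid.m_assoc[OF group.is_monoid[OF group_W]])
qed

definition crossing :: "complex \<Rightarrow> complex \<Rightarrow> bool" where
  "crossing a b \<longleftrightarrow> Re a < 0 \<and> Re b < 0 \<and> (0 \<le> Im a) \<noteq> (0 \<le> Im b)"

definition transport1 :: "circle \<Rightarrow> square_point set \<Rightarrow> square_point set \<Rightarrow>
    vertex word set \<times> (circle \<Rightarrow> bool) \<Rightarrow> vertex word set \<times> (circle \<Rightarrow> bool)" where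
  "transport1 l y z f = (if crossing (circle_coord l y) (circle_coord l z)
     then cross l (0 \<le> Im (circle_coord l y)) f else f)"

definition transport :: "square_point set \<Rightarrow> square_point set \<Rightarrow>
    vertex word set \<times> (circle \<Rightarrow> bool) \<Rightarrow> vertex word set \<times> (circle \<Rightarrow> bool)" where
  "transport y z f = transport1 CA y z (transport1 CB y z (transport1 CC y z (transport1 CD y z f)))"

definition near :: "square_point set \<Rightarrow> square_point set set" where
  "near y = {z. y \<in> Y_space \<and> z \<in> Y_space \<and> (\<forall>l. cmod (circle_coord l z - circle_coord l y) < 1/4)}"

lemma transport1_fibre: "f \<in> fibre \<Longrightarrow> transport1 l y z f \<in> fibre"
  unfolding transport1_def using cross_fibre by presburger

text \<open>If a nearby point lies in the right half of the unit circle, then \<open>a\<close> and \<open>b\<close> are far from \<open>-1\<close>,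
  so they lie on the same side of it.\<close>

lemma no_crossing_near_right:
  assumes a: "cmod a = 1" and t: "0 \<le> Re t" "cmod (t - a) < 1/4" and b: "cmod (a - b) < 1/4"
  shows "\<not> crossing a b"
proof
  assume c: "crossing a b"
  have "\<bar>Re t - Re a\<bar> < 1/4" "\<bar>Im a - Im b\<bar> < 1/4"
    using abs_Re_le_cmod[of "t - a"] abs_Im_le_cmod[of "a - b"] t b by auto
  then have "\<bar>Re a\<bar> < 1/4" and ab: "\<bar>Im a\<bar> < 1/4" using c t(1) by (auto simp: crossing_def)
  then have "(Re a)\<^sup>2 \<le> (1/4)\<^sup>2" "(Im a)\<^sup>2 \<le> (1/4)\<^sup>2"
    by (intro abs_le_square_iff[THEN iffD1]; simp)+
  moreover have "(Re a)\<^sup>2 + (Im a)\<^sup>2 = 1" using a cmod_power2[of a] by simp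
  ultimately show False by (simp add: power2_eq_square)
qed

lemma circle_coord_norm: "y \<in> Y_space \<Longrightarrow> cmod (circle_coord l y) = 1"
  by (elim Y_spaceE) (simp add: circle_coord_flat_map)

lemma transport1_cocycle:
  assumes "u \<in> near y" "v \<in> near y" "v \<in> near u" "f \<in> fibre"
  shows "transport1 l u v (transport1 l y u f) = transport1 l y v f"
proof -
  let ?e = "circle_coord l"
  have Y: "cmod (?e y) = 1" "cmod (?e u) = 1" "cmod (?e v) = 1"
    using assms circle_coord_norm by (auto simp: near_def)
  have near: "cmod (?e u - ?e y) < 1/4" "cmod (?e v - ?e y) < 1/4" "cmod (?e v - ?e u) < 1/4"
    "cmod (?e y - ?e u) < 1/4" "cmod (?e y - ?e v) < 1/4" "cmod (?e u - ?e v) < 1/4"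
    using assms by (auto simp: near_def norm_minus_commute)
  show ?thesis
  proof (cases "Re (?e y) < 0 \<and> Re (?e u) < 0 \<and> Re (?e v) < 0")
    case True
    have "cross l False (cross l True f) = f" "cross l True (cross l False f) = f"
      using cross_back[OF assms(4), of l True] cross_back[OF assms(4), of l False] by simp_all
    then show ?thesis using True
      by (cases "0 \<le> Im (?e y)"; cases "0 \<le> Im (?e u)"; cases "0 \<le> Im (?e v)")
        (simp_all add: transport1_def crossing_def)
  next
    case False
    then consider "0 \<le> Re (?e y)" | "0 \<le> Re (?e u)" | "0 \<le> Re (?e v)" by fastforce
    then have "\<not> crossing (?e y) (?e u) \<and> \<not> crossing (?e u) (?e v) \<and> \<not> crossing (?e y) (?e v)"
    proof cases
      case 1
      then show ?thesis using no_crossing_near_right[OF Y(2) 1 near(4) near(6)] by (auto simp: crossing_def)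
    next
      case 2
      then show ?thesis using no_crossing_near_right[OF Y(1) 2 near(1) near(5)] by (auto simp: crossing_def)
    next
      case 3
      then show ?thesis using no_crossing_near_right[OF Y(1) 3 near(2) near(4)] by (auto simp: crossing_def)
    qed
    then show ?thesis by (simp add: transport1_def)
  qed
qed

text \<open>If both maps are different from the identity, then the coordinates \<open>l\<close> and \<open>m\<close> of \<open>u\<close>
  are both different from \<open>1\<close>, so the two loops lie in one torus.\<close>

lemma transport1_commute:
  assumes "u \<in> Y_space" "l \<noteq> m" "f \<in> fibre"
  shows "transport1 l u v (transport1 m y u f) = transport1 m y u (transport1 l u v f)"
proof (cases "crossing (circle_coord l u) (circle_coord l v) \<and> crossing (circle_coord m y) (circle_coord m u)")
  case True
  obtain i z where u: "u = flat_map i z" using assms(1) by (rule Y_spaceE)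
  have "k = first_circle i \<or> k = second_circle i" if "Re (circle_coord k u) < 0" for k
    using that unfolding u circle_coord_flat_map by (auto simp: coord_def split: if_splits)
  then have "in_torus i l m" using True assms(2) unfolding crossing_def in_torus_def by metis
  then show ?thesis using True cross_commute assms(3) by (simp add: transport1_def)
qed (auto simp: transport1_def)

lemma transport_cocycle:
  assumes "u \<in> near y" "v \<in> near y" "v \<in> near u" "f \<in> fibre"
  shows "transport u v (transport y u f) = transport y v f"
proof -
  have "u \<in> Y_space" using assms by (simp add: near_def)
  note comm = transport1_commute[OF this]
  show ?thesis
    unfolding transport_def
    by (simp add: comm transport1_cocycle[OF assms(1,2,3)] transport1_fibre assms(4) del: mem_Times_iff mem_Sigma_iff)
qed

lemma continuous_circle_coord: "continuous_map Y_topology euclidean (circle_coord l)"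
proof -
  have "Lipschitz_continuous_map (metric (Y_space, Y_dist)) euclidean_metric (circle_coord l)"
    unfolding Lipschitz_continuous_map_def
    using circle_coord_Lipschitz by (auto simp: dist_norm intro!: exI[of _ "2 * pi"])
  from Lipschitz_continuous_imp_continuous_map[OF this] show ?thesis by (simp add: Y_topology_eq)
qed

lemma openin_near:
  assumes "y \<in> Y_space"
  shows "openin Y_topology (near y)"
proof -
  let ?S = "\<lambda>l. {z \<in> topspace Y_topology. circle_coord l z \<in> ball (circle_coord l y) (1/4)}"
  have S: "openin Y_topology (?S l)" for l
    by (rule openin_continuous_map_preimage[OF continuous_circle_coord]) simp
  have "near y = ?S CA \<inter> ?S CB \<inter> ?S CC \<inter> ?S CD"
  proof -
    have all: "(\<forall>l. P l) \<longleftrightarrow> P CA \<and> P CB \<and> P CC \<and> P CD" for P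
      by (metis circle.exhaust)
    show ?thesis
      unfolding near_def all using assms by (auto simp: dist_norm norm_minus_commute)
  qed
  then show ?thesis using S by (simp only: openin_Int)
qed

lemma holonomy_cocycle: "cocycle_on Y_topology fibre near transport"
  unfolding cocycle_on_def
proof (intro conjI ballI allI impI)
  show "openin Y_topology (near y)" if "y \<in> topspace Y_topology" for y using openin_near that by simp
  show "y \<in> near y" if "y \<in> topspace Y_topology" for y using that by (simp add: near_def)
  show "y \<in> near u" if "u \<in> near y" for y u using that by (simp add: near_def norm_minus_commute)
  show "transport y y f = f" for y f by (simp add: transport_def transport1_def crossing_def)
  show "transport y u f \<in> fibre" if "f \<in> fibre" for y u f
    unfolding transport_def by (intro transport1_fibre that)
qed (rule transport_cocycle)

section \<open>The action of the Coxeter group\<close>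

definition unit_step :: "bool \<Rightarrow> real" where
  "unit_step b = (if b then 1 else -1)"

lemma unit_step_Ints [simp]: "unit_step b \<in> \<int>"
  by (simp add: unit_step_def)

lemma signed_unit_step: "signed c (unit_step b) = unit_step (b \<noteq> c)"
  by (auto simp: signed_def unit_step_def)

fun flips :: "vertex word \<Rightarrow> circle \<Rightarrow> bool" where
  "flips [] = (\<lambda>l. False)"
| "flips ((s, b) # u) = (\<lambda>l. (l = circle_of s) \<noteq> flips u l)"

lemma flips_snoc: "flips (u @ [(s, b)]) = (flips u)(circle_of s := \<not> flips u (circle_of s))"
  by (induction u) (auto simp: fun_eq_iff)

lemma flip_coords_unit_square:
  assumes "fst z \<in> {0..1}" "snd z \<in> {0..1}"
  shows "flip_coords \<sigma> i z \<in> {-1..1} \<times> {-1..1}"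
  using assms by (auto simp: flip_coords_def signed_def)

locale croke_kleiner_based = croke_kleiner +
  fixes x0
  assumes x0: "x0 \<in> vertices"
begin

lemma vertices_p: "x \<in> vertices \<Longrightarrow> p x = origin"
  and vertices_in_X [simp]: "x \<in> vertices \<Longrightarrow> x \<in> topspace X"
  by (simp_all add: vertices_def)

text \<open>Restricted to \<open>X\<close>, since the elements of \<^const>\<open>BijGroup\<close> are extensional.\<close>

definition generator :: "vertex \<Rightarrow> 'a \<Rightarrow> 'a" where
  "generator v = restrict (SOME f. covers (\<lambda>l. l = circle_of v) f \<and>
     f x0 = line x0 (circle_of v) (unit_step (forward v))) (topspace X)"

lemma generator:
  shows "covers (\<lambda>l. l = circle_of v) (generator v)"
    "generator v x0 = line x0 (circle_of v) (unit_step (forward v))"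
proof -
  let ?y = "line x0 (circle_of v) (unit_step (forward v))"
  let ?P = "\<lambda>f. covers (\<lambda>l. l = circle_of v) f \<and> f x0 = ?y"
  have "?y \<in> vertices" by (rule line_Ints_vertex[OF line(1)[OF x0]]) simp
  then have "p ?y = reflect (\<lambda>l. l = circle_of v) (p x0)" "?y \<in> topspace X"
    using x0 by (simp_all add: vertices_p)
  then obtain f where "covers (\<lambda>l. l = circle_of v) f" "f x0 = ?y"
    using covers_exist[OF vertices_in_X[OF x0]] by metis
  then have "?P (SOME f. ?P f)" by (intro someI[of ?P f]) simp
  then show "covers (\<lambda>l. l = circle_of v) (generator v)" "generator v x0 = ?y"
    unfolding generator_def using covers_restrict x0 by auto
qed

lemma generator_involution:
  assumes "y \<in> topspace X"
  shows "generator v (generator v y) = y"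
proof -
  let ?l = "circle_of v" and ?e = "unit_step (forward v)"
  have "covers (\<lambda>l. False) (generator v \<circ> generator v)"
    using covers_compose[OF generator(1)[of v] generator(1)[of v]] by simp
  moreover have "(generator v \<circ> generator v) x0 = x0"
  proof -
    have "generator v (generator v x0) = line (line x0 ?l ?e) ?l (- ?e)"
      using covers_line[OF generator(1)[of v] x0, of ?l ?e] by (simp add: generator(2) signed_def)
    also have "\<dots> = x0"
      using line_eq[OF line(1)[OF x0, of ?l], of ?e "- ?e"] line(2)[OF x0] by simp
    finally show ?thesis by simp
  qed
  ultimately show ?thesis
    using covers_unique[OF _ covers_id, of "generator v \<circ> generator v" x0 y] x0 assms by simp
qed

text \<open>Both sides are the corner \<open>(a, b)\<close>, up to the order of coordinates, of the flat at \<open>x\<close>.\<close>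

lemma line_square:
  assumes x: "x \<in> vertices" and i: "in_torus i l m" and n: "a \<in> \<int>" "b \<in> \<int>"
  shows "line (line x l a) m b = line (line x m b) l a"
proof -
  have "p x = flat_map i (0, 0)" using vertices_p[OF x] flat_map_eq_origin_iff[of i 0 0] by simp
  then obtain F where F: "lifts (flat_map i) F" "F (0, 0) = x"
    using lifts_exist[OF continuous_flat_map] x by (metis vertices_in_X)
  have 1: "line (F (c, d)) (first_circle i) u = F (c + u, d)" if "c \<in> \<int>" "d \<in> \<int>" for c d u
    using line_eq[OF flat_line_first[OF F(1) that(2)] that(1)] by simp
  have 2: "line (F (c, d)) (second_circle i) u = F (c, d + u)" if "c \<in> \<int>" "d \<in> \<int>" for c d u
    using line_eq[OF flat_line_second[OF F(1) that(1)] that(2)] by simp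
  show ?thesis
    using i unfolding in_torus_def F(2)[symmetric] by (auto simp: 1 2 n)
qed

lemma generators_commute:
  assumes i: "in_torus i (circle_of v) (circle_of w)" and y: "y \<in> topspace X"
  shows "generator v (generator w y) = generator w (generator v y)"
proof -
  let ?l = "circle_of v" and ?m = "circle_of w"
  have lm: "?l \<noteq> ?m" using i by (auto simp: in_torus_def)
  have *: "generator v (generator w x0) = line (line x0 (circle_of v) (unit_step (forward v))) (circle_of w) (unit_step (forward w))"
    if "circle_of v \<noteq> circle_of w" for v w
    using covers_line[OF generator(1)[of v] x0] that by (simp add: generator(2) signed_def)
  have c: "covers (\<lambda>k. (k = ?l) \<noteq> (k = ?m)) (generator v \<circ> generator w)"
    using covers_compose[OF generator(1)[of v] generator(1)[of w]] .
  have "covers (\<lambda>k. (k = ?m) \<noteq> (k = ?l)) (generator w \<circ> generator v)"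
    using covers_compose[OF generator(1)[of w] generator(1)[of v]] .
  moreover have "(\<lambda>k. (k = ?m) \<noteq> (k = ?l)) = (\<lambda>k. (k = ?l) \<noteq> (k = ?m))" by auto
  ultimately have c': "covers (\<lambda>k. (k = ?l) \<noteq> (k = ?m)) (generator w \<circ> generator v)" by simp
  have "(generator v \<circ> generator w) x0 = (generator w \<circ> generator v) x0"
    using *[of v w] *[of w v] lm line_square[OF x0 i, of "unit_step (forward v)" "unit_step (forward w)"] by simp
  from covers_unique[OF c c' _ this y] show ?thesis using x0 by simp
qed

abbreviation "B \<equiv> BijGroup (topspace X)"

lemma generator_carrier: "generator v \<in> carrier B"
proof -
  have "bij_betw (generator v) (topspace X) (topspace X)"
    by (rule bij_betw_byWitness[where f' = "generator v"])
      (use generator_involution covers_in_X[OF generator(1)] in auto)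
  then show ?thesis by (simp add: BijGroup_def Bij_def generator_def)
qed

lemma B_mult: "f \<in> carrier B \<Longrightarrow> g \<in> carrier B \<Longrightarrow> f \<otimes>\<^bsub>B\<^esub> g = compose (topspace X) f g"
  by (simp add: BijGroup_def)

lemma B_one: "\<one>\<^bsub>B\<^esub> = (\<lambda>x\<in>topspace X. x)"
  by (simp add: BijGroup_def)

lemma generator_square: "generator v \<otimes>\<^bsub>B\<^esub> generator v = \<one>\<^bsub>B\<^esub>"
  unfolding B_mult[OF generator_carrier generator_carrier] B_one
  by (auto simp: compose_def generator_involution)

lemma letter_value_generator: "letter_value B generator (s, b) = generator s"
  using group.inv_equality[OF group_BijGroup generator_square generator_carrier generator_carrier]
  by (simp add: letter_value_def)

definition act :: "vertex word \<Rightarrow> 'a \<Rightarrow> 'a" where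
  "act u = word_value B generator u"

lemma act_carrier: "act u \<in> carrier B"
  unfolding act_def by (rule word_value_closed[OF group_BijGroup, where S = UNIV]) (simp_all add: generator_carrier)

lemma act_Nil: "x \<in> topspace X \<Longrightarrow> act [] x = x"
  by (simp add: act_def B_one)

lemma act_append:
  assumes "x \<in> topspace X"
  shows "act (u @ v) x = act u (act v x)"
proof -
  have "act (u @ v) = act u \<otimes>\<^bsub>B\<^esub> act v"
    unfolding act_def
    by (rule word_value_append[OF group_BijGroup, where S = UNIV]) (simp_all add: generator_carrier)
  then show ?thesis using assms by (simp add: B_mult[OF act_carrier act_carrier] compose_def)
qed

lemma act_letter: "x \<in> topspace X \<Longrightarrow> act [(s, b)] x = generator s x"
  using monoid.r_one[OF group.is_monoid[OF group_BijGroup] generator_carrier]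
  by (simp add: act_def word_value_Cons letter_value_generator)

lemma covers_act: "covers (flips u) (act u)"
proof (induction u)
  case Nil
  then show ?case
    unfolding act_def word_value_Nil B_one flips.simps by (rule covers_restrict[OF covers_id])
next
  case (Cons a u)
  obtain s b where a: "a = (s, b)" by (cases a)
  have "covers (flips (a # u)) (generator s \<circ> act u)"
    using covers_compose[OF generator(1)[of s] Cons.IH] a by simp
  moreover have "(generator s \<circ> act u) x = act (a # u) x" if "x \<in> topspace X" for x
    using act_append[OF that, of "[a]" u] act_letter[OF covers_in_X[OF Cons.IH that]] a by simp
  ultimately show ?case
    unfolding covers_def by (metis continuous_map_eq)
qed

lemma relator_value:
  assumes "r \<in> coxeter_relators"
  shows "word_value B generator r = \<one>\<^bsub>B\<^esub>"
proof -
  have "act r x = x" if x: "x \<in> topspace X" for x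
  proof -
    have X: "generator v y \<in> topspace X" if "y \<in> topspace X" for v y
      using covers_in_X[OF generator(1) that] .
    have c: "act (a # u) y = generator (fst a) (act u y)" if "y \<in> topspace X" for a u y
      using act_append[OF that, of "[a]" u] act_letter[OF covers_in_X[OF covers_act that]] by (cases a) simp
    from assms consider v where "r = [(v, True), (v, True)]"
      | v w where "r = [(v, True), (w, True), (v, False), (w, False)]" "{v, w} \<in> Gamma_edges" by blast
    then show ?thesis
    proof cases
      case 1
      then show ?thesis using x by (simp add: c act_Nil generator_involution)
    next
      case 2
      obtain i where i: "in_torus i (circle_of v) (circle_of w)" using Gamma_edge_torus[OF 2(2)] .
      have "act r x = generator v (generator w (generator v (generator w x)))"
        using x 2 by (simp add: c act_Nil)
      also have "generator v (generator w x) = generator w (generator v x)" by (rule generators_commute[OF i x])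
      finally show ?thesis using x X by (simp add: generator_involution)
    qed
  qed
  then have "act r = (\<lambda>x\<in>topspace X. x)"
    using act_carrier[of r] by (intro extensionalityI[of _ "topspace X"]) (auto simp: BijGroup_def Bij_def)
  then show ?thesis by (simp add: act_def B_one)
qed

lemma action_exists:
  obtains \<phi> where "\<phi> \<in> hom W B" "\<And>u. \<phi> (W_class u) = act u"
proof -
  have gen: "generator s \<in> carrier B" if "s \<in> UNIV" for s by (rule generator_carrier)
  have rel: "word_value B generator r = \<one>\<^bsub>B\<^esub>" if "r \<in> coxeter_relators \<inter> words UNIV" for r
    using that by (intro relator_value) (rule IntD1)
  show ?thesis
  proof (rule presented_group_universal[OF group_BijGroup gen rel])
    fix \<phi> assume "\<phi> \<in> hom (presented_group UNIV coxeter_relators) B"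
      "\<And>u. u \<in> words UNIV \<Longrightarrow> \<phi> (word_class UNIV coxeter_relators u) = word_value B generator u"
    then show ?thesis
      by (intro that[of \<phi>]) (simp_all only: W_eq W_class_def act_def words_UNIV)
  qed
qed

lemma act_snoc: "act (u @ [(s, b)]) x0 = line (act u x0) (circle_of s) (unit_step (forward s \<noteq> flips u (circle_of s)))"
proof -
  have "act (u @ [(s, b)]) x0 = act u (line x0 (circle_of s) (unit_step (forward s)))"
    using act_append[of x0 u] act_letter[of x0] x0 by (simp add: generator(2))
  also have "\<dots> = line (act u x0) (circle_of s) (signed (flips u (circle_of s)) (unit_step (forward s)))"
    by (rule covers_line[OF covers_act x0])
  finally show ?thesis by (simp add: signed_unit_step)
qed

lemma act_x0_vertex: "act u x0 \<in> vertices"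
  using covers_vertices[OF covers_act x0] .

section \<open>Faithfulness on vertices\<close>

text \<open>Along an edge, the section given by \<open>cocycle_trivial\<close> is constant up to the midpoint
  and beyond it, and it is changed by \<open>cross\<close> at the midpoint.\<close>

lemma holonomy_exists:
  obtains h where "h x0 = (W_class [], \<lambda>l. False)" "\<And>x. x \<in> topspace X \<Longrightarrow> h x \<in> fibre"
    "\<And>x l b. x \<in> vertices \<Longrightarrow> h (line x l (unit_step b)) = cross l b (h x)"
proof -
  have "(W_class [], \<lambda>l. False) \<in> fibre" by simp
  then obtain h where h: "h x0 = (W_class [], \<lambda>l. False)" "\<And>x. x \<in> topspace X \<Longrightarrow> h x \<in> fibre"
    "\<And>x. x \<in> topspace X \<Longrightarrow> \<exists>O'. openin X O' \<and> x \<in> O' \<and> (\<forall>z \<in> O'. h z = transport (p x) (p z) (h x))"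
    using cocycle_trivial[OF holonomy_cocycle simply_connected locally_path_connected_X continuous_p] x0
      vertices_in_X by metis
  have fwd: "h (line x l 1) = cross l True (h x)" if x: "x \<in> vertices" for x l
  proof -
    let ?L = "line x l" and ?e = "\<lambda>t. cis (2 * pi * t)"
    let ?T = "\<lambda>t s f. if crossing (?e t) (?e s) then cross l (0 \<le> Im (?e t)) f else f"
    have T: "transport (circle_map l t) (circle_map l s) f = ?T t s f" for t s f
      by (cases l) (simp_all add: transport_def transport1_def circle_coord_circle_map crossing_def)
    have near: "\<exists>d>0. \<forall>s. dist s t < d \<longrightarrow> h (?L s) = ?T t s (h (?L t))" for t
    proof -
      have LX: "?L t \<in> topspace X" by (rule lifts_in_X[OF line(1)[OF x]])
      obtain O' where O': "openin X O'" "?L t \<in> O'" "\<forall>z \<in> O'. h z = transport (p (?L t)) (p z) (h (?L t))"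
        using h(3)[OF LX] by blast
      have "continuous_map euclidean X ?L" using line(1)[OF x] by (simp add: lifts_def)
      then have "openin euclidean {s \<in> topspace euclidean. ?L s \<in> O'}"
        using O'(1) by (rule openin_continuous_map_preimage)
      then have "open {s. ?L s \<in> O'}" by simp
      then obtain d where "d > 0" "\<forall>s. dist s t < d \<longrightarrow> ?L s \<in> O'" using O'(2) unfolding open_dist by blast
      have "h (?L s) = ?T t s (h (?L t))" if "dist s t < d" for s
      proof -
        have "h (?L s) = transport (p (?L t)) (p (?L s)) (h (?L t))"
          using O'(3) that \<open>\<forall>s. dist s t < d \<longrightarrow> ?L s \<in> O'\<close> by blast
        then show ?thesis unfolding lifts_p[OF line(1)[OF x]] T .
      qed
      then show ?thesis using \<open>d > 0\<close> by blast
    qed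
    have const: "h (?L a) = h (?L b)"
      if S: "connected S" "a \<in> S" "b \<in> S" and nc: "\<And>s t. s \<in> S \<Longrightarrow> t \<in> S \<Longrightarrow> \<not> crossing (?e t) (?e s)" for S a b
    proof (rule connected_local_const[OF S(1-3)], intro ballI)
      fix t assume t: "t \<in> S"
      obtain d where d: "d > 0" "\<forall>s. dist s t < d \<longrightarrow> h (?L s) = ?T t s (h (?L t))" using near by blast
      show "\<forall>\<^sub>F s in at t within S. h (?L t) = h (?L s)"
        unfolding eventually_at
      proof (intro exI[of _ d] conjI ballI impI d(1))
        fix s assume "s \<in> S" "s \<noteq> t \<and> dist s t < d"
        then show "h (?L t) = h (?L s)" using d(2) nc[OF \<open>s \<in> S\<close> t] by metis
      qed
    qed
    have sin_neg: "sin (2 * pi * t) < 0" if "1/2 < t" "t < 1" for t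
      using sin_gt_zero[of "2 * pi * (1 - t)"] that by (simp add: right_diff_distrib sin_diff)
    have "h (?L 0) = h (?L (1/2))"
    proof (rule const[of "{0..1/2}"])
      show "\<not> crossing (?e t) (?e s)" if "s \<in> {0..1/2}" "t \<in> {0..1/2}" for s t
        using sin_ge_zero[of "2 * pi * t"] sin_ge_zero[of "2 * pi * s"] that by (auto simp: crossing_def)
    qed auto
    moreover obtain d where d: "d > 0" "\<forall>s. dist s (1/2) < d \<longrightarrow> h (?L s) = ?T (1/2) s (h (?L (1/2)))"
      using near by blast
    \<comment> \<open>A point just beyond the midpoint, in the left half of the circle.\<close>
    define s where "s = 1/2 + min (d/2) (1/8)"
    have s: "1/2 < s" "s < 3/4" "dist s (1/2) < d" using d(1) by (auto simp: s_def dist_real_def)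
    have "cos (2 * pi * s) < 0"
    proof -
      have "2 * pi * (1/2) < 2 * pi * s" "2 * pi * s < 2 * pi * (3/4)"
        using s(1,2) by (intro mult_strict_left_mono; simp)+
      then have "0 < cos (2 * pi * s - pi)" by (intro cos_gt_zero_pi) (use pi_gt_zero in linarith)+
      then show ?thesis by (simp add: cos_diff)
    qed
    then have "crossing (?e (1/2)) (?e s)" using sin_neg[of s] s by (simp add: crossing_def)
    then have "h (?L s) = cross l True (h (?L (1/2)))" using d(2) s(3) by simp
    moreover have "h (?L s) = h (?L 1)"
    proof (rule const[of "{1/2<..1}"])
      show "\<not> crossing (?e b) (?e a)" if "a \<in> {1/2<..1}" "b \<in> {1/2<..1}" for a b
        using sin_neg[of a] sin_neg[of b] that by (cases "a = 1"; cases "b = 1") (auto simp: crossing_def)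
    qed (use s in auto)
    ultimately show ?thesis using line(2)[OF x] by simp
  qed
  have bwd: "h (line x l (-1)) = cross l False (h x)" if x: "x \<in> vertices" for x l
  proof -
    let ?y = "line x l (-1)"
    have y: "?y \<in> vertices" by (rule line_Ints_vertex[OF line(1)[OF x]]) simp
    have "line ?y l 1 = x" using line_eq[OF line(1)[OF x], of "-1" l 1] line(2)[OF x] by simp
    then have "cross l False (h x) = cross l (\<not> True) (cross l True (h ?y))" using fwd[OF y, of l] by simp
    also have "\<dots> = h ?y" using h(2)[OF vertices_in_X[OF y]] by (rule cross_back)
    finally show ?thesis by simp
  qed
  show ?thesis
  proof (rule that[of h])
    show "h (line x l (unit_step b)) = cross l b (h x)" if "x \<in> vertices" for x l b
      using fwd[OF that] bwd[OF that] by (cases b) (simp_all add: unit_step_def)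
  qed (fact h)+
qed

text \<open>The section has the value \<open>([u], flips u)\<close> at the vertex \<open>u x\<^sub>0\<close>: this follows by induction on
  \<open>u\<close>, because the vertices belonging to \<open>u\<close> and to \<open>u s\<close> are the ends of an edge.\<close>

lemma act_determines_class:
  assumes "act u x0 = act v x0"
  shows "W_class u = W_class v"
proof -
  obtain h where h: "h x0 = (W_class [], \<lambda>l. False)" "\<And>x. x \<in> topspace X \<Longrightarrow> h x \<in> fibre"
    "\<And>x l b. x \<in> vertices \<Longrightarrow> h (line x l (unit_step b)) = cross l b (h x)"
    using holonomy_exists by metis
  have "h (act u x0) = (W_class u, flips u)" for u
  proof (induction u rule: rev_induct)
    case Nil
    then show ?case using h(1) act_Nil x0 by simp
  next
    case (snoc a u)
    obtain s b where a: "a = (s, b)" by (cases a)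
    let ?l = "circle_of s" and ?f = "flips u (circle_of s)"
    have "h (act (u @ [a]) x0) = cross ?l (forward s \<noteq> ?f) (W_class u, flips u)"
      unfolding a act_snoc using h(3)[OF act_x0_vertex] snoc.IH by simp
    also have "\<dots> = (W_class u \<otimes>\<^bsub>W\<^esub> W_gen ?l ((forward s \<noteq> ?f) \<noteq> ?f), flips (u @ [a]))"
      unfolding a flips_snoc by (simp add: cross_def)
    also have "((forward s \<noteq> ?f) \<noteq> ?f) = forward s" by auto
    also have "W_gen ?l (forward s) = W_class [a]"
      unfolding W_gen_def a using W_class_letter[of s b] by simp
    finally show ?case by (simp add: W_class_mult)
  qed
  from this[of u] this[of v] show ?thesis using assms by simp
qed


section \<open>Transitivity on vertices\<close>

definition orbit :: "'a set" where
  "orbit = range (\<lambda>u. act u x0)"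

lemma orbit_unit_step: "x \<in> orbit \<Longrightarrow> line x l (unit_step b) \<in> orbit"
proof -
  assume "x \<in> orbit"
  then obtain u where u: "x = act u x0" by (auto simp: orbit_def)
  have "act (u @ [(vertex_of l (b \<noteq> flips u l), True)]) x0 = line x l (unit_step ((b \<noteq> flips u l) \<noteq> flips u l))"
    unfolding u act_snoc by simp
  also have "((b \<noteq> flips u l) \<noteq> flips u l) = b" by auto
  finally show ?thesis unfolding orbit_def by (metis rangeI)
qed

lemma orbit_line:
  assumes L: "lifts (circle_map l) L" and mn: "m \<in> \<int>" "n \<in> \<int>" and m: "L m \<in> orbit"
  shows "L n \<in> orbit"
proof -
  have step: "L (k + unit_step b) \<in> orbit" if "L k \<in> orbit" "k \<in> \<int>" for k b
    using orbit_unit_step[OF that(1), of l b] line_eq[OF L that(2)] by simp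
  have "L (m + of_int k) \<in> orbit" for k
  proof (induction k rule: int_induct[of _ 0])
    case base
    then show ?case using m by simp
  next
    case (step1 i)
    then show ?case using step[of "m + of_int i" True] mn by (simp add: unit_step_def add.assoc)
  next
    case (step2 i)
    then show ?case using step[of "m + of_int i" False] mn by (simp add: unit_step_def algebra_simps)
  qed
  moreover obtain k where "n - m = of_int k" using mn by (metis Ints_cases Ints_diff)
  ultimately show ?thesis by (metis add_diff_cancel_left' diff_add_cancel add.commute)
qed

lemma orbit_flat:
  assumes F: "lifts (flat_map i) F" and Z: "a \<in> \<int>" "b \<in> \<int>" "c \<in> \<int>" "d \<in> \<int>" and ab: "F (a, b) \<in> orbit"
  shows "F (c, d) \<in> orbit"
proof -
  have "F (c, b) \<in> orbit" by (rule orbit_line[OF flat_line_first[OF F Z(2)] Z(1,3) ab])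
  then show ?thesis by (rule orbit_line[OF flat_line_second[OF F Z(3)] Z(2,4)])
qed

text \<open>The two flats share a line over the common loop of the two tori, and this line contains
  lattice points of both.\<close>

lemma orbit_adjacent_flats:
  assumes ij: "second_circle i = first_circle j" and F: "lifts (flat_map i) F" and G: "lifts (flat_map j) G"
    and eq: "F (a, b) = G (c, d)" and Z: "a \<in> \<int>" "d \<in> \<int>" "b - c \<in> \<int>"
  shows "F (0, 0) \<in> orbit \<longleftrightarrow> G (0, 0) \<in> orbit"
proof -
  have L: "lifts (circle_map (first_circle j)) (\<lambda>u. F (a, u))"
    using flat_line_second[OF F Z(1)] ij by simp
  have "lifts (flat_map i) (\<lambda>z. F (z + (0, b - c)))"
    using flat_translate[OF F, of "(0, b - c)"] Z by simp
  from flat_line_second[OF this Z(1)] have L': "lifts (circle_map (first_circle j)) (\<lambda>u. F (a, u + (b - c)))"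
    using ij by simp
  have M: "lifts (circle_map (first_circle j)) (\<lambda>u. G (u, d))" by (rule flat_line_first[OF G Z(2)])
  have "(\<lambda>u. F (a, u + (b - c))) = (\<lambda>u. G (u, d))"
    by (rule lifts_unique[OF L' M, of c]) (use eq in simp)
  from fun_cong[OF this, of 0] have FG: "F (a, b - c) = G (0, d)" by simp
  show ?thesis
  proof
    assume "F (0, 0) \<in> orbit"
    then have "F (a, b - c) \<in> orbit" using orbit_flat[OF F, of 0 0 a "b - c"] Z by simp
    then show "G (0, 0) \<in> orbit" using orbit_flat[OF G, of 0 d 0 0] FG Z by simp
  next
    assume "G (0, 0) \<in> orbit"
    then have "G (0, d) \<in> orbit" using orbit_flat[OF G, of 0 0 0 d] Z by simp
    then show "F (0, 0) \<in> orbit" using orbit_flat[OF F, of a "b - c" 0 0] FG Z by simp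
  qed
qed

lemma orbit_same_torus:
  assumes F: "lifts (flat_map i) F" and G: "lifts (flat_map i) G" and eq: "F z = G w" and o: "F (0, 0) \<in> orbit"
  shows "G (0, 0) \<in> orbit"
proof -
  have "flat_map i z = flat_map i w" using lifts_p[OF F, of z] lifts_p[OF G, of w] eq by simp
  then have Z: "fst (z - w) \<in> \<int>" "snd (z - w) \<in> \<int>"
    unfolding flat_map_eq_iff by (metis coord_simps(1) fst_diff, metis coord_simps(2) snd_diff)
  have "(\<lambda>x. F (x + (z - w))) = G"
    by (rule lifts_unique[OF flat_translate[OF F Z] G, of w]) (use eq in simp)
  from fun_cong[OF this, of "(0, 0)"] have "G (0, 0) = F (z - w)" by (simp only: zero_prod_def[symmetric] add_0)
  moreover have "F (fst (z - w), snd (z - w)) \<in> orbit"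
    by (rule orbit_flat[OF F _ _ Z o]) simp_all
  ultimately show ?thesis by (simp only: prod.collapse)
qed

text \<open>Points with equal coordinates in \<open>T1\<close> and \<open>T3\<close> are lattice points of both flats.\<close>

lemma orbit_flats_meeting:
  assumes F: "lifts (flat_map i) F" and G: "lifts (flat_map j) G" and eq: "F z = G w" and o: "F (0, 0) \<in> orbit"
  shows "G (0, 0) \<in> orbit"
proof -
  obtain a b c d where zw: "z = (a, b)" "w = (c, d)" by (metis surj_pair)
  have "flat_map i z = flat_map j w" using lifts_p[OF F, of z] lifts_p[OF G, of w] eq by simp
  then have co: "coord i (a, b) l - coord j (c, d) l \<in> \<int>" for l
    unfolding flat_map_eq_iff zw by blast
  have lattice: "G (0, 0) \<in> orbit" if "a \<in> \<int>" "b \<in> \<int>"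
  proof -
    have "flat_map i (a, b) = origin" using that by (simp add: flat_map_eq_origin_iff)
    then have "flat_map j (c, d) = origin" using \<open>flat_map i z = flat_map j w\<close> zw by simp
    then have cd: "c \<in> \<int>" "d \<in> \<int>" by (simp_all add: flat_map_eq_origin_iff)
    have "F (a, b) \<in> orbit" using orbit_flat[OF F, of 0 0 a b] that o by simp
    then show ?thesis using orbit_flat[OF G, of c d 0 0] cd eq zw by simp
  qed
  show ?thesis
  proof (cases "i = j")
    case True
    then have "lifts (flat_map i) G" using G by simp
    from orbit_same_torus[of i F G z w, OF F this eq o] show ?thesis .
  next
    case False
    then consider "(i, j) \<in> {(T1, T2), (T2, T3)}" | "(j, i) \<in> {(T1, T2), (T2, T3)}"
      | "(i, j) \<in> {(T1, T3), (T3, T1)}"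
      by (cases i; cases j) auto
    then show ?thesis
    proof cases
      case 1
      then have "second_circle i = first_circle j" by auto
      moreover have "a \<in> \<int>" "d \<in> \<int>" "b - c \<in> \<int>"
        using 1 co[of "first_circle i"] co[of "second_circle j"] co[of "second_circle i"] by (auto simp: coord_def)
      ultimately show ?thesis using orbit_adjacent_flats[OF _ F G, of a b c d] eq zw o by simp
    next
      case 2
      then have "second_circle j = first_circle i" by auto
      moreover have "c \<in> \<int>" "b \<in> \<int>" "a - d \<in> \<int>"
        using 2 co[of "first_circle j"] co[of "second_circle i"] co[of "second_circle j"] by (auto simp: coord_def)
      then have "d - a \<in> \<int>" by (metis Ints_minus minus_diff_eq)
      ultimately show ?thesis using orbit_adjacent_flats[OF _ G F, of c d a b] eq zw o
          \<open>c \<in> \<int>\<close> \<open>b \<in> \<int>\<close> by simp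
    next
      case 3
      then have "a \<in> \<int>" "b \<in> \<int>"
        using co[of "first_circle i"] co[of "second_circle i"] by (auto simp: coord_def)
      then show ?thesis by (rule lattice)
    qed
  qed
qed

lemma flat_corner_in_orbit:
  assumes F: "lifts (flat_map i) F"
  shows "F (0, 0) \<in> orbit"
proof -
  have x0': "x0 \<in> orbit" using act_Nil[of x0] x0 unfolding orbit_def by (metis rangeI vertices_in_X)
  have "flat_linked x0 (F (0, 0))" using flat_linked_X x0 lifts_in_X[OF F] by simp
  then have "\<forall>j G w. lifts (flat_map j) G \<longrightarrow> G w = F (0, 0) \<longrightarrow> G (0, 0) \<in> orbit"
  proof (induction rule: rtranclp_induct)
    case base
    show ?case
    proof (intro allI impI)
      fix j G w assume G: "lifts (flat_map j) G" "G w = x0"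
      have "flat_map j (fst w, snd w) = origin" using lifts_p[OF G(1), of w] G(2) vertices_p[OF x0] by simp
      then have "fst w \<in> \<int>" "snd w \<in> \<int>" unfolding flat_map_eq_origin_iff by auto
      then show "G (0, 0) \<in> orbit" using orbit_flat[OF G(1), of "fst w" "snd w" 0 0] G(2) x0' by simp
    qed
  next
    case (step y z)
    then obtain i H a b where H: "lifts (flat_map i) H" "H a = y" "H b = z" unfolding flat_step_def by blast
    then have "H (0, 0) \<in> orbit" using step.IH by blast
    then show ?case using orbit_flats_meeting[OF H(1)] H(3) by metis
  qed
  then show ?thesis using F by blast
qed

section \<open>The action is geometric\<close>

definition base_flat :: "torus \<Rightarrow> real \<times> real \<Rightarrow> 'a" where
  "base_flat i = (SOME F. lifts (flat_map i) F \<and> F (0, 0) = x0)"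

lemma base_flat: "lifts (flat_map i) (base_flat i)" "base_flat i (0, 0) = x0"
proof -
  have "p x0 = flat_map i (0, 0)" using vertices_p[OF x0] flat_map_eq_origin_iff[of i 0 0] by simp
  then obtain F where "lifts (flat_map i) F" "F (0, 0) = x0"
    using lifts_exist[OF continuous_flat_map] x0 by (metis vertices_in_X)
  then have "lifts (flat_map i) (base_flat i) \<and> base_flat i (0, 0) = x0"
    unfolding base_flat_def by (intro someI[of "\<lambda>F. lifts (flat_map i) F \<and> F (0, 0) = x0" F]) simp
  then show "lifts (flat_map i) (base_flat i)" "base_flat i (0, 0) = x0" by auto
qed

text \<open>The squares on all four sides of \<open>x0\<close> in each flat are needed, because an element of
  \<open>W\<close> may reverse the axes of a flat.\<close>

definition chamber :: "'a set" where
  "chamber = (\<Union>i. base_flat i ` ({-1..1} \<times> {-1..1}))"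

lemma chamber_covers:
  assumes x: "x \<in> topspace X"
  obtains u where "x \<in> act u ` chamber"
proof -
  obtain i z where z: "p x = flat_map i z" using Y_spaceE[OF p_in_Y[OF x]] .
  obtain F where F: "lifts (flat_map i) F" "F z = x" by (rule lifts_exist[OF continuous_flat_map x z])
  define n :: "real \<times> real" where "n = (of_int \<lfloor>fst z\<rfloor>, of_int \<lfloor>snd z\<rfloor>)"
  have n: "fst n \<in> \<int>" "snd n \<in> \<int>" by (simp_all add: n_def)
  have "F (fst n, snd n) \<in> orbit"
    using orbit_flat[OF F(1), of 0 0 "fst n" "snd n"] n flat_corner_in_orbit[OF F(1)] by simp
  then obtain u where u: "F n = act u x0" by (auto simp: orbit_def)
  have "(\<lambda>z. F (z + n)) = (\<lambda>z. act u (base_flat i (flip_coords (flips u) i z)))"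
    by (rule lifts_unique[OF flat_translate[OF F(1) n] covers_flat[OF covers_act base_flat(1)], of "(0, 0)"])
      (simp add: u base_flat(2) flip_coords_def plus_prod_def n_def flip: u)
  then have "F ((z - n) + n) = act u (base_flat i (flip_coords (flips u) i (z - n)))" by (rule fun_cong)
  then have x_eq: "x = act u (base_flat i (flip_coords (flips u) i (z - n)))" using F(2) by simp
  have "fst (z - n) \<in> {0..1}" "snd (z - n) \<in> {0..1}"
    using frac_ge_0[of "fst z"] frac_lt_1[of "fst z"] frac_ge_0[of "snd z"] frac_lt_1[of "snd z"]
    by (simp_all add: n_def frac_def)
  then have "flip_coords (flips u) i (z - n) \<in> {-1..1} \<times> {-1..1}" by (rule flip_coords_unit_square)
  then have "base_flat i (flip_coords (flips u) i (z - n)) \<in> chamber"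
    unfolding chamber_def by (intro UN_I[OF UNIV_I[of i]] imageI)
  then have "x \<in> act u ` chamber" unfolding x_eq by (rule imageI)
  then show ?thesis by (rule that)
qed

lemma D_flat_Lipschitz:
  assumes F: "lifts (flat_map i) F" and zw: "dist z w < 1"
  shows "D (F z) (F w) \<le> 2 * dist z w"
proof -
  let ?\<gamma> = "\<lambda>t. (1 - t) *\<^sub>R z + t *\<^sub>R w"
  have "Y_dist (flat_map i (?\<gamma> s)) (flat_map i (?\<gamma> t)) \<le> 2 * (dist z w * (t - s))"
    if st: "0 \<le> s" "s \<le> t" "t \<le> 1" for s t
  proof -
    have "dist z w * (t - s) \<le> dist z w * 1" using st by (intro mult_left_mono) auto
    then show ?thesis using flat_map_Lipschitz[of "?\<gamma> s" "?\<gamma> t" i] zw by (simp add: dist_on_segment[OF st(2)])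
  qed
  note seg = flat_segment[OF F _ this]
  show ?thesis by (rule D_le[OF seg(1) _ _ seg(2)]) simp_all
qed

sublocale XD: Metric_space "topspace X" D
  by (rule D_Metric_space)

lemma chamber_compact: "compactin XD.mtopology chamber"
  unfolding chamber_def
proof (intro compactin_UN_torus image_compactin)
  fix i
  show "continuous_map euclidean XD.mtopology (base_flat i)"
    using lifts_in_X[OF base_flat(1)] D_flat_Lipschitz[OF base_flat(1)]
    by (intro continuous_map_into_metric[OF D_Metric_space, where L = 2])
qed (auto simp: compact_Times)

text \<open>For discontinuity, let \<open>C\<close> be a finite net in the compact set. An element that moves the set to
  meet itself moves some \<open>c \<in> C\<close> close to some \<open>c' \<in> C\<close>; and there is at most one such element that
  reverses a given set of loops, because these loops determine the point of \<open>Y\<close> under the image of \<open>c\<close>.\<close>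

theorem geometric_action_exists:
  "\<exists>\<phi>. geometric_action W (topspace X) D \<phi>"
proof -
  obtain \<phi> where \<phi>: "\<phi> \<in> hom W B" "\<And>u. \<phi> (W_class u) = act u" using action_exists by blast
  have grp: "group_action W (topspace X) \<phi>"
    by (intro group_action.intro group_hom.intro group_hom_axioms.intro group_W group_BijGroup \<phi>(1))
  have iso: "D (\<phi> g x) (\<phi> g y) = D x y" if g: "g \<in> carrier W" and xy: "x \<in> topspace X" "y \<in> topspace X" for g x y
  proof -
    obtain u where u: "g = W_class u" by (rule W_carrierE[OF g])
    have "inv\<^bsub>W\<^esub> g \<in> carrier W" using group.inv_closed[OF group_W g] .
    then obtain v where v: "inv\<^bsub>W\<^esub> g = W_class v" by (rule W_carrierE)
    have "W_class (v @ u) = W_class []"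
      using group.l_inv[OF group_W g] unfolding v unfolding u W_class_mult W_class_one .
    then have "act (v @ u) = act []" using \<phi>(2) by metis
    then have "act v (act u z) = z" if "z \<in> topspace X" for z
      using act_append[OF that] act_Nil[OF that] by metis
    then show ?thesis
      unfolding u \<phi>(2) by (rule covers_isometry[OF covers_act covers_act _ xy])
  qed
  have faithful: "g = h"
    if g: "g \<in> carrier W" and h: "h \<in> carrier W" and c: "covers \<sigma> (\<phi> g)" "covers \<sigma> (\<phi> h)"
      and x: "x \<in> topspace X" "\<phi> g x = \<phi> h x" for g h \<sigma> x
  proof -
    obtain u v where uv: "g = W_class u" "h = W_class v" using W_carrierE[OF g] W_carrierE[OF h] by metis
    have "\<phi> g x0 = \<phi> h x0" by (rule covers_unique[OF c x]) (use x0 in simp)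
    then show ?thesis unfolding uv \<phi>(2) by (rule act_determines_class)
  qed
  obtain r where r: "r > 0"
    "\<And>x y. x \<in> topspace X \<Longrightarrow> y \<in> topspace X \<Longrightarrow> p x = p y \<Longrightarrow> D x y < r \<Longrightarrow> x = y"
    using fibres_uniformly_separated by metis
  have proper: "finite {g \<in> carrier W. \<phi> g ` K \<inter> K \<noteq> {}}" if K: "compactin XD.mtopology K" for K
  proof -
    have "XD.mtotally_bounded K" using K by (rule XD.compactin_imp_mtotally_bounded)
    then obtain C where C: "finite C" "C \<subseteq> K" "K \<subseteq> (\<Union>c\<in>C. XD.mball c (r/4))"
      using r(1) unfolding XD.mtotally_bounded_def by (metis divide_pos_pos zero_less_numeral)
    have KX: "K \<subseteq> topspace X" using compactin_subset_topspace[OF K] by simp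
    define P where "P = (\<lambda>(c, c', S). {g \<in> carrier W. covers (\<lambda>l. l \<in> S) (\<phi> g) \<and> D (\<phi> g c) c' < r/2})"
    have fin: "finite (P a)" if a: "a \<in> C \<times> C \<times> UNIV" for a
    proof -
      obtain c c' S where acS: "a = (c, c', S)" "c \<in> C" "c' \<in> C" using a by auto
      have cX: "c \<in> topspace X" "c' \<in> topspace X" using acS C(2) KX by auto
      have "g = h" if "g \<in> P a" "h \<in> P a" for g h
      proof -
        have g: "g \<in> carrier W" "covers (\<lambda>l. l \<in> S) (\<phi> g)" "D (\<phi> g c) c' < r/2"
          and h: "h \<in> carrier W" "covers (\<lambda>l. l \<in> S) (\<phi> h)" "D (\<phi> h c) c' < r/2"
          using that unfolding P_def acS(1) by auto
        have X: "\<phi> g c \<in> topspace X" "\<phi> h c \<in> topspace X"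
          using covers_in_X[OF g(2) cX(1)] covers_in_X[OF h(2) cX(1)] .
        have "D (\<phi> g c) (\<phi> h c) < r"
          using XD.triangle[OF X(1) cX(2) X(2)] XD.commute[of c' "\<phi> h c"] g(3) h(3) by linarith
        moreover have "p (\<phi> g c) = p (\<phi> h c)" using covers_p[OF g(2) cX(1)] covers_p[OF h(2) cX(1)] by simp
        ultimately have "\<phi> g c = \<phi> h c" using r(2)[OF X] by blast
        then show ?thesis using faithful[OF g(1) h(1) g(2) h(2) cX(1)] by blast
      qed
      then show ?thesis by (metis finite.simps finite_subset insertI1 subsetI singletonD)
    qed
    have "{g \<in> carrier W. \<phi> g ` K \<inter> K \<noteq> {}} \<subseteq> (\<Union>a \<in> C \<times> C \<times> UNIV. P a)"
    proof
      fix g assume "g \<in> {g \<in> carrier W. \<phi> g ` K \<inter> K \<noteq> {}}"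
      then obtain z where g: "g \<in> carrier W" and z: "z \<in> K" "\<phi> g z \<in> K" by blast
      obtain u where u: "g = W_class u" by (rule W_carrierE[OF g])
      obtain c where c: "c \<in> C" "c \<in> topspace X" "z \<in> topspace X" "D c z < r/4" using C(3) z(1) by auto
      obtain c' where c': "c' \<in> C" "c' \<in> topspace X" "\<phi> g z \<in> topspace X" "D c' (\<phi> g z) < r/4" using C(3) z(2) by auto
      have cov: "covers (\<lambda>l. l \<in> {l. flips u l}) (\<phi> g)" using covers_act[of u] by (simp add: u \<phi>(2))
      have "D (\<phi> g c) c' \<le> D (\<phi> g c) (\<phi> g z) + D (\<phi> g z) c'"
        by (rule XD.triangle[OF covers_in_X[OF cov c(2)] c'(3) c'(2)])
      also have "\<dots> < r/2"
        using iso[OF g c(2,3)] c(4) c'(4) XD.commute[of c' "\<phi> g z"] by linarith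
      finally have "g \<in> P (c, c', {l. flips u l})" using g cov unfolding P_def by simp
      then show "g \<in> (\<Union>a \<in> C \<times> C \<times> UNIV. P a)" using c(1) c'(1) by blast
    qed
    moreover have "finite (\<Union>a \<in> C \<times> C \<times> (UNIV :: circle set set). P a)"
    proof (rule finite_UN_I)
      have "(UNIV :: circle set) = {CA, CB, CC, CD}" using circle.exhaust by auto
      then have "finite (UNIV :: circle set)" by (metis finite.emptyI finite.insertI)
      then have "finite (UNIV :: circle set set)" by (metis Pow_UNIV finite_Pow_iff)
      then show "finite (C \<times> C \<times> (UNIV :: circle set set))" using C(1) by blast
    qed (rule fin)
    ultimately show ?thesis by (rule finite_subset)
  qed
  have cocompact: "(\<Union>g \<in> carrier W. \<phi> g ` chamber) = topspace X"
  proof (intro equalityI subsetI)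
    fix x assume "x \<in> (\<Union>g \<in> carrier W. \<phi> g ` chamber)"
    then obtain g z where g: "g \<in> carrier W" and z: "z \<in> chamber" "x = \<phi> g z" by blast
    obtain u where u: "g = W_class u" by (rule W_carrierE[OF g])
    have "z \<in> topspace X" using compactin_subset_topspace[OF chamber_compact] z(1) by auto
    then show "x \<in> topspace X" using covers_in_X[OF covers_act[of u]] z(2) unfolding u \<phi>(2) by simp
  next
    fix x assume "x \<in> topspace X"
    then obtain u where "x \<in> act u ` chamber" by (rule chamber_covers)
    then have "x \<in> \<phi> (W_class u) ` chamber" unfolding \<phi>(2) .
    then show "x \<in> (\<Union>g \<in> carrier W. \<phi> g ` chamber)" by (rule UN_I[OF W_class_carrier])
  qed
  show ?thesis
    unfolding geometric_action_def
    by (intro exI[of _ \<phi>] exI[of _ chamber] conjI ballI allI impI D_Metric_space grp iso proper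
        chamber_compact cocompact)
qed

end

theorem mainTheorem3:
  fixes X :: "'x topology" and p :: "'x \<Rightarrow> square_point set"
  assumes "universal_cover X Y_topology p"
  shows "\<exists>\<phi>. geometric_action (right_angled_coxeter_group UNIV Gamma_edges)
               (topspace X) (induced_length_dist X p Y_dist) \<phi>"
proof -
  interpret croke_kleiner X p by unfold_locales (rule assms)
  have "origin \<in> p ` topspace X" using covering_map_surj[OF covering] by simp
  then obtain x0 where "x0 \<in> vertices" by (auto simp: vertices_def)
  then interpret croke_kleiner_based X p x0 by unfold_locales
  show ?thesis by (rule geometric_action_exists)
qed

end
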